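(* Let $\mathfrak{H}$ be a Hilbert space and let $\mathfrak{B}$ be either a nest algebra $\mathcal{T}(\mathcal{N})$ or a quasi-triangular algebra $\mathcal{T}(\mathcal{N})+K$ on $\mathfrak{H}$, where $\mathcal{N}$ is a nest of closed subspaces of $\mathfrak{H}$. Then every flow on $\mathfrak{B}$ is uniformly continuous. Moreover, any two flows on $\mathfrak{B}$ are cocycle perturbations of each other.
   Context: A nest $\mathcal{N}$ on a Hilbert space $\mathfrak{H}$ is a chain of closed subspaces of $\mathfrak{H}$ containing $\{0\}$ and $\mathfrak{H}$ which is closed under taking arbitrary intersections and closed spans. The nest algebra $\mathcal{T}(\mathcal{N})$ is the set of all $T\in B(\mathfrak{H})$ leaving each element of $\mathcal{N}$ invariant. The quasi-triangular algebra of $\mathcal{N}$ is $\mathcal{T}(\mathcal{N})+K$, where $K$ is the ideal of compact operators on $\mathfrak{H}$. Both are Banach algebras under the operator norm. A flow $\alpha$ on a Banach algebra $\mathfrak{B}$ is a group homomorphism $t\mapsto\alpha_t$ from $\mathbb{R}$ into the group of bounded automorphisms of $\mathfrak{B}$ such that $\lim_{t\to t_0}\|\alpha_t(B)-\alpha_{t_0}(B)\|=0$ for each $t_0\in\mathbb{R}$ and each $B\in\mathfrak{B}$. It is uniformly continuous if $\lim_{t\to t_0}\|\alpha_t-\alpha_{t_0}\|=0$ (operator norm) for each $t_0\in\mathbb{R}$. An $\alpha$-cocycle is a (norm-)continuous map $t\mapsto u_t$ from $\mathbb{R}$ into the group of invertible elements of $\mathfrak{B}$ such that $u_s\alpha_s(u_t)=u_{s+t}$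 for all $s,t\in\mathbb{R}$. A flow $\beta$ is a cocycle perturbation of $\alpha$ if there is an $\alpha$-cocycle $u$ with $\beta_t(B)=u_t\alpha_t(B)u_t^{-1}$ for all $t\in\mathbb{R}$, $B\in\mathfrak{B}$. *)

theory Defs
  imports "HOL-Analysis.Analysis"
begin

text \<open>The underlying real Banach space (norm, distance, topology, real scalars) is inherited from
  the class \<open>banach\<close>; the complex scalars extend the real ones and the norm comes from the inner
  product, which is linear in its first argument.\<close>

class chilbert_space = banach +
  fixes scaleC :: "complex \<Rightarrow> 'a \<Rightarrow> 'a"  (infixr \<open>*\<^sub>C\<close> 75)
    and cinner :: "'a \<Rightarrow> 'a \<Rightarrow> complex"
  assumes scaleC_add_right: "a *\<^sub>C (x + y) = a *\<^sub>C x + a *\<^sub>C y"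
    and scaleC_add_left: "(a + b) *\<^sub>C x = a *\<^sub>C x + b *\<^sub>C x"
    and scaleC_scaleC: "a *\<^sub>C b *\<^sub>C x = (a * b) *\<^sub>C x"
    and scaleC_complex_of_real: "complex_of_real r *\<^sub>C x = r *\<^sub>R x"
    and cinner_commute: "cinner x y = cnj (cinner y x)"
    and cinner_add_left: "cinner (x + y) z = cinner x z + cinner y z"
    and cinner_scaleC_left: "cinner (a *\<^sub>C x) y = a * cinner x y"
    and norm_eq_sqrt_cinner: "norm x = sqrt (Re (cinner x x))"

text \<open>There is no positivity axiom for \<open>cinner\<close>, because positive definiteness follows from
  \<open>norm_eq_sqrt_cinner\<close>.\<close>

lemma cinner_self: "cinner x x = complex_of_real ((norm x)\<^sup>2)"
  for x :: "'a::chilbert_space"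
proof -
  have "0 \<le> Re (cinner x x)"
    using norm_ge_zero[of x] unfolding norm_eq_sqrt_cinner[of x] by simp
  hence "Re (cinner x x) = (norm x)\<^sup>2"
    by (simp add: norm_eq_sqrt_cinner)
  moreover have "Im (cinner x x) = 0"
    using arg_cong[OF cinner_commute[of x x], of Im] by simp
  ultimately show ?thesis
    by (simp add: complex_eq_iff)
qed

lemma norm_scaleC: "norm (a *\<^sub>C x) = cmod a * norm x"
  for x :: "'a::chilbert_space"
proof -
  have "cinner (a *\<^sub>C x) (a *\<^sub>C x) = a * cnj a * cinner x x"
    using cinner_commute[of x "a *\<^sub>C x"] cinner_commute[of x x]
    by (simp only: cinner_scaleC_left complex_cnj_mult mult.assoc)
  also have "\<dots> = complex_of_real ((cmod a * norm x)\<^sup>2)"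
    by (simp only: cinner_self complex_norm_square[symmetric] power_mult_distrib
        of_real_mult of_real_power)
  finally have "complex_of_real ((norm (a *\<^sub>C x))\<^sup>2) = complex_of_real ((cmod a * norm x)\<^sup>2)"
    by (simp only: cinner_self)
  hence "(norm (a *\<^sub>C x))\<^sup>2 = (cmod a * norm x)\<^sup>2"
    by (simp only: of_real_eq_iff)
  thus ?thesis
    by (simp add: power2_eq_iff_nonneg)
qed

global_interpretation complex_vector:
  vector_space "scaleC :: complex \<Rightarrow> 'a \<Rightarrow> 'a::chilbert_space"
  defines csubspace = complex_vector.subspace
    and cspan = complex_vector.span
proof
  show "1 *\<^sub>C x = x" for x :: 'a
    using scaleC_complex_of_real[of 1 x] by simp
qed (auto simp: scaleC_add_right scaleC_add_left scaleC_scaleC)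

text \<open>The library type of bounded linear maps over the reals carries the operator norm and
  composition; \<open>B(H)\<close> consists of its complex-linear members.\<close>

definition bounded_operators :: "('a::chilbert_space \<Rightarrow>\<^sub>L 'a) set"
  where "bounded_operators = {T. Vector_Spaces.linear scaleC scaleC (blinfun_apply T)}"

lift_definition blinfun_scaleC :: "complex \<Rightarrow> ('a::chilbert_space \<Rightarrow>\<^sub>L 'a) \<Rightarrow> ('a \<Rightarrow>\<^sub>L 'a)"
  is "\<lambda>c T x. c *\<^sub>C T x"
proof -
  fix c :: complex and T :: "'a \<Rightarrow> 'a"
  assume T: "bounded_linear T"
  have "bounded_linear (\<lambda>x::'a. c *\<^sub>C x)"
  proof (rule bounded_linear_intro[where K = "cmod c"])
    show "c *\<^sub>C r *\<^sub>R x = r *\<^sub>R c *\<^sub>C x" for r and x :: 'a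
      by (simp add: scaleC_complex_of_real[symmetric] scaleC_scaleC mult.commute)
  qed (simp_all add: scaleC_add_right norm_scaleC mult.commute)
  thus "bounded_linear (\<lambda>x. c *\<^sub>C T x)"
    using T by (rule bounded_linear_compose)
qed

definition compact_operators :: "('a::chilbert_space \<Rightarrow>\<^sub>L 'a) set"
  where "compact_operators =
    {T \<in> bounded_operators. compact (closure (blinfun_apply T ` cball 0 1))}"

definition nest :: "'a::chilbert_space set set \<Rightarrow> bool"
  where "nest N \<longleftrightarrow>
    (\<forall>M\<in>N. csubspace M \<and> closed M) \<and>
    (\<forall>L\<in>N. \<forall>M\<in>N. L \<subseteq> M \<or> M \<subseteq> L) \<and>
    {0} \<in> N \<and> UNIV \<in> N \<and>
    (\<forall>F\<subseteq>N. \<Inter>F \<in> N \<and> closure (cspan (\<Union>F)) \<in> N)"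

definition nest_algebra :: "'a::chilbert_space set set \<Rightarrow> ('a \<Rightarrow>\<^sub>L 'a) set"
  where "nest_algebra N = {T \<in> bounded_operators. \<forall>M\<in>N. blinfun_apply T ` M \<subseteq> M}"

definition quasitriangular_algebra :: "'a::chilbert_space set set \<Rightarrow> ('a \<Rightarrow>\<^sub>L 'a) set"
  where "quasitriangular_algebra N = {S + T | S T. S \<in> nest_algebra N \<and> T \<in> compact_operators}"

text \<open>Below, \<open>B\<close> is an algebra of bounded operators that contains the identity. Maps on
  \<open>B\<close> are represented by total functions, whose values outside \<open>B\<close> are irrelevant.\<close>

definition bounded_automorphism ::
    "('a::chilbert_space \<Rightarrow>\<^sub>L 'a) set \<Rightarrow> (('a \<Rightarrow>\<^sub>L 'a) \<Rightarrow> ('a \<Rightarrow>\<^sub>L 'a)) \<Rightarrow> bool"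
  where "bounded_automorphism B \<phi> \<longleftrightarrow>
    bij_betw \<phi> B B \<and>
    (\<forall>S\<in>B. \<forall>T\<in>B. \<phi> (S + T) = \<phi> S + \<phi> T) \<and>
    (\<forall>c. \<forall>T\<in>B. \<phi> (blinfun_scaleC c T) = blinfun_scaleC c (\<phi> T)) \<and>
    (\<forall>S\<in>B. \<forall>T\<in>B. \<phi> (S o\<^sub>L T) = \<phi> S o\<^sub>L \<phi> T) \<and>
    (\<exists>K. \<forall>T\<in>B. norm (\<phi> T) \<le> K * norm T)"

definition flow ::
    "('a::chilbert_space \<Rightarrow>\<^sub>L 'a) set \<Rightarrow> (real \<Rightarrow> ('a \<Rightarrow>\<^sub>L 'a) \<Rightarrow> ('a \<Rightarrow>\<^sub>L 'a)) \<Rightarrow> bool"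
  where "flow B \<alpha> \<longleftrightarrow>
    (\<forall>t. bounded_automorphism B (\<alpha> t)) \<and>
    (\<forall>s t. \<forall>T\<in>B. \<alpha> (s + t) T = \<alpha> s (\<alpha> t T)) \<and>
    (\<forall>t\<^sub>0. \<forall>T\<in>B. ((\<lambda>t. norm (\<alpha> t T - \<alpha> t\<^sub>0 T)) \<longlongrightarrow> 0) (at t\<^sub>0))"

text \<open>The analogue of the library's \<open>onorm\<close> for a map defined on \<open>B\<close> only. The supremum is
  meaningful for bounded maps, in particular for differences of bounded automorphisms.\<close>

definition onorm_on ::
    "('a::chilbert_space \<Rightarrow>\<^sub>L 'a) set \<Rightarrow> (('a \<Rightarrow>\<^sub>L 'a) \<Rightarrow> ('a \<Rightarrow>\<^sub>L 'a)) \<Rightarrow> real"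
  where "onorm_on B \<phi> = (SUP T\<in>B. norm (\<phi> T) / norm T)"

definition uniformly_continuous_flow ::
    "('a::chilbert_space \<Rightarrow>\<^sub>L 'a) set \<Rightarrow> (real \<Rightarrow> ('a \<Rightarrow>\<^sub>L 'a) \<Rightarrow> ('a \<Rightarrow>\<^sub>L 'a)) \<Rightarrow> bool"
  where "uniformly_continuous_flow B \<alpha> \<longleftrightarrow> flow B \<alpha> \<and>
    (\<forall>t\<^sub>0. ((\<lambda>t. onorm_on B (\<lambda>T. \<alpha> t T - \<alpha> t\<^sub>0 T)) \<longlongrightarrow> 0) (at t\<^sub>0))"

definition is_inverse_in ::
    "('a::chilbert_space \<Rightarrow>\<^sub>L 'a) set \<Rightarrow> ('a \<Rightarrow>\<^sub>L 'a) \<Rightarrow> ('a \<Rightarrow>\<^sub>L 'a) \<Rightarrow> bool"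
  where "is_inverse_in B U V \<longleftrightarrow> V \<in> B \<and> U o\<^sub>L V = id_blinfun \<and> V o\<^sub>L U = id_blinfun"

definition invertibles :: "('a::chilbert_space \<Rightarrow>\<^sub>L 'a) set \<Rightarrow> ('a \<Rightarrow>\<^sub>L 'a) set"
  where "invertibles B = {U \<in> B. \<exists>V. is_inverse_in B U V}"

definition inverse_in ::
    "('a::chilbert_space \<Rightarrow>\<^sub>L 'a) set \<Rightarrow> ('a \<Rightarrow>\<^sub>L 'a) \<Rightarrow> ('a \<Rightarrow>\<^sub>L 'a)"
  where "inverse_in B U = (THE V. is_inverse_in B U V)"

lemma inverse_in_eq:
  assumes "is_inverse_in B U V"
  shows "inverse_in B U = V"
  unfolding inverse_in_def
proof (rule the_equality)
  show "is_inverse_in B U V" by fact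
next
  fix W assume "is_inverse_in B U W"
  hence UW: "blinfun_apply U (blinfun_apply W x) = x" for x
    by (metis is_inverse_in_def blinfun_apply_blinfun_compose blinfun_apply_id_blinfun)
  have VU: "blinfun_apply V (blinfun_apply U x) = x" for x
    using assms
    by (metis is_inverse_in_def blinfun_apply_blinfun_compose blinfun_apply_id_blinfun)
  show "W = V"
    by (rule blinfun_eqI) (metis UW VU)
qed

definition cocycle ::
    "('a::chilbert_space \<Rightarrow>\<^sub>L 'a) set \<Rightarrow> (real \<Rightarrow> ('a \<Rightarrow>\<^sub>L 'a) \<Rightarrow> ('a \<Rightarrow>\<^sub>L 'a)) \<Rightarrow>
      (real \<Rightarrow> ('a \<Rightarrow>\<^sub>L 'a)) \<Rightarrow> bool"
  where "cocycle B \<alpha> u \<longleftrightarrow>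
    (\<forall>t. u t \<in> invertibles B) \<and>
    continuous_on UNIV u \<and>
    (\<forall>s t. u s o\<^sub>L \<alpha> s (u t) = u (s + t))"

definition cocycle_perturbation ::
    "('a::chilbert_space \<Rightarrow>\<^sub>L 'a) set \<Rightarrow> (real \<Rightarrow> ('a \<Rightarrow>\<^sub>L 'a) \<Rightarrow> ('a \<Rightarrow>\<^sub>L 'a)) \<Rightarrow>
      (real \<Rightarrow> ('a \<Rightarrow>\<^sub>L 'a) \<Rightarrow> ('a \<Rightarrow>\<^sub>L 'a)) \<Rightarrow> bool"
  where "cocycle_perturbation B \<alpha> \<beta> \<longleftrightarrow>
    (\<exists>u. cocycle B \<alpha> u \<and>
      (\<forall>t. \<forall>T\<in>B. \<beta> t T = u t o\<^sub>L \<alpha> t T o\<^sub>L inverse_in B (u t)))"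

end

theory Submission
  imports Defs
begin

text \<open>A flow converges uniformly on rank-one operators: from badly converging \<open>x\<^sub>i \<otimes> u\<^sub>i\<close> one builds an
  operator \<open>T = \<Sum>\<^sub>i e\<^sub>i \<otimes> u\<^sub>i\<close> of the algebra, and \<open>(x\<^sub>i \<otimes> e\<^sub>i) T = x\<^sub>i \<otimes> u\<^sub>i\<close> together with multiplicativity
  gives a contradiction. Products with rank-one operators transport this to the whole algebra, so
  the flow is uniformly continuous and its generator is a bounded derivation \<open>\<delta>\<close>. The formula
  \<open>X x = \<delta>(x \<otimes> f) f\<close> makes \<open>\<delta>\<close> the commutator with a bounded operator \<open>X\<close>, and \<open>X\<close> lies in the algebra.
  For the nest algebra this follows from \<open>[X, P] \<in> \<T>(\<N>)\<close> for \<open>P \<in> \<N>\<close>. For the quasi-triangular algebra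
  the corners \<open>(1 - P) X P\<close> are compact and, over a suitable finite subnest, nearly constant on each
  interval; Parrott's completion with compact entries then corrects \<open>X\<close> by a norm convergent series
  of compact operators to a member of \<open>\<T>(\<N>)\<close>. Hence every flow is \<open>T \<mapsto> e\<^sup>t\<^sup>X T e\<^sup>-\<^sup>t\<^sup>X\<close> with \<open>X\<close> in the
  algebra, and \<open>e\<^sup>t\<^sup>Y e\<^sup>-\<^sup>t\<^sup>X\<close> is the cocycle that perturbs one such flow into another.\<close>

section \<open>Hilbert space\<close>

text \<open>The obstacle is that the algebra need not contain a given \<open>rank1 x y\<close>: for
  the nest algebra, every member \<open>M\<close> of the nest must contain \<open>x\<close> or be
  orthogonal to \<open>y\<close>. To build the diagonal operator \<open>T\<close> one needs an
  orthonormal sequence \<open>e\<close> that may be paired with nearly arbitrary \<open>u\<close>.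
  If some \<open>M\<close> and its complement are both infinite-dimensional, \<open>e\<close> in
  \<open>M\<close> and \<open>u\<close> in the complement will do, and an operator is treated in
  four blocks. Otherwise every member has finite dimension or finite codimension, and
  \<open>left_condition\<close> holds for the nest or for the nest of complements; taking adjoints
  exchanges the two. A bound on the automorphisms uniform in time is not known beforehand; it
  results from absorbing the error into the left-hand side. Nor is it known beforehand that the
  quasi-triangular algebra is closed, although differentiating a flow inside it requires this. Hence
  the argument that places \<open>X\<close> in the algebra starts from commutators in its closure;
  applied to a limit of members of the algebra, it also yields closedness.\<close>

lemma cinner_add_right: "cinner x (y + z) = cinner x y + cinner x (z::'a::chilbert_space)"
  by (metis cinner_add_left cinner_commute complex_cnj_add)

lemma cinner_scaleC_right: "cinner x (a *\<^sub>C y) = cnj a * cinner x (y::'a::chilbert_space)"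
  by (metis cinner_commute cinner_scaleC_left complex_cnj_mult)

lemma cinner_scaleR_left: "cinner (r *\<^sub>R x) y = r *\<^sub>R cinner x (y::'a::chilbert_space)"
  by (metis cinner_scaleC_left scaleC_complex_of_real scaleR_conv_of_real)

lemma cinner_scaleR_right: "cinner x (r *\<^sub>R y) = r *\<^sub>R cinner x (y::'a::chilbert_space)"
  by (metis cinner_scaleC_right scaleC_complex_of_real scaleR_conv_of_real complex_cnj_complex_of_real)

lemma scaleC_scaleR_commute: "c *\<^sub>C r *\<^sub>R x = r *\<^sub>R c *\<^sub>C (x::'a::chilbert_space)"
  by (simp add: scaleC_complex_of_real[symmetric] scaleC_scaleC mult.commute)

lemma norm_square: "(norm x)\<^sup>2 = Re (cinner x (x::'a::chilbert_space))"
  by (simp add: cinner_self)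

lemma cinner_zero_left [simp]: "cinner 0 (x::'a::chilbert_space) = 0"
  using cinner_add_left[of 0 0 x] by simp

lemma cinner_zero_right [simp]: "cinner (x::'a::chilbert_space) 0 = 0"
  using cinner_add_right[of x 0 0] by simp

lemma cinner_minus_left: "cinner (- x) y = - cinner x (y::'a::chilbert_space)"
  by (metis cinner_add_left cinner_zero_left add.right_inverse add_eq_0_iff)

lemma cinner_minus_right: "cinner x (- y) = - cinner x (y::'a::chilbert_space)"
  by (metis cinner_add_right cinner_zero_right add.right_inverse add_eq_0_iff)

lemma cinner_diff_left: "cinner (x - z) y = cinner x y - cinner z (y::'a::chilbert_space)"
  using cinner_add_left[of x "- z" y] by (simp add: cinner_minus_left)

lemma cinner_diff_right: "cinner y (x - z) = cinner y x - cinner y (z::'a::chilbert_space)"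
  using cinner_add_right[of y x "- z"] by (simp add: cinner_minus_right)

lemma norm_add_square:
  "(norm (x + y))\<^sup>2 = (norm x)\<^sup>2 + (norm y)\<^sup>2 + 2 * Re (cinner x (y::'a::chilbert_space))"
proof -
  have "Re (cinner y x) = Re (cinner x y)"
    by (metis cinner_commute complex_cnj cnj.simps(1))
  thus ?thesis by (simp add: norm_square cinner_add_left cinner_add_right)
qed

lemma norm_diff_square:
  "(norm (x - y))\<^sup>2 = (norm x)\<^sup>2 + (norm y)\<^sup>2 - 2 * Re (cinner x (y::'a::chilbert_space))"
  using norm_add_square[of x "- y"] by (simp add: cinner_minus_right)

lemma pythagoras:
  "cinner x y = 0 \<Longrightarrow> (norm (x + y))\<^sup>2 = (norm x)\<^sup>2 + (norm (y::'a::chilbert_space))\<^sup>2"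
  by (simp add: norm_add_square)

lemma cinner_commute_zero: "cinner x y = 0 \<longleftrightarrow> cinner y (x::'a::chilbert_space) = 0"
  by (metis cinner_commute complex_cnj_zero)

lemma cinner_eq_zero_iff [simp]: "cinner x x = 0 \<longleftrightarrow> x = (0::'a::chilbert_space)"
  by (simp add: cinner_self)

lemma Cauchy_Schwarz: "cmod (cinner x y) \<le> norm x * norm (y::'a::chilbert_space)"
proof (cases "y = 0")
  case False
  define c where "c = cinner x y / cinner y y"
  have y: "cinner y y \<noteq> 0" using False by simp
  have "cinner (x - c *\<^sub>C y) (c *\<^sub>C y) = 0"
    using y by (simp add: cinner_diff_left cinner_scaleC_left cinner_scaleC_right c_def)
  from pythagoras[OF this] have "(norm (c *\<^sub>C y))\<^sup>2 \<le> (norm x)\<^sup>2" by simp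
  hence "norm (c *\<^sub>C y) \<le> norm x" by (simp add: power2_le_iff_abs_le)
  hence "cmod c * norm y * norm y \<le> norm x * norm y"
    by (simp add: norm_scaleC mult_right_mono)
  moreover have "cmod c * norm y * norm y = cmod (cinner x y)"
    using False by (simp add: c_def norm_divide cinner_self norm_mult norm_power power2_eq_square)
  ultimately show ?thesis by simp
qed simp

lemma bounded_bilinear_cinner: "bounded_bilinear (cinner :: 'a::chilbert_space \<Rightarrow> 'a \<Rightarrow> complex)"
  by (rule bounded_bilinear.intro)
     (auto simp: cinner_add_left cinner_add_right cinner_scaleR_left cinner_scaleR_right
       intro!: exI[of _ 1] Cauchy_Schwarz)

lemma bounded_bilinear_scaleC:
  "bounded_bilinear (scaleC :: complex \<Rightarrow> 'a::chilbert_space \<Rightarrow> 'a)"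
proof (rule bounded_bilinear.intro)
  show "(r *\<^sub>R a) *\<^sub>C b = r *\<^sub>R a *\<^sub>C b" for r a and b :: 'a
    by (metis scaleC_complex_of_real scaleC_scaleC scaleR_conv_of_real)
qed (auto simp: scaleC_add_left scaleC_add_right scaleC_scaleR_commute norm_scaleC intro!: exI[of _ 1])

lemmas continuous_on_cinner [continuous_intros] =
  bounded_bilinear.continuous_on[OF bounded_bilinear_cinner]
lemmas tendsto_scaleC [tendsto_intros] = bounded_bilinear.tendsto[OF bounded_bilinear_scaleC]
lemmas cinner_sum_left = bounded_bilinear.sum_left[OF bounded_bilinear_cinner]
lemmas cinner_sum_right = bounded_bilinear.sum_right[OF bounded_bilinear_cinner]
lemmas scaleC_diff_right = bounded_bilinear.diff_right[OF bounded_bilinear_scaleC]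
lemmas scaleC_diff_left = bounded_bilinear.diff_left[OF bounded_bilinear_scaleC]

lemma norm_le_cinner_bound:
  assumes "0 \<le> K" and "\<And>u. cmod (cinner x u) \<le> K * norm (u::'a::chilbert_space)"
  shows "norm x \<le> K"
proof (cases "x = 0")
  case False
  have "norm x * norm x \<le> K * norm x"
    using assms(2)[of x] by (simp add: cinner_self norm_mult norm_power power2_eq_square)
  thus ?thesis using False by simp
qed (use assms in simp)

section \<open>Closed subspaces and complex-linear bounded operators\<close>

definition closed_csubspace :: "'a::chilbert_space set \<Rightarrow> bool"
  where "closed_csubspace M \<longleftrightarrow> csubspace M \<and> closed M"

lemma csubspace_zero: "csubspace M \<Longrightarrow> 0 \<in> M"
  and csubspace_add: "csubspace M \<Longrightarrow> x \<in> M \<Longrightarrow> y \<in> M \<Longrightarrow> x + y \<in> M"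
  and csubspace_scaleC: "csubspace M \<Longrightarrow> x \<in> M \<Longrightarrow> c *\<^sub>C x \<in> M"
  and csubspace_diff: "csubspace M \<Longrightarrow> x \<in> M \<Longrightarrow> y \<in> M \<Longrightarrow> x - y \<in> M"
  and csubspace_sum: "csubspace M \<Longrightarrow> (\<And>i. i \<in> I \<Longrightarrow> f i \<in> M) \<Longrightarrow> sum f I \<in> M"
  by (simp_all add: complex_vector.subspace_0 complex_vector.subspace_add
      complex_vector.subspace_scale complex_vector.subspace_diff complex_vector.subspace_sum)

lemma csubspace_scaleR: "csubspace M \<Longrightarrow> x \<in> M \<Longrightarrow> r *\<^sub>R x \<in> M"
  by (metis csubspace_scaleC scaleC_complex_of_real)

lemma csubspaceI:
  "0 \<in> M \<Longrightarrow> (\<And>x y. x \<in> M \<Longrightarrow> y \<in> M \<Longrightarrow> x + y \<in> M) \<Longrightarrow>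
    (\<And>c x. x \<in> M \<Longrightarrow> c *\<^sub>C x \<in> M) \<Longrightarrow> csubspace M"
  by (rule complex_vector.subspaceI)

lemma closed_csubspace_sums:
  assumes "closed_csubspace M" "f sums x" "\<And>i. f i \<in> M"
  shows "x \<in> M"
proof -
  have "closed M" "\<And>n. (\<Sum>i<n. f i) \<in> M"
    using assms by (auto simp: closed_csubspace_def intro: csubspace_sum)
  thus ?thesis using assms(2) unfolding sums_def by (rule closed_sequentially)
qed

lemma bounded_operatorsI:
  fixes T :: "'a::chilbert_space \<Rightarrow>\<^sub>L 'a"
  assumes "\<And>c x. T (c *\<^sub>C x) = c *\<^sub>C T x"
  shows "T \<in> bounded_operators"
  unfolding bounded_operators_def mem_Collect_eq
  by (simp add: Vector_Spaces.linear_iff complex_vector.vector_space_axioms assms blinfun.add_right)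

lemma bounded_operators_scaleC: "T \<in> bounded_operators \<Longrightarrow> T (c *\<^sub>C x) = c *\<^sub>C T x"
  by (simp add: bounded_operators_def Vector_Spaces.linear_iff)

lemma blinfun_scaleC_apply [simp]: "blinfun_scaleC c T x = c *\<^sub>C T x"
  by transfer simp

lemma bounded_operators_closed_under [simp]:
  "id_blinfun \<in> bounded_operators" "0 \<in> bounded_operators"
  "S \<in> bounded_operators \<Longrightarrow> T \<in> bounded_operators \<Longrightarrow> S + T \<in> bounded_operators"
  "S \<in> bounded_operators \<Longrightarrow> T \<in> bounded_operators \<Longrightarrow> S - T \<in> bounded_operators"
  "T \<in> bounded_operators \<Longrightarrow> - T \<in> bounded_operators"
  "T \<in> bounded_operators \<Longrightarrow> r *\<^sub>R T \<in> bounded_operators"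
  "T \<in> bounded_operators \<Longrightarrow> blinfun_scaleC c T \<in> bounded_operators"
  "S \<in> bounded_operators \<Longrightarrow> T \<in> bounded_operators \<Longrightarrow> S o\<^sub>L T \<in> bounded_operators"
  by (auto intro!: bounded_operatorsI simp: bounded_operators_scaleC blinfun.add_left
      blinfun.diff_left blinfun.minus_left blinfun.scaleR_left scaleC_add_right scaleC_diff_right
      scaleC_scaleR_commute scaleC_scaleC mult.commute)

lemma closed_bounded_operators: "closed (bounded_operators :: ('a::chilbert_space \<Rightarrow>\<^sub>L 'a) set)"
proof -
  have "bounded_operators = (\<Inter>c. \<Inter>x. {T::'a \<Rightarrow>\<^sub>L 'a. T (c *\<^sub>C x) = c *\<^sub>C T x})"
    by (auto intro: bounded_operatorsI simp: bounded_operators_scaleC)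
  also have "closed \<dots>"
    by (intro closed_INT ballI closed_Collect_eq)
       (auto intro!: continuous_intros bounded_bilinear.continuous_on[OF bounded_bilinear_scaleC])
  finally show ?thesis .
qed

lemma norm_blinfun_scaleC: "norm (blinfun_scaleC c T) = cmod c * norm T"
proof -
  have le: "norm (blinfun_scaleC c T) \<le> cmod c * norm T" for c and T :: "'a \<Rightarrow>\<^sub>L 'a"
    by (rule norm_blinfun_bound)
       (auto simp: norm_scaleC mult.assoc intro!: mult_left_mono norm_blinfun)
  show ?thesis
  proof (cases "c = 0")
    case True
    thus ?thesis using le[of c T] by simp
  next
    case False
    have "blinfun_scaleC (1/c) (blinfun_scaleC c T) = T"
      by (rule blinfun_eqI) (simp add: scaleC_scaleC False)
    hence "norm T \<le> cmod (1/c) * norm (blinfun_scaleC c T)" by (metis le)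
    thus ?thesis using False le[of c T] by (simp add: norm_divide field_simps)
  qed
qed

section \<open>Orthogonal projections and complements\<close>

lemma exists_orthogonal_projection:
  assumes M: "closed_csubspace M"
  shows "\<exists>y\<in>M. \<forall>m\<in>M. cinner (x - y) m = 0"
proof -
  have sub: "csubspace M" and cl: "closed M" using M by (auto simp: closed_csubspace_def)
  have ne: "M \<noteq> {}" using csubspace_zero[OF sub] by blast
  define d where "d = infdist x M"
  have d: "d \<le> dist x m" if "m \<in> M" for m using that by (simp add: d_def infdist_le)
  have d0: "d \<ge> 0" by (simp add: d_def infdist_nonneg)
  have "\<exists>y\<in>M. dist x y < d + 1 / real (Suc n)" for n
  proof (rule ccontr)
    assume "\<not> ?thesis"
    hence "\<And>y. y \<in> M \<Longrightarrow> d + 1 / real (Suc n) \<le> dist x y" by force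
    hence "d + 1 / real (Suc n) \<le> d"
      unfolding d_def infdist_notempty[OF ne] by (rule cINF_greatest[OF ne])
    thus False by simp
  qed
  then obtain y where y: "\<And>n. y n \<in> M" "\<And>n. dist x (y n) < d + 1 / real (Suc n)" by metis
  have lim: "(\<lambda>n. (d + 1 / real (Suc n))\<^sup>2) \<longlonglongrightarrow> (d + 0)\<^sup>2"
    by (intro tendsto_intros LIMSEQ_inverse_real_of_nat[unfolded inverse_eq_divide])
  \<comment> \<open>Parallelogram law: the midpoint of \<open>y m\<close> and \<open>y n\<close> is
    in \<open>M\<close>, hence at distance at least \<open>d\<close> from \<open>x\<close>. So a
    minimising sequence is Cauchy.\<close>
  have par: "(norm (y m - y n))\<^sup>2 \<le> 2 * (dist x (y m))\<^sup>2 + 2 * (dist x (y n))\<^sup>2 - 4 * d\<^sup>2" for m n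
  proof -
    have "(norm ((x - y n) - (x - y m)))\<^sup>2 + (norm ((x - y n) + (x - y m)))\<^sup>2
        = 2 * (norm (x - y m))\<^sup>2 + 2 * (norm (x - y n))\<^sup>2"
      using norm_add_square[of "x - y n" "x - y m"] norm_diff_square[of "x - y n" "x - y m"] by simp
    moreover have "(x - y n) + (x - y m) = 2 *\<^sub>R (x - (1/2) *\<^sub>R (y n + y m))"
      by (simp add: algebra_simps scaleR_2)
    moreover have "(1/2) *\<^sub>R (y n + y m) \<in> M"
      using y sub by (simp add: csubspace_scaleR csubspace_add)
    hence "d\<^sup>2 \<le> (norm (x - (1/2) *\<^sub>R (y n + y m)))\<^sup>2"
      using d d0 by (simp add: power_mono dist_norm)
    ultimately show ?thesis by (simp add: dist_norm power_mult_distrib)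
  qed
  have "Cauchy y"
  proof (rule metric_CauchyI)
    fix e :: real assume e: "e > 0"
    have "\<forall>\<^sub>F n in sequentially. (d + 1 / real (Suc n))\<^sup>2 < d\<^sup>2 + e\<^sup>2 / 4"
      using lim e by (intro order_tendstoD(2)) auto
    then obtain N where N: "\<And>n. n \<ge> N \<Longrightarrow> (d + 1 / real (Suc n))\<^sup>2 < d\<^sup>2 + e\<^sup>2 / 4"
      by (auto simp: eventually_sequentially)
    have "dist (y m) (y n) < e" if "m \<ge> N" "n \<ge> N" for m n
    proof -
      have "(dist x (y k))\<^sup>2 < d\<^sup>2 + e\<^sup>2 / 4" if "k \<ge> N" for k
        using N[OF that] y(2)[of k] power_mono[of "dist x (y k)" "d + 1 / real (Suc k)" 2]
        by simp
      from this[OF that(1)] this[OF that(2)] par[of m n]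
      have "(norm (y m - y n))\<^sup>2 < e\<^sup>2" by linarith
      thus ?thesis using e by (simp add: dist_norm power2_less_imp_less)
    qed
    thus "\<exists>M. \<forall>m\<ge>M. \<forall>n\<ge>M. dist (y m) (y n) < e" by blast
  qed
  then obtain z where z: "y \<longlonglongrightarrow> z" using Cauchy_convergent convergent_def by blast
  have zM: "z \<in> M" using cl y(1) z by (rule closed_sequentially)
  have "dist x z \<le> d"
  proof (rule LIMSEQ_le)
    show "(\<lambda>n. dist x (y n)) \<longlonglongrightarrow> dist x z" by (intro tendsto_intros z)
    show "(\<lambda>n. d + 1 / real (Suc n)) \<longlonglongrightarrow> d"
      using tendsto_add[OF tendsto_const LIMSEQ_inverse_real_of_nat, of d]
      by (simp add: inverse_eq_divide)
    show "\<exists>N. \<forall>n\<ge>N. dist x (y n) \<le> d + 1 / real (Suc n)" using y(2) less_imp_le by blast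
  qed
  have "cinner (x - z) m = 0" if m: "m \<in> M" for m
  proof (cases "m = 0")
    case False
    \<comment> \<open>Subtracting the component along \<open>m\<close> would shorten
      \<open>x - z\<close>, so it must vanish.\<close>
    define c where "c = cinner (x - z) m / cinner m m"
    have m0: "cinner m m \<noteq> 0" using False by simp
    have "z + c *\<^sub>C m \<in> M" using zM m sub by (simp add: csubspace_add csubspace_scaleC)
    hence le: "norm (x - z) \<le> norm (x - z - c *\<^sub>C m)"
      using d \<open>dist x z \<le> d\<close> by (fastforce simp: dist_norm algebra_simps)
    have "cinner (x - z - c *\<^sub>C m) (c *\<^sub>C m) = 0"
      using m0 by (simp add: cinner_diff_left cinner_scaleC_left cinner_scaleC_right c_def)
    from pythagoras[OF this]
    have "(norm (x - z))\<^sup>2 = (norm (x - z - c *\<^sub>C m))\<^sup>2 + (norm (c *\<^sub>C m))\<^sup>2" by simp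
    moreover have "(norm (x - z))\<^sup>2 \<le> (norm (x - z - c *\<^sub>C m))\<^sup>2" using le by (simp add: power_mono)
    ultimately have "norm (c *\<^sub>C m) = 0" by simp
    hence "c = 0" using False by (simp add: norm_scaleC)
    thus ?thesis using m0 by (simp add: c_def)
  qed simp
  thus ?thesis using zM by blast
qed

lemma orthogonal_projection_unique:
  assumes "csubspace M" "y \<in> M" "\<And>m. m \<in> M \<Longrightarrow> cinner (x - y) m = 0"
    "z \<in> M" "\<And>m. m \<in> M \<Longrightarrow> cinner (x - z) m = 0"
  shows "y = z"
proof -
  have "z - y \<in> M" using assms by (simp add: csubspace_diff)
  hence "cinner (z - y) (z - y) = cinner (x - y) (z - y) - cinner (x - z) (z - y)"
    by (simp add: cinner_diff_left)
  also have "\<dots> = 0" using assms(3,5) \<open>z - y \<in> M\<close> by simp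
  finally show ?thesis by simp
qed

text \<open>\<open>Blinfun\<close> yields an operator for any \<open>M\<close>; it has the intended
  values when \<open>M\<close> is a closed subspace, since then the chosen foot is unique and
  depends linearly and boundedly on \<open>x\<close>.\<close>

definition proj :: "'a::chilbert_space set \<Rightarrow> 'a \<Rightarrow>\<^sub>L 'a"
  where "proj M = Blinfun (\<lambda>x. SOME y. y \<in> M \<and> (\<forall>m\<in>M. cinner (x - y) m = 0))"

lemma proj_props:
  assumes M: "closed_csubspace M"
  shows proj_in: "proj M x \<in> M"
    and proj_orth: "m \<in> M \<Longrightarrow> cinner (x - proj M x) m = 0"
    and proj_bounded: "proj M \<in> bounded_operators"
    and norm_proj_le: "norm (proj M x) \<le> norm x"
proof -
  define f where "f x = (SOME y. y \<in> M \<and> (\<forall>m\<in>M. cinner (x - y) m = 0))" for x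
  have sub: "csubspace M" using M by (simp add: closed_csubspace_def)
  have f: "f x \<in> M" "m \<in> M \<Longrightarrow> cinner (x - f x) m = 0" for x m
    using someI_ex[OF exists_orthogonal_projection[OF M, of x, unfolded Bex_def]]
    unfolding f_def by blast+
  have add: "f (x + y) = f x + f y" for x y
  proof (rule orthogonal_projection_unique[OF sub f(1) f(2)])
    show "f x + f y \<in> M" by (simp add: f sub csubspace_add)
    show "cinner (x + y - (f x + f y)) m = 0" if "m \<in> M" for m
      using f(2)[OF that, of x] f(2)[OF that, of y]
      by (simp add: cinner_add_left cinner_diff_left)
  qed
  have scaleC: "f (c *\<^sub>C x) = c *\<^sub>C f x" for x c
  proof (rule orthogonal_projection_unique[OF sub f(1) f(2)])
    show "c *\<^sub>C f x \<in> M" by (simp add: f sub csubspace_scaleC)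
    show "cinner (c *\<^sub>C x - c *\<^sub>C f x) m = 0" if "m \<in> M" for m
      using f(2)[OF that, of x] by (simp add: scaleC_diff_right[symmetric] cinner_scaleC_left)
  qed
  have nrm: "norm (f x) \<le> norm x" for x
  proof -
    have "(norm x)\<^sup>2 = (norm (x - f x))\<^sup>2 + (norm (f x))\<^sup>2"
      using pythagoras[OF f(2)[OF f(1)], of x x] by simp
    thus ?thesis by (simp add: power2_le_imp_le)
  qed
  have "bounded_linear f"
  proof (rule bounded_linear_intro[where K=1])
    show "f (r *\<^sub>R x) = r *\<^sub>R f x" for r x
      using scaleC[of "of_real r" x] by (simp add: scaleC_complex_of_real)
  qed (simp_all add: add nrm)
  hence app: "proj M x = f x" for x
    unfolding proj_def f_def[abs_def, symmetric] by (simp add: bounded_linear_Blinfun_apply)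
  show "proj M x \<in> M" "m \<in> M \<Longrightarrow> cinner (x - proj M x) m = 0" "norm (proj M x) \<le> norm x"
    using app f nrm by auto
  show "proj M \<in> bounded_operators" by (rule bounded_operatorsI) (simp add: app scaleC)
qed

lemma proj_eqI:
  assumes "closed_csubspace M" "y \<in> M" "\<And>m. m \<in> M \<Longrightarrow> cinner (x - y) m = 0"
  shows "proj M x = y"
  using assms by (intro orthogonal_projection_unique[OF _ proj_in proj_orth])
    (auto simp: closed_csubspace_def)

lemma proj_id: "closed_csubspace M \<Longrightarrow> x \<in> M \<Longrightarrow> proj M x = x"
  by (rule proj_eqI) auto

lemma proj_eq_iff: "closed_csubspace M \<Longrightarrow> proj M x = x \<longleftrightarrow> x \<in> M"
  by (metis proj_id proj_in)

lemma proj_self_adjoint: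
  assumes "closed_csubspace M"
  shows "cinner (proj M x) y = cinner x (proj M y)"
proof -
  have "cinner (x - proj M x) (proj M y) = 0" using assms by (simp add: proj_in proj_orth)
  moreover have "cinner (proj M x) (y - proj M y) = 0"
    using assms by (simp add: proj_in proj_orth cinner_commute_zero[of "proj M x"])
  ultimately show ?thesis by (simp add: cinner_diff_left cinner_diff_right)
qed

lemma norm_proj: "closed_csubspace M \<Longrightarrow> norm (proj M) \<le> 1"
  by (rule norm_blinfun_bound) (auto simp: norm_proj_le)

definition ocomp :: "'a::chilbert_space set \<Rightarrow> 'a set"
  where "ocomp M = {x. \<forall>m\<in>M. cinner x m = 0}"

lemma closed_csubspace_ocomp: "closed_csubspace (ocomp M)"
proof -
  have "ocomp M = (\<Inter>m\<in>M. {x. cinner x m = 0})" by (auto simp: ocomp_def)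
  moreover have "closed {x. cinner x m = 0}" for m :: 'a
    by (rule closed_Collect_eq) (auto intro!: continuous_intros)
  ultimately have "closed (ocomp M)" by auto
  moreover have "csubspace (ocomp M)"
    by (rule csubspaceI) (auto simp: ocomp_def cinner_add_left cinner_scaleC_left)
  ultimately show ?thesis by (simp add: closed_csubspace_def)
qed

lemma ocomp_sym: "x \<in> ocomp M \<Longrightarrow> m \<in> M \<Longrightarrow> cinner m x = 0"
  by (auto simp: ocomp_def cinner_commute_zero[of m])

lemma ocomp_antimono: "M \<subseteq> L \<Longrightarrow> ocomp L \<subseteq> ocomp M"
  by (auto simp: ocomp_def)

lemma ocomp_ocomp: assumes "closed_csubspace M" shows "ocomp (ocomp M) = M"
proof
  show "M \<subseteq> ocomp (ocomp M)" using ocomp_sym by (auto simp: ocomp_def)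
  show "ocomp (ocomp M) \<subseteq> M"
  proof
    fix x assume x: "x \<in> ocomp (ocomp M)"
    have c: "x - proj M x \<in> ocomp M" using assms by (simp add: ocomp_def proj_orth)
    have "cinner x (x - proj M x) = 0" using x c by (simp add: ocomp_def)
    moreover have "cinner (proj M x) (x - proj M x) = 0"
      using ocomp_sym[OF c proj_in[OF assms]] .
    ultimately have "cinner (x - proj M x) (x - proj M x) = 0" by (simp add: cinner_diff_left)
    thus "x \<in> M" using proj_in[OF assms, of x] by simp
  qed
qed

lemma proj_ocomp: "closed_csubspace M \<Longrightarrow> proj (ocomp M) x = x - proj M x"
  by (rule proj_eqI[OF closed_csubspace_ocomp])
     (auto simp: ocomp_sym proj_in, simp add: ocomp_def proj_orth)

lemma minus_proj_in_ocomp: "closed_csubspace M \<Longrightarrow> x - proj M x \<in> ocomp M"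
  by (simp add: ocomp_def proj_orth)

lemma proj_zero_iff: "closed_csubspace M \<Longrightarrow> proj M x = 0 \<longleftrightarrow> x \<in> ocomp M"
  by (metis proj_ocomp closed_csubspace_ocomp diff_zero proj_eq_iff diff_eq_eq add.right_neutral
      add_diff_cancel_left' cancel_comm_monoid_add_class.diff_cancel)

lemma csubspace_closure:
  assumes "csubspace M"
  shows "csubspace (closure M)"
proof (rule csubspaceI)
  show "0 \<in> closure M" using assms closure_subset csubspace_zero by blast
  fix c x y assume "x \<in> closure M"
  then obtain f where f: "\<And>n::nat. f n \<in> M" "f \<longlonglongrightarrow> x" by (auto simp: closure_sequential)
  have "(\<lambda>n. c *\<^sub>C f n) \<longlonglongrightarrow> c *\<^sub>C x" by (intro tendsto_intros f)
  thus "c *\<^sub>C x \<in> closure M" using f assms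
    by (auto simp: closure_sequential intro!: exI[of _ "\<lambda>n. c *\<^sub>C f n"] csubspace_scaleC)
  assume "y \<in> closure M"
  then obtain g where g: "\<And>n::nat. g n \<in> M" "g \<longlonglongrightarrow> y" by (auto simp: closure_sequential)
  have "(\<lambda>n. f n + g n) \<longlonglongrightarrow> x + y" by (intro tendsto_intros f g)
  thus "x + y \<in> closure M" using f g assms
    by (auto simp: closure_sequential intro!: exI[of _ "\<lambda>n. f n + g n"] csubspace_add)
qed

lemma ocomp_trivial_dense:
  assumes "csubspace M" "ocomp M \<subseteq> {0}"
  shows "closure M = UNIV"
proof -
  have cl: "closed_csubspace (closure M)"
    using assms(1) by (simp add: closed_csubspace_def csubspace_closure)
  have "x \<in> closure M" for x
  proof -
    have "x - proj (closure M) x \<in> ocomp M"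
      using minus_proj_in_ocomp[OF cl] ocomp_antimono[OF closure_subset] by blast
    hence "x = proj (closure M) x" using assms by auto
    thus ?thesis using proj_in[OF cl] by metis
  qed
  thus ?thesis by blast
qed

section \<open>Riesz representation and adjoints\<close>

lemma Riesz_representation:
  fixes \<phi> :: "'a::chilbert_space \<Rightarrow> complex"
  assumes bl: "bounded_linear \<phi>" and sc: "\<And>c x. \<phi> (c *\<^sub>C x) = c * \<phi> x"
  shows "\<exists>y. \<forall>x. \<phi> x = cinner x y"
proof -
  interpret bounded_linear \<phi> by (rule bl)
  define M where "M = {x. \<phi> x = 0}"
  have "closed M" unfolding M_def
    by (rule closed_Collect_eq) (auto intro!: continuous_intros linear_continuous_on bl)
  moreover have "csubspace M" by (rule csubspaceI) (auto simp: M_def sc add)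
  ultimately have M: "closed_csubspace M" by (simp add: closed_csubspace_def)
  show ?thesis
  proof (cases "\<forall>x. \<phi> x = 0")
    case True thus ?thesis by (intro exI[of _ 0]) simp
  next
    case False
    then obtain x0 where x0: "\<phi> x0 \<noteq> 0" by blast
    define z where "z = x0 - proj M x0"
    have "\<phi> (proj M x0) = 0" using proj_in[OF M] by (simp add: M_def)
    hence z: "\<phi> z \<noteq> 0" using x0 by (simp add: z_def diff)
    hence zz: "cinner z z \<noteq> 0" by (metis cinner_eq_zero_iff zero)
    have "\<phi> x = cinner x (cnj (\<phi> z / cinner z z) *\<^sub>C z)" for x
    proof -
      have "\<phi> z *\<^sub>C x - \<phi> x *\<^sub>C z \<in> M" by (simp add: M_def diff sc)
      hence "cinner (\<phi> z *\<^sub>C x - \<phi> x *\<^sub>C z) z = 0"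
        unfolding z_def by (rule ocomp_sym[OF minus_proj_in_ocomp[OF M]])
      thus ?thesis using zz by (simp add: cinner_diff_left cinner_scaleC_left cinner_scaleC_right field_simps)
    qed
    thus ?thesis by blast
  qed
qed

definition adj :: "('a::chilbert_space \<Rightarrow>\<^sub>L 'a) \<Rightarrow> ('a \<Rightarrow>\<^sub>L 'a)"
  where "adj T = Blinfun (\<lambda>y. SOME z. \<forall>x. cinner (T x) y = cinner x z)"

lemma cinner_eqI: "(\<And>x. cinner x y = cinner x z) \<Longrightarrow> y = (z::'a::chilbert_space)"
  by (metis cinner_diff_right cinner_eq_zero_iff eq_iff_diff_eq_0)

lemma cinner_adj:
  assumes T: "T \<in> bounded_operators"
  shows "cinner (T x) y = cinner x (adj T y)"
proof -
  define f where "f y = (SOME z. \<forall>x. cinner (T x) y = cinner x z)" for y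
  have ex: "\<exists>z. \<forall>x. cinner (T x) y = cinner x z" for y
  proof (rule Riesz_representation)
    show "bounded_linear (\<lambda>x. cinner (T x) y)"
      by (rule bounded_linear_compose[OF bounded_bilinear.bounded_linear_left[OF bounded_bilinear_cinner]])
         (rule blinfun.bounded_linear_right)
    show "cinner (T (c *\<^sub>C x)) y = c * cinner (T x) y" for c x
      using T by (simp add: bounded_operators_scaleC cinner_scaleC_left)
  qed
  have f: "cinner (T x) y = cinner x (f y)" for x y
    using someI_ex[OF ex[of y]] unfolding f_def by blast
  have "bounded_linear f"
  proof (rule bounded_linear_intro)
    show "f (y + z) = f y + f z" for y z
      by (rule cinner_eqI) (simp add: f[symmetric] cinner_add_right)
    show "f (r *\<^sub>R y) = r *\<^sub>R f y" for r y
      by (rule cinner_eqI) (simp add: f[symmetric] cinner_scaleR_right)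
    show "norm (f y) \<le> norm y * norm T" for y
    proof (rule norm_le_cinner_bound)
      show "cmod (cinner (f y) x) \<le> norm y * norm T * norm x" for x
      proof -
        have "cmod (cinner (f y) x) = cmod (cinner (T x) y)"
          by (metis f cinner_commute complex_mod_cnj)
        also have "\<dots> \<le> norm (T x) * norm y" by (rule Cauchy_Schwarz)
        also have "\<dots> \<le> (norm T * norm x) * norm y" by (intro mult_right_mono norm_blinfun) simp
        finally show ?thesis by (simp add: mult_ac)
      qed
    qed simp
  qed
  hence "adj T y = f y"
    unfolding adj_def f_def[abs_def, symmetric] by (simp add: bounded_linear_Blinfun_apply)
  thus ?thesis using f by simp
qed

lemma cinner_adj_left: "T \<in> bounded_operators \<Longrightarrow> cinner (adj T x) y = cinner x (T y)"
  by (metis cinner_adj cinner_commute)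

lemma adj_eqI:
  fixes S T :: "'a::chilbert_space \<Rightarrow>\<^sub>L 'a"
  assumes "T \<in> bounded_operators" "\<And>x y. cinner (T x) y = cinner x (S y)"
  shows "adj T = S"
  by (rule blinfun_eqI, rule cinner_eqI) (metis assms cinner_adj)

lemma adj_bounded [simp]: assumes "T \<in> bounded_operators" shows "adj T \<in> bounded_operators"
  by (rule bounded_operatorsI, rule cinner_eqI)
     (simp add: cinner_adj[OF assms, symmetric] cinner_scaleC_right)

lemma adj_adj: "T \<in> bounded_operators \<Longrightarrow> adj (adj T) = T"
  by (rule adj_eqI) (simp_all add: cinner_adj_left)

lemma adj_compose:
  "S \<in> bounded_operators \<Longrightarrow> T \<in> bounded_operators \<Longrightarrow> adj (S o\<^sub>L T) = adj T o\<^sub>L adj S"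
  by (rule adj_eqI) (simp_all add: cinner_adj)

lemma adj_add:
  "S \<in> bounded_operators \<Longrightarrow> T \<in> bounded_operators \<Longrightarrow> adj (S + T) = adj S + adj T"
  by (rule adj_eqI) (simp_all add: cinner_adj blinfun.add_left cinner_add_left cinner_add_right)

lemma adj_diff:
  "S \<in> bounded_operators \<Longrightarrow> T \<in> bounded_operators \<Longrightarrow> adj (S - T) = adj S - adj T"
  by (rule adj_eqI) (simp_all add: cinner_adj blinfun.diff_left cinner_diff_left cinner_diff_right)

lemma adj_scaleC: "T \<in> bounded_operators \<Longrightarrow> adj (blinfun_scaleC c T) = blinfun_scaleC (cnj c) (adj T)"
  by (rule adj_eqI) (simp_all add: cinner_adj cinner_scaleC_left cinner_scaleC_right)

lemma norm_adj: assumes "T \<in> bounded_operators" shows "norm (adj T) = norm T"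
proof -
  have le: "norm (adj T) \<le> norm T" if T: "T \<in> bounded_operators" for T :: "'a \<Rightarrow>\<^sub>L 'a"
  proof (rule norm_blinfun_bound)
    fix y show "norm (adj T y) \<le> norm T * norm y"
    proof (rule norm_le_cinner_bound)
      fix u
      have "cmod (cinner (adj T y) u) \<le> norm y * norm (T u)"
        by (simp add: cinner_adj_left[OF T] Cauchy_Schwarz)
      also have "\<dots> \<le> norm y * (norm T * norm u)" by (intro mult_left_mono norm_blinfun) simp
      finally show "cmod (cinner (adj T y) u) \<le> norm T * norm y * norm u" by (simp add: mult_ac)
    qed simp
  qed simp
  show ?thesis using le[OF assms] le[OF adj_bounded[OF assms]] by (simp add: adj_adj[OF assms])
qed

section \<open>Bounds by matrix entries, and rank-one operators\<close>

lemma norm_le_sesquilinear: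
  fixes T :: "'a::chilbert_space \<Rightarrow>\<^sub>L 'a"
  assumes "0 \<le> K" "\<And>v u. cmod (cinner (T v) u) \<le> K * norm v * norm u"
  shows "norm T \<le> K"
  using assms by (intro norm_blinfun_bound norm_le_cinner_bound) auto

lemma cmod_cinner_blinfun:
  fixes T :: "'a::chilbert_space \<Rightarrow>\<^sub>L 'a"
  shows "cmod (cinner (T v) u) \<le> norm T * norm v * norm u"
  using Cauchy_Schwarz[of "T v" u] mult_right_mono[OF norm_blinfun[of T v] norm_ge_zero[of u]]
  by linarith

text \<open>The tensor of \<open>x\<close> and \<open>y\<close> in the overview; it is linear in
  \<open>x\<close> and conjugate linear in \<open>y\<close>.\<close>

definition rank1 :: "'a::chilbert_space \<Rightarrow> 'a \<Rightarrow> ('a \<Rightarrow>\<^sub>L 'a)"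
  where "rank1 x y = Blinfun (\<lambda>z. cinner z y *\<^sub>C x)"

lemma rank1_apply [simp]: "rank1 x y z = cinner z y *\<^sub>C x"
proof -
  have "bounded_linear (\<lambda>z. cinner z y *\<^sub>C x)"
    by (rule bounded_linear_compose[OF bounded_bilinear.bounded_linear_left[OF bounded_bilinear_scaleC]
          bounded_bilinear.bounded_linear_left[OF bounded_bilinear_cinner]])
  thus ?thesis by (simp add: rank1_def bounded_linear_Blinfun_apply)
qed

lemma rank1_bounded [simp]: "rank1 x y \<in> bounded_operators"
  by (rule bounded_operatorsI) (simp add: cinner_scaleC_left scaleC_scaleC)

lemma norm_rank1: "norm (rank1 x y) = norm x * norm y"
proof (rule antisym)
  show "norm (rank1 x y) \<le> norm x * norm y"
  proof (rule norm_blinfun_bound)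
    fix v show "norm (rank1 x y v) \<le> norm x * norm y * norm v"
      using mult_right_mono[OF Cauchy_Schwarz[of v y] norm_ge_zero[of x]]
      by (simp add: norm_scaleC mult_ac)
  qed simp
  show "norm x * norm y \<le> norm (rank1 x y)"
  proof (cases "y = 0")
    case False
    have "(norm x * norm y) * norm y = norm (rank1 x y y)"
      by (simp add: norm_scaleC cinner_self norm_power norm_mult power2_eq_square)
    also have "\<dots> \<le> norm (rank1 x y) * norm y" by (rule norm_blinfun)
    finally show ?thesis using False by simp
  qed simp
qed

lemma adj_rank1: "adj (rank1 x y) = rank1 y x"
proof (rule adj_eqI)
  show "cinner (rank1 x y v) w = cinner v (rank1 y x w)" for v w
    using cinner_commute[of w x] by (simp add: cinner_scaleC_left cinner_scaleC_right)
qed simp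

lemma compose_rank1: "T \<in> bounded_operators \<Longrightarrow> T o\<^sub>L rank1 x y = rank1 (T x) y"
  by (rule blinfun_eqI) (simp add: bounded_operators_scaleC)

lemma rank1_compose: "T \<in> bounded_operators \<Longrightarrow> rank1 x y o\<^sub>L T = rank1 x (adj T y)"
  by (rule blinfun_eqI) (simp add: cinner_adj)

lemma rank1_rank1: "rank1 x y o\<^sub>L rank1 z w = blinfun_scaleC (cinner z y) (rank1 x w)"
  by (rule blinfun_eqI) (simp add: cinner_scaleC_left scaleC_scaleC mult.commute)

lemma rank1_add_right: "rank1 x (y + z) = rank1 x y + rank1 x z"
  by (rule blinfun_eqI) (simp add: blinfun.add_left cinner_add_right scaleC_add_left)

lemma rank1_add_left: "rank1 (x + y) z = rank1 x z + rank1 y z"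
  by (rule blinfun_eqI) (simp add: blinfun.add_left scaleC_add_right)

lemma rank1_scaleC_right: "rank1 x (c *\<^sub>C y) = blinfun_scaleC (cnj c) (rank1 x y)"
  by (rule blinfun_eqI) (simp add: cinner_scaleC_right scaleC_scaleC)

lemma rank1_scaleC_left: "rank1 (c *\<^sub>C x) y = blinfun_scaleC c (rank1 x y)"
  by (rule blinfun_eqI) (simp add: scaleC_scaleC mult.commute)

lemma rank1_zero_right [simp]: "rank1 x 0 = 0"
  by (rule blinfun_eqI) simp

section \<open>Finite orthonormal sets and dimension\<close>

definition orthonormal_set :: "'a::chilbert_space set \<Rightarrow> bool"
  where "orthonormal_set S \<longleftrightarrow> (\<forall>x\<in>S. \<forall>y\<in>S. cinner x y = (if x = y then 1 else 0))"

definition orthonormal :: "(nat \<Rightarrow> 'a::chilbert_space) \<Rightarrow> bool"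
  where "orthonormal e \<longleftrightarrow> (\<forall>i j. cinner (e i) (e j) = (if i = j then 1 else 0))"

lemma norm_one_iff: "norm x = 1 \<longleftrightarrow> cinner x x = (1::complex)" for x :: "'a::chilbert_space"
proof -
  have "cinner x x = 1 \<longleftrightarrow> (norm x)\<^sup>2 = 1" by (metis cinner_self of_real_eq_1_iff)
  thus ?thesis using norm_ge_zero[of x] by (auto simp: power2_eq_1_iff)
qed

lemma orthonormalD:
  "orthonormal e \<Longrightarrow> norm (e i) = 1" "orthonormal e \<Longrightarrow> i \<noteq> j \<Longrightarrow> cinner (e i) (e j) = 0"
  by (auto simp: orthonormal_def norm_one_iff)

lemma orthonormalI:
  assumes "\<And>i. norm (e i) = 1" "\<And>i j. i < j \<Longrightarrow> cinner (e j) (e i) = 0"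
  shows "orthonormal e"
proof -
  have "cinner (e i) (e j) = 0" if "i \<noteq> j" for i j
    using assms(2)[of i j] assms(2)[of j i] that cinner_commute_zero[of "e i" "e j"]
    by (cases i j rule: linorder_cases) auto
  thus ?thesis using assms(1) by (auto simp: orthonormal_def norm_one_iff)
qed

text \<open>For a finite orthonormal \<open>S\<close> this is the projection onto its span, written
  as an explicit sum to which additivity and homogeneity of a map can be applied.\<close>

definition sproj :: "'a::chilbert_space set \<Rightarrow> 'a \<Rightarrow> 'a"
  where "sproj S x = (\<Sum>b\<in>S. cinner x b *\<^sub>C b)"

lemma sproj_orth:
  assumes "finite S" "orthonormal_set S" "b \<in> S"
  shows "cinner (x - sproj S x) b = 0"
proof -
  have "cinner (sproj S x) b = (\<Sum>a\<in>S. if a = b then cinner x a else 0)"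
    using assms unfolding sproj_def cinner_sum_left
    by (intro sum.cong) (auto simp: cinner_scaleC_left orthonormal_set_def)
  also have "\<dots> = cinner x b" using assms by simp
  finally show ?thesis by (simp add: cinner_diff_left)
qed

lemma sproj_in: "csubspace M \<Longrightarrow> S \<subseteq> M \<Longrightarrow> sproj S x \<in> M"
  unfolding sproj_def by (intro csubspace_sum csubspace_scaleC) auto

lemma norm_minus_sproj:
  assumes "finite S" "orthonormal_set S"
  shows "norm (x - sproj S x) \<le> norm x"
proof -
  have "cinner (x - sproj S x) (sproj S x) = 0"
    unfolding sproj_def[of S x] cinner_sum_right
    by (intro sum.neutral ballI)
       (simp add: cinner_scaleC_right sproj_orth[OF assms, unfolded sproj_def])
  from pythagoras[OF this] show ?thesis by (simp add: power2_le_imp_le)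
qed

lemma normalize_orthogonal:
  fixes z :: "'a::chilbert_space"
  assumes "z \<noteq> 0"
  shows "norm ((1 / norm z) *\<^sub>R z) = 1"
    "cinner z b = 0 \<Longrightarrow> cinner ((1 / norm z) *\<^sub>R z) b = 0"
  using assms by (auto simp: cinner_scaleR_left)

lemma orthonormal_set_insert:
  assumes "orthonormal_set S" "norm x = 1" "\<And>b. b \<in> S \<Longrightarrow> cinner x b = 0"
  shows "orthonormal_set (insert x S)"
  using assms unfolding orthonormal_set_def
  by (auto simp: norm_one_iff cinner_commute_zero[of _ x])

lemma sproj_insert:
  assumes "finite S" "x \<notin> S"
  shows "sproj (insert x S) v = cinner v x *\<^sub>C x + sproj S v"
  using assms by (simp add: sproj_def)

text \<open>The last clause expresses that the span of \<open>S\<close> contains \<open>G\<close>,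
  in the form used later: whatever is orthogonal to \<open>S\<close> is orthogonal to
  \<open>G\<close>.\<close>

lemma Gram_Schmidt:
  assumes "finite G" "csubspace M" "G \<subseteq> M"
  shows "\<exists>S. finite S \<and> orthonormal_set S \<and> S \<subseteq> M \<and>
    (\<forall>u. (\<forall>b\<in>S. cinner u b = 0) \<longrightarrow> (\<forall>g\<in>G. cinner u g = 0))"
  using assms
proof (induction G)
  case empty
  show ?case by (intro exI[of _ "{}"]) (simp add: orthonormal_set_def)
next
  case (insert g G)
  then obtain S where S: "finite S" "orthonormal_set S" "S \<subseteq> M"
    and u: "\<And>u g. \<forall>b\<in>S. cinner u b = 0 \<Longrightarrow> g \<in> G \<Longrightarrow> cinner u g = 0" by auto
  define z where "z = g - sproj S g"
  have sp: "cinner u (sproj S g) = 0" if "\<forall>b\<in>S. cinner u b = 0" for u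
    using that by (simp add: sproj_def cinner_sum_right cinner_scaleC_right)
  show ?case
  proof (cases "z = 0")
    case True
    hence "\<And>u. \<forall>b\<in>S. cinner u b = 0 \<Longrightarrow> cinner u g = 0" using sp by (simp add: z_def)
    thus ?thesis using S u by (intro exI[of _ S]) auto
  next
    case False
    define x where "x = (1 / norm z) *\<^sub>R z"
    have "z \<in> M" using insert.prems S by (simp add: z_def csubspace_diff sproj_in)
    hence xM: "x \<in> M" using insert.prems by (simp add: x_def csubspace_scaleR)
    have x: "norm x = 1" "\<And>b. b \<in> S \<Longrightarrow> cinner x b = 0"
      using normalize_orthogonal[OF False] sproj_orth[OF S(1,2)] by (auto simp: x_def z_def)
    have g: "g = norm z *\<^sub>R x + sproj S g" using False by (simp add: x_def z_def)
    have "cinner u g = 0" if "\<forall>b\<in>insert x S. cinner u b = 0" for u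
      by (subst g) (use that sp in \<open>simp add: cinner_add_right cinner_scaleR_right\<close>)
    thus ?thesis using S xM orthonormal_set_insert[OF S(2) x] u
      by (intro exI[of _ "insert x S"]) auto
  qed
qed

text \<open>For a subspace this is infinite dimension, put as the orthonormal sequence that later
  constructions consume.\<close>

definition infd :: "'a::chilbert_space set \<Rightarrow> bool"
  where "infd M \<longleftrightarrow> (\<exists>e. orthonormal e \<and> range e \<subseteq> M)"

text \<open>If every finite orthonormal subset left a nonzero residual vector, normalising these
  residuals one after another would produce an infinite orthonormal sequence.\<close>

lemma not_infd_basis:
  assumes M: "csubspace M" and fin: "\<not> infd M"
  shows "\<exists>S. finite S \<and> orthonormal_set S \<and> S \<subseteq> M \<and> (\<forall>x\<in>M. x = sproj S x)"
proof (rule ccontr)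
  assume no: "\<not> ?thesis"
  have "\<exists>z\<in>M. norm z = 1 \<and> (\<forall>b\<in>S. cinner z b = 0)"
    if S: "finite S" "orthonormal_set S" "S \<subseteq> M" for S
  proof -
    obtain x where x: "x \<in> M" "x - sproj S x \<noteq> 0" using no S by auto
    have "x - sproj S x \<in> M" using x M S by (simp add: csubspace_diff sproj_in)
    thus ?thesis
      using normalize_orthogonal[OF x(2)] sproj_orth[OF S(1,2)] M
      by (intro bexI[of _ "(1 / norm (x - sproj S x)) *\<^sub>R (x - sproj S x)"])
         (auto simp: csubspace_scaleR)
  qed
  then obtain f where f: "\<And>S. finite S \<Longrightarrow> orthonormal_set S \<Longrightarrow> S \<subseteq> M \<Longrightarrow>
      f S \<in> M \<and> norm (f S) = 1 \<and> (\<forall>b\<in>S. cinner (f S) b = 0)" by metis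
  define S where "S = rec_nat {} (\<lambda>_ S. insert (f S) S)"
  have S: "S 0 = {}" "S (Suc n) = insert (f (S n)) (S n)" for n by (simp_all add: S_def)
  have inv: "finite (S n) \<and> orthonormal_set (S n) \<and> S n \<subseteq> M" for n
    by (induction n) (auto simp: S f orthonormal_set_def[of "{}"] intro!: orthonormal_set_insert)
  have mem: "f (S m) \<in> S n" if "m < n" for m n
    using that by (induction n) (auto simp: S less_Suc_eq)
  have "orthonormal (\<lambda>n. f (S n))"
    using f inv mem by (intro orthonormalI) blast+
  thus False using fin f inv by (auto simp: infd_def)
qed

lemma not_infd_cspan:
  assumes "finite S" "M \<subseteq> cspan S"
  shows "\<not> infd M"
proof
  assume "infd M"
  then obtain e where e: "orthonormal e" "range e \<subseteq> M" by (auto simp: infd_def)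
  have inj: "inj e"
  proof (rule injI)
    fix i j assume "e i = e j"
    thus "i = j" using e(1) unfolding orthonormal_def by (metis zero_neq_one)
  qed
  have "\<not> complex_vector.dependent (range e)"
  proof
    assume "complex_vector.dependent (range e)"
    then obtain t u v where t: "finite t" "t \<subseteq> range e" "(\<Sum>v\<in>t. u v *\<^sub>C v) = 0" "v \<in> t" "u v \<noteq> 0"
      by (auto simp: complex_vector.dependent_explicit)
    have "0 = cinner (\<Sum>v\<in>t. u v *\<^sub>C v) v" by (simp add: t)
    also have "\<dots> = (\<Sum>w\<in>t. (if w = v then u w else 0))"
      unfolding cinner_sum_left
    proof (intro sum.cong refl)
      fix w assume "w \<in> t"
      then obtain i j where "w = e i" "v = e j" using t by blast
      thus "cinner (u w *\<^sub>C w) v = (if w = v then u w else 0)"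
        using e(1) inj by (auto simp: cinner_scaleC_left orthonormal_def inj_eq)
    qed
    also have "\<dots> = u v" using t by simp
    finally show False using t by simp
  qed
  hence "finite (range e)"
    using complex_vector.independent_span_bound[OF assms(1)] e(2) assms(2) by blast
  thus False using range_inj_infinite[OF inj] by simp
qed

text \<open>Finite bases of \<open>L\<close> and of its complement in \<open>M\<close> would
  together span \<open>M\<close>.\<close>

lemma infd_relative_complement:
  assumes L: "closed_csubspace L" "L \<subseteq> M" "csubspace M" "infd M" "\<not> infd L"
  shows "infd (M \<inter> ocomp L)"
proof (rule ccontr)
  assume fin: "\<not> infd (M \<inter> ocomp L)"
  have "csubspace (M \<inter> ocomp L)"
    using assms closed_csubspace_ocomp[of L]
    by (simp add: closed_csubspace_def complex_vector.subspace_inter)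
  from not_infd_basis[OF this fin] obtain S where S: "finite S" "\<And>x. x \<in> M \<inter> ocomp L \<Longrightarrow> x = sproj S x"
    by auto
  obtain S' where S': "finite S'" "\<And>x. x \<in> L \<Longrightarrow> x = sproj S' x"
    using not_infd_basis[of L] assms by (auto simp: closed_csubspace_def)
  have span: "sproj R x \<in> cspan R" if "finite R" for R and x :: 'a
    unfolding sproj_def
    by (intro complex_vector.span_sum complex_vector.span_scale complex_vector.span_base)
  have "M \<subseteq> cspan (S \<union> S')"
  proof
    fix x assume x: "x \<in> M"
    have "proj L x \<in> L" using L by (simp add: proj_in)
    moreover have "x - proj L x \<in> M \<inter> ocomp L"
      using x calculation assms minus_proj_in_ocomp[OF L(1)] by (auto intro: csubspace_diff)
    ultimately have "proj L x \<in> cspan S'" "x - proj L x \<in> cspan S"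
      using S S' span by metis+
    hence "proj L x + (x - proj L x) \<in> cspan (S \<union> S')"
      by (intro complex_vector.span_add) (use complex_vector.span_mono in blast)+
    thus "x \<in> cspan (S \<union> S')" by simp
  qed
  thus False using not_infd_cspan[of "S \<union> S'" M] S(1) S'(1) assms by simp
qed

section \<open>Strongly convergent sums of operators with orthogonal ranges\<close>

lemma norm_sum_orthogonal:
  fixes f :: "nat \<Rightarrow> 'a::chilbert_space"
  assumes "finite I" "\<And>i j. i \<in> I \<Longrightarrow> j \<in> I \<Longrightarrow> i \<noteq> j \<Longrightarrow> cinner (f i) (f j) = 0"
  shows "(norm (\<Sum>i\<in>I. f i))\<^sup>2 = (\<Sum>i\<in>I. (norm (f i))\<^sup>2)"
  using assms
proof (induction I)
  case (insert i I)
  have "cinner (f i) (\<Sum>i\<in>I. f i) = 0"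
    unfolding cinner_sum_right by (intro sum.neutral) (use insert in auto)
  from pythagoras[OF this] show ?case using insert by simp
qed simp

text \<open>The bound makes the squared norms summable at each vector, and orthogonality of the
  terms turns this into Cauchy partial sums. Convergence is strong, in general not in norm.\<close>

lemma orthogonal_operator_sum:
  fixes A :: "nat \<Rightarrow> 'a::chilbert_space \<Rightarrow>\<^sub>L 'a"
  assumes A: "\<And>i. A i \<in> bounded_operators"
    and orth: "\<And>i j v w. i \<noteq> j \<Longrightarrow> cinner (A i v) (A j w) = 0"
    and bound: "\<And>n v. (\<Sum>i<n. (norm (A i v))\<^sup>2) \<le> (norm v)\<^sup>2"
  shows "\<exists>T\<in>bounded_operators. \<forall>v. (\<lambda>i. A i v) sums T v"
proof -
  have "summable (\<lambda>i. A i v)" for v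
  proof -
    have sm: "summable (\<lambda>i. (norm (A i v))\<^sup>2)"
      by (rule summableI_nonneg_bounded[where x = "(norm v)\<^sup>2"]) (use bound in auto)
    show ?thesis
      unfolding summable_Cauchy
    proof (intro allI impI)
      fix e :: real assume e: "e > 0"
      then obtain N where N: "\<And>m n. m \<ge> N \<Longrightarrow> norm (\<Sum>i=m..<n. (norm (A i v))\<^sup>2) < e\<^sup>2"
        using sm unfolding summable_Cauchy by (metis zero_less_power)
      have "norm (\<Sum>i=m..<n. A i v) < e" if "m \<ge> N" for m n
      proof -
        have "(norm (\<Sum>i=m..<n. A i v))\<^sup>2 < e\<^sup>2"
          using N[OF that, of n] by (simp add: norm_sum_orthogonal orth sum_nonneg)
        thus ?thesis using e by (simp add: power2_less_imp_less)
      qed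
      thus "\<exists>N. \<forall>m\<ge>N. \<forall>n. norm (\<Sum>i=m..<n. A i v) < e" by blast
    qed
  qed
  hence s: "(\<lambda>i. A i v) sums (\<Sum>i. A i v)" for v by (rule summable_sums)
  define f where "f v = (\<Sum>i. A i v)" for v
  note s = s[folded f_def]
  have "bounded_linear f"
  proof (rule bounded_linear_intro[where K = 1])
    show "f (x + y) = f x + f y" for x y
      by (rule sums_unique2[OF s[of "x + y"] sums_add[OF s[of x] s[of y], folded blinfun.add_right]])
    show "f (r *\<^sub>R x) = r *\<^sub>R f x" for r x
      by (rule sums_unique2[OF s[of "r *\<^sub>R x"]
            sums_scaleR_right[OF s[of x], of r, folded blinfun.scaleR_right]])
    show "norm (f v) \<le> norm v * 1" for v
    proof -
      have "norm (\<Sum>i<n. A i v) \<le> norm v" for n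
      proof -
        have "(norm (\<Sum>i<n. A i v))\<^sup>2 \<le> (norm v)\<^sup>2"
          by (subst norm_sum_orthogonal) (auto simp: orth bound)
        thus ?thesis by (rule power2_le_imp_le) simp
      qed
      hence "norm (f v) \<le> norm v"
        using s[of v] unfolding sums_def by (intro Lim_norm_ubound[of sequentially]) auto
      thus ?thesis by simp
    qed
  qed
  then have app: "Blinfun f v = f v" for v by (simp add: bounded_linear_Blinfun_apply)
  have "f (c *\<^sub>C v) = c *\<^sub>C f v" for c v
  proof (rule sums_unique2[OF s[of "c *\<^sub>C v"]])
    have "(\<lambda>i. c *\<^sub>C A i v) sums (c *\<^sub>C f v)"
      by (rule bounded_linear.sums[OF bounded_bilinear.bounded_linear_right[OF bounded_bilinear_scaleC] s])
    thus "(\<lambda>i. A i (c *\<^sub>C v)) sums (c *\<^sub>C f v)" by (simp add: bounded_operators_scaleC[OF A])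
  qed
  thus ?thesis by (intro bexI[of _ "Blinfun f"] bounded_operatorsI) (simp_all add: app s)
qed

lemma Bessel:
  fixes u :: "nat \<Rightarrow> 'a::chilbert_space"
  assumes "orthonormal u"
  shows "(\<Sum>i<n. (cmod (cinner v (u i)))\<^sup>2) \<le> (norm v)\<^sup>2"
proof -
  define p where "p = (\<Sum>i<n. cinner v (u i) *\<^sub>C u i)"
  have n: "(norm p)\<^sup>2 = (\<Sum>i<n. (cmod (cinner v (u i)))\<^sup>2)"
    using assms unfolding p_def
    by (subst norm_sum_orthogonal)
       (auto simp: cinner_scaleC_left cinner_scaleC_right orthonormalD norm_scaleC)
  have "cinner p (u i) = cinner v (u i)" if "i < n" for i
  proof -
    have "cinner p (u i) = (\<Sum>j<n. if j = i then cinner v (u j) else 0)"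
      using assms unfolding p_def cinner_sum_left
      by (intro sum.cong) (auto simp: cinner_scaleC_left orthonormal_def)
    thus ?thesis using that by simp
  qed
  hence "cinner (v - p) p = 0"
    unfolding p_def[of] cinner_sum_right
    by (intro sum.neutral ballI) (simp add: cinner_scaleC_right cinner_diff_left p_def[symmetric])
  from pythagoras[OF this] show ?thesis using n by simp
qed

lemma orthonormal_diagonal_operator:
  assumes "orthonormal e" "orthonormal u"
  shows "\<exists>T\<in>bounded_operators. \<forall>v. (\<lambda>i. cinner v (u i) *\<^sub>C e i) sums T v"
proof -
  have "\<exists>T\<in>bounded_operators. \<forall>v. (\<lambda>i. rank1 (e i) (u i) v) sums T v"
  proof (rule orthogonal_operator_sum)
    show "cinner (rank1 (e i) (u i) v) (rank1 (e j) (u j) w) = 0" if "i \<noteq> j" for i j v w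
      using that assms(1) by (simp add: cinner_scaleC_left cinner_scaleC_right orthonormalD)
    show "(\<Sum>i<n. (norm (rank1 (e i) (u i) v))\<^sup>2) \<le> (norm v)\<^sup>2" for n v
      using Bessel[OF assms(2), of v n] assms(1) by (simp add: norm_scaleC orthonormalD)
  qed simp
  thus ?thesis by simp
qed

section \<open>Nests\<close>

lemma nestD:
  assumes "nest N"
  shows nest_closed_csubspace: "M \<in> N \<Longrightarrow> closed_csubspace M"
    and nest_chain: "L \<in> N \<Longrightarrow> M \<in> N \<Longrightarrow> L \<subseteq> M \<or> M \<subseteq> L"
    and nest_zero: "{0} \<in> N" and nest_UNIV: "UNIV \<in> N"
    and nest_Inter: "F \<subseteq> N \<Longrightarrow> \<Inter>F \<in> N"
    and nest_Union: "F \<subseteq> N \<Longrightarrow> closure (cspan (\<Union>F)) \<in> N"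
  using assms by (auto simp: nest_def closed_csubspace_def)

lemma nest_algebra_bounded: "T \<in> nest_algebra N \<Longrightarrow> T \<in> bounded_operators"
  and nest_algebra_invariant: "T \<in> nest_algebra N \<Longrightarrow> M \<in> N \<Longrightarrow> x \<in> M \<Longrightarrow> T x \<in> M"
  by (auto simp: nest_algebra_def)

lemma nest_algebraI:
  "T \<in> bounded_operators \<Longrightarrow> (\<And>M x. M \<in> N \<Longrightarrow> x \<in> M \<Longrightarrow> T x \<in> M) \<Longrightarrow> T \<in> nest_algebra N"
  by (auto simp: nest_algebra_def)

lemma nest_algebra_closed_under:
  assumes "nest N"
  shows "S \<in> nest_algebra N \<Longrightarrow> T \<in> nest_algebra N \<Longrightarrow> S + T \<in> nest_algebra N"
    and "T \<in> nest_algebra N \<Longrightarrow> blinfun_scaleC c T \<in> nest_algebra N"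
    and "S \<in> nest_algebra N \<Longrightarrow> T \<in> nest_algebra N \<Longrightarrow> S o\<^sub>L T \<in> nest_algebra N"
    and "id_blinfun \<in> nest_algebra N"
  using nest_closed_csubspace[OF assms]
  by (auto intro!: nest_algebraI csubspace_add csubspace_scaleC simp: nest_algebra_bounded
      blinfun.add_left nest_algebra_invariant closed_csubspace_def)

lemma closed_nest_algebra:
  assumes "nest N" shows "closed (nest_algebra N)"
proof -
  have "nest_algebra N = bounded_operators \<inter> (\<Inter>M\<in>N. \<Inter>x\<in>M. {T. blinfun_apply T x \<in> M})"
    by (auto simp: nest_algebra_def)
  also have "closed \<dots>"
  proof (intro closed_Int closed_bounded_operators closed_INT ballI)
    fix M and x :: 'a assume "M \<in> N"
    hence "closed M" using nest_closed_csubspace[OF assms] by (simp add: closed_csubspace_def)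
    thus "closed {T. blinfun_apply T x \<in> M}"
      by (rule closed_vimage[unfolded vimage_def]) (intro continuous_intros)
  qed
  finally show ?thesis .
qed

text \<open>Convergence at each vector is enough: invariance of a closed subspace passes to strong
  limits.\<close>

lemma nest_algebra_sums:
  fixes T :: "'a::chilbert_space \<Rightarrow>\<^sub>L 'a" and A :: "nat \<Rightarrow> 'a \<Rightarrow>\<^sub>L 'a"
  assumes "nest N" "T \<in> bounded_operators" "\<And>v. (\<lambda>i. A i v) sums T v" "\<And>i. A i \<in> nest_algebra N"
  shows "T \<in> nest_algebra N"
proof (rule nest_algebraI)
  fix M x assume M: "M \<in> N" "x \<in> M"
  show "T x \<in> M"
    using closed_csubspace_sums[OF nest_closed_csubspace[OF assms(1) M(1)] assms(3)[of x]]
      nest_algebra_invariant[OF assms(4) M] by blast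
qed (rule assms)

text \<open>On \<open>M\<close> the operator either vanishes or takes its values in a line that
  \<open>M\<close> contains.\<close>

lemma rank1_in_nest_algebra:
  assumes "nest N" "\<And>M. M \<in> N \<Longrightarrow> x \<in> M \<or> y \<in> ocomp M"
  shows "rank1 x y \<in> nest_algebra N"
proof (rule nest_algebraI)
  fix M z assume M: "M \<in> N" "z \<in> M"
  show "rank1 x y z \<in> M"
  proof (cases "x \<in> M")
    case True
    thus ?thesis using nest_closed_csubspace[OF assms(1) M(1)]
      by (simp add: closed_csubspace_def csubspace_scaleC)
  next
    case False
    hence "cinner z y = 0" using assms(2)[OF M(1)] ocomp_sym M(2) by blast
    thus ?thesis using nest_closed_csubspace[OF assms(1) M(1)]
      by (simp add: closed_csubspace_def csubspace_zero)
  qed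
qed simp

lemma rank1_in_nest_algebra_at:
  assumes "nest N" "M \<in> N" "x \<in> M" "y \<in> ocomp M"
  shows "rank1 x y \<in> nest_algebra N"
proof (rule rank1_in_nest_algebra[OF assms(1)])
  fix L assume "L \<in> N"
  thus "x \<in> L \<or> y \<in> ocomp L"
    using nest_chain[OF assms(1,2), of L] ocomp_antimono[of L M] assms(3,4) by blast
qed

lemma proj_commute_nest:
  assumes "nest N" "M \<in> N" "L \<in> N" "x \<in> L"
  shows "proj M x \<in> L"
proof (cases "L \<subseteq> M")
  case True
  thus ?thesis using assms proj_id[OF nest_closed_csubspace[OF assms(1,2)]] by auto
next
  case False
  thus ?thesis using assms nest_chain[OF assms(1-3)] proj_in[OF nest_closed_csubspace[OF assms(1,2)]]
    by blast
qed

lemma proj_in_nest_algebra: "nest N \<Longrightarrow> M \<in> N \<Longrightarrow> proj M \<in> nest_algebra N"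
  by (intro nest_algebraI proj_bounded proj_commute_nest) (auto simp: nest_closed_csubspace)

lemma ocomp_UNIV [simp]: "ocomp UNIV = {0}"
proof -
  have "x = 0" if "x \<in> ocomp UNIV" for x :: 'a
  proof -
    have "cinner x x = 0" using that unfolding ocomp_def by blast
    thus ?thesis by simp
  qed
  thus ?thesis by (auto simp: ocomp_def)
qed

lemma ocomp_zero [simp]: "ocomp {0} = UNIV"
  by (simp add: ocomp_def)

lemma in_ocomp_singleton: "y \<in> ocomp {x} \<longleftrightarrow> cinner x y = 0"
  using cinner_commute_zero[of y x] by (simp add: ocomp_def)

lemma subset_closure_cspan: "M \<in> F \<Longrightarrow> M \<subseteq> closure (cspan (\<Union>F))"
  by (rule order_trans[OF Union_upper order_trans[OF complex_vector.span_superset closure_subset]])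

lemma ocomp_span_Union: "ocomp (closure (cspan (\<Union>G))) = \<Inter>(ocomp ` G)"
proof
  show "ocomp (closure (cspan (\<Union>G))) \<subseteq> \<Inter>(ocomp ` G)"
    by (intro INT_greatest ocomp_antimono subset_closure_cspan)
  show "\<Inter>(ocomp ` G) \<subseteq> ocomp (closure (cspan (\<Union>G)))"
  proof
    fix x assume x: "x \<in> \<Inter>(ocomp ` G)"
    \<comment> \<open>Orthogonality read from the other side: \<open>ocomp {x}\<close> is a closed
      subspace that contains every member of \<open>G\<close>, hence also their closed span.\<close>
    have "\<Union>G \<subseteq> ocomp {x}" using x unfolding subset_iff in_ocomp_singleton by (auto simp: ocomp_def)
    hence "closure (cspan (\<Union>G)) \<subseteq> ocomp {x}"
      using closed_csubspace_ocomp[of "{x}"]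
      by (intro closure_minimal complex_vector.span_minimal) (auto simp: closed_csubspace_def)
    thus "x \<in> ocomp (closure (cspan (\<Union>G)))"
      using in_ocomp_singleton unfolding ocomp_def[of "closure (cspan (\<Union>G))"] by blast
  qed
qed

text \<open>Complements reverse inclusions and exchange intersections with closed spans. Since
  adjoints carry one nest algebra to the other, statements about a nest have mirror images.\<close>

lemma nest_ocomp:
  assumes "nest N" shows "nest (ocomp ` N)"
  unfolding nest_def
proof (intro conjI ballI allI impI)
  note cl = nest_closed_csubspace[OF assms]
  show "{0} \<in> ocomp ` N" using nest_UNIV[OF assms] ocomp_UNIV by blast
  show "UNIV \<in> ocomp ` N" using nest_zero[OF assms] ocomp_zero by blast
  fix F assume "F \<subseteq> ocomp ` N"
  then obtain G where G: "G \<subseteq> N" "F = ocomp ` G" by (auto simp: subset_image_iff)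
  show "\<Inter>F \<in> ocomp ` N"
    using nest_Union[OF assms G(1)] ocomp_span_Union[of G] G(2) by blast
  have "ocomp (closure (cspan (\<Union>F))) = \<Inter>(ocomp ` ocomp ` G)"
    by (simp add: G(2) ocomp_span_Union)
  also have "ocomp ` ocomp ` G = G"
    using cl G(1) by (force simp: image_image ocomp_ocomp)
  finally have "closure (cspan (\<Union>F)) = ocomp (\<Inter>G)"
    using ocomp_ocomp[of "closure (cspan (\<Union>F))"]
    by (simp add: closed_csubspace_def csubspace_closure complex_vector.subspace_span)
  thus "closure (cspan (\<Union>F)) \<in> ocomp ` N" using nest_Inter[OF assms G(1)] by blast
next
  fix L M assume "L \<in> ocomp ` N" "M \<in> ocomp ` N"
  then obtain L' M' where "L' \<in> N" "M' \<in> N" "L = ocomp L'" "M = ocomp M'" by blast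
  thus "L \<subseteq> M \<or> M \<subseteq> L"
    using nest_chain[OF assms, of L' M'] ocomp_antimono[of L' M'] ocomp_antimono[of M' L'] by auto
qed (use closed_csubspace_ocomp in \<open>auto simp: closed_csubspace_def\<close>)

lemma adj_nest_algebra:
  assumes "nest N" "T \<in> nest_algebra N"
  shows "adj T \<in> nest_algebra (ocomp ` N)"
proof (rule nest_algebraI)
  show "adj T \<in> bounded_operators" using assms by (simp add: nest_algebra_bounded)
  fix M x assume "M \<in> ocomp ` N" "x \<in> M"
  then obtain L where L: "L \<in> N" "M = ocomp L" "x \<in> ocomp L" by auto
  have "cinner (adj T x) m = 0" if "m \<in> L" for m
    using L(3) nest_algebra_invariant[OF assms(2) L(1) that]
    by (simp add: cinner_adj_left nest_algebra_bounded[OF assms(2)] ocomp_def)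
  thus "adj T x \<in> M" using L by (simp add: ocomp_def)
qed

lemma ocomp_ocomp_nest: "nest N \<Longrightarrow> ocomp ` ocomp ` N = N"
  using nest_closed_csubspace by (force simp: image_image ocomp_ocomp)

lemma infd_mono: "infd M \<Longrightarrow> M \<subseteq> L \<Longrightarrow> infd L"
  by (auto simp: infd_def)

section \<open>Chains in a nest and orthonormal sequences along them\<close>

lemma exists_unit_orthogonal:
  assumes "closed_csubspace L" "csubspace M" "L \<subset> M"
  shows "\<exists>x\<in>M. x \<in> ocomp L \<and> norm x = 1"
proof -
  obtain y where y: "y \<in> M" "y \<notin> L" using assms(3) by blast
  define z where "z = y - proj L y"
  have z: "z \<noteq> 0" using y proj_in[OF assms(1), of y] by (auto simp: z_def)
  have "z \<in> M" using y assms proj_in[OF assms(1), of y] by (auto simp: z_def intro: csubspace_diff)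
  moreover have "z \<in> ocomp L" by (simp add: z_def minus_proj_in_ocomp[OF assms(1)])
  ultimately show ?thesis
    using normalize_orthogonal(1)[OF z] assms(2) closed_csubspace_ocomp[of L]
    by (intro bexI[of _ "(1 / norm z) *\<^sub>R z"] conjI) (auto simp: closed_csubspace_def csubspace_scaleR)
qed

lemma exists_unit: "csubspace M \<Longrightarrow> M \<noteq> {0} \<Longrightarrow> \<exists>x\<in>M. norm x = 1"
proof -
  assume M: "csubspace M" "M \<noteq> {0}"
  hence "{0} \<subset> M" using csubspace_zero by blast
  thus ?thesis using exists_unit_orthogonal[of "{0}" M] M
    by (auto simp: closed_csubspace_def intro: csubspaceI)
qed

lemma descending_orthonormal:
  assumes "\<And>n::nat. closed_csubspace (L n)" "\<And>n. L (Suc n) \<subset> L n"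
  shows "\<exists>e. orthonormal e \<and> (\<forall>n. e n \<in> L n \<and> e n \<in> ocomp (L (Suc n)))"
proof -
  have "\<exists>x\<in>L n. x \<in> ocomp (L (Suc n)) \<and> norm x = 1" for n
    using assms by (intro exists_unit_orthogonal) (auto simp: closed_csubspace_def)
  then obtain e where e: "\<And>n. e n \<in> L n \<and> e n \<in> ocomp (L (Suc n)) \<and> norm (e n) = 1" by metis
  have "antimono L" using assms(2) by (intro decseq_SucI) blast
  have "cinner (e j) (e i) = 0" if "i < j" for i j
  proof -
    have "L j \<subseteq> L (Suc i)" using antimonoD[OF \<open>antimono L\<close>, of "Suc i" j] that by simp
    hence "e j \<in> L (Suc i)" using e by blast
    thus ?thesis using e ocomp_sym by blast
  qed
  hence "orthonormal e" using e by (intro orthonormalI) auto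
  thus ?thesis using e by blast
qed

lemma ascending_orthonormal:
  assumes "\<And>n::nat. closed_csubspace (L n)" "\<And>n. L n \<subset> L (Suc n)"
  shows "\<exists>e. orthonormal e \<and> (\<forall>n. e n \<in> L (Suc n) \<and> e n \<in> ocomp (L n))"
proof -
  have "ocomp (L (Suc n)) \<subset> ocomp (L n)" for n
    using assms(2)[of n] ocomp_antimono[of "L n" "L (Suc n)"]
      ocomp_ocomp[OF assms(1)[of n]] ocomp_ocomp[OF assms(1)[of "Suc n"]] by (metis psubset_eq)
  from descending_orthonormal[of "\<lambda>n. ocomp (L n)", OF closed_csubspace_ocomp this]
  show ?thesis using assms(1) by (auto simp: ocomp_ocomp)
qed

text \<open>A nonzero member with no smaller nonzero member would lie in the intersection, which is
  zero; so the descent never stops.\<close>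

lemma nest_descending:
  assumes "nest N" "\<Inter>{L\<in>N. L \<noteq> {0}} = {0}" "M \<in> N" "M \<noteq> {0}"
  shows "\<exists>L. L 0 = M \<and> (\<forall>n. L n \<in> N \<and> L n \<noteq> {0} \<and> L (Suc n) \<subset> L n)"
proof -
  have step: "\<exists>L'. (L' \<in> N \<and> L' \<noteq> {0}) \<and> L' \<subset> L" if L: "L \<in> N \<and> L \<noteq> {0}" for L
  proof (rule ccontr)
    assume no: "\<not> ?thesis"
    have "L \<subseteq> L'" if "L' \<in> N" "L' \<noteq> {0}" for L'
      using no that nest_chain[OF assms(1), of L L'] L by blast
    hence "L \<subseteq> {0}" using assms(2) by blast
    moreover have "0 \<in> L" using nest_closed_csubspace[OF assms(1)] L
      by (auto simp: closed_csubspace_def csubspace_zero)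
    ultimately show False using L by blast
  qed
  then obtain g where g: "\<And>L. L \<in> N \<and> L \<noteq> {0} \<Longrightarrow> (g L \<in> N \<and> g L \<noteq> {0}) \<and> g L \<subset> L" by metis
  define L where "L n = (g ^^ n) M" for n
  have inv: "L n \<in> N \<and> L n \<noteq> {0}" for n
    by (induction n) (use assms g in \<open>auto simp: L_def\<close>)
  have "L (Suc n) \<subset> L n" for n using g[OF inv, of n] by (simp add: L_def)
  thus ?thesis using inv by (intro exI[of _ L]) (auto simp: L_def)
qed

lemma nest_bottom_vector:
  assumes "nest N" "\<Inter>{L\<in>N. L \<noteq> {0}} \<noteq> {0}"
  shows "\<exists>x. norm x = 1 \<and> (\<forall>L\<in>N. L = {0} \<or> x \<in> L)"
proof -
  have "\<Inter>{L\<in>N. L \<noteq> {0}} \<in> N" by (rule nest_Inter[OF assms(1)]) auto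
  hence "csubspace (\<Inter>{L\<in>N. L \<noteq> {0}})"
    using nest_closed_csubspace[OF assms(1)] by (simp add: closed_csubspace_def)
  from exists_unit[OF this assms(2)] show ?thesis by blast
qed

text \<open>Otherwise the nonzero members would meet in zero, and an infinite descent starting at
  \<open>M\<close> would place an orthonormal sequence in a finite-dimensional space.\<close>

lemma nest_bottom_vector_finite:
  assumes "nest N" "M \<in> N" "M \<noteq> {0}" "\<not> infd M"
  shows "\<exists>x. norm x = 1 \<and> (\<forall>L\<in>N. L = {0} \<or> x \<in> L)"
proof (rule nest_bottom_vector[OF assms(1)], rule notI)
  assume "\<Inter>{L\<in>N. L \<noteq> {0}} = {0}"
  from nest_descending[OF assms(1) this assms(2,3)] obtain L
    where L: "L 0 = M" "\<And>n. L n \<in> N \<and> L (Suc n) \<subset> L n" by blast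
  obtain e where e: "orthonormal e" "\<And>n. e n \<in> L n"
    using descending_orthonormal[of L] L nest_closed_csubspace[OF assms(1)] by blast
  have "antimono L" using L by (intro decseq_SucI) blast
  hence "L n \<subseteq> M" for n using antimonoD[of L 0 n] L(1) by simp
  thus False using e assms(4) by (force simp: infd_def)
qed

text \<open>The vector \<open>x\<close> makes all \<open>rank1 x u\<close> members of the nest
  algebra. The sequence \<open>e\<close> makes \<open>rank1 (e i) u\<close> a member as soon as
  \<open>u\<close> is orthogonal to the finite-dimensional \<open>F i\<close>, which amounts to
  finitely many conditions on \<open>u\<close>.\<close>

definition left_condition :: "'a::chilbert_space set set \<Rightarrow> bool"
  where "left_condition N \<longleftrightarrow> (\<exists>x. norm x = 1 \<and> (\<forall>M\<in>N. M = {0} \<or> x \<in> M)) \<and>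
    (infd (UNIV :: 'a set) \<longrightarrow> (\<exists>e F. orthonormal e \<and>
      (\<forall>i. F i \<in> N \<and> \<not> infd (F i) \<and> (\<forall>M\<in>N. e i \<in> M \<or> M \<subseteq> F i))))"

text \<open>No finite-dimensional member is greatest among those of its kind, so they contain an
  infinite ascending chain \<open>L\<close>. A unit vector \<open>e i\<close> from the i-th step of
  the chain goes with \<open>F i = L (Suc i)\<close>.\<close>

lemma left_condition_infinite_union:
  assumes N: "nest N" and inf: "infd (closure (cspan (\<Union>{M\<in>N. \<not> infd M})))"
  shows "left_condition N"
proof -
  have "\<exists>M'. (M' \<in> N \<and> \<not> infd M') \<and> M \<subset> M'" if M: "M \<in> N \<and> \<not> infd M" for M
  proof (rule ccontr)
    assume no: "\<not> ?thesis"
    have "\<Union>{M\<in>N. \<not> infd M} \<subseteq> M" using no nest_chain[OF N] M by blast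
    hence "closure (cspan (\<Union>{M\<in>N. \<not> infd M})) \<subseteq> M"
      using nest_closed_csubspace[OF N] M
      by (intro closure_minimal complex_vector.span_minimal) (auto simp: closed_csubspace_def)
    thus False using inf M infd_mono by blast
  qed
  then obtain g where g: "\<And>M. M \<in> N \<and> \<not> infd M \<Longrightarrow> (g M \<in> N \<and> \<not> infd (g M)) \<and> M \<subset> g M" by metis
  define L where "L n = (g ^^ n) {0}" for n
  have "\<not> infd {0::'a}" by (rule not_infd_cspan[of "{}"]) auto
  hence inv: "L n \<in> N \<and> \<not> infd (L n)" for n
    by (induction n) (use nest_zero[OF N] g in \<open>auto simp: L_def\<close>)
  have step: "L n \<subset> L (Suc n)" for n using g[OF inv, of n] by (simp add: L_def)
  obtain e where e: "orthonormal e" "\<And>n. e n \<in> L (Suc n)"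
    using ascending_orthonormal[of L] inv step nest_closed_csubspace[OF N] by blast
  have "L (Suc 0) \<noteq> {0}" using step[of 0] by (auto simp: L_def)
  from nest_bottom_vector_finite[OF N _ this] inv
  have "\<exists>x. norm x = 1 \<and> (\<forall>M\<in>N. M = {0} \<or> x \<in> M)" by blast
  moreover have "e i \<in> M \<or> M \<subseteq> L (Suc i)" if "M \<in> N" for M i
    using nest_chain[OF N that] inv e(2) by blast
  ultimately show ?thesis
    unfolding left_condition_def using e inv by (intro conjI impI exI[of _ e] exI[of _ "\<lambda>i. L (Suc i)"]) auto
qed

text \<open>Let \<open>L\<close> be the closed span of the finite-dimensional members and
  \<open>L'\<close> the intersection of the infinite-dimensional ones. If \<open>L\<close> is
  infinite-dimensional, \<open>left_condition_infinite_union\<close> applies. If only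
  \<open>L'\<close> is, an orthonormal sequence in \<open>L'\<close> lies in every
  infinite-dimensional member, and \<open>L\<close> contains all other members. If \<open>L'\<close>
  is finite-dimensional, the nest of complements takes over.\<close>

lemma left_condition_cases:
  fixes N :: "'a::chilbert_space set set"
  assumes N: "nest N" and nz: "(UNIV :: 'a set) \<noteq> {0}"
    and no: "\<And>M. M \<in> N \<Longrightarrow> infd M \<Longrightarrow> \<not> infd (ocomp M)"
  shows "left_condition N \<or> left_condition (ocomp ` N)"
proof (cases "infd (UNIV :: 'a set)")
  case False
  thus ?thesis
    using nest_bottom_vector_finite[OF N nest_UNIV[OF N] nz] by (simp add: left_condition_def)
next
  case True
  define L where "L = closure (cspan (\<Union>{M\<in>N. \<not> infd M}))"
  define L' where "L' = \<Inter>{M\<in>N. infd M}"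
  have L: "L \<in> N" unfolding L_def by (rule nest_Union[OF N]) auto
  have L': "L' \<in> N" unfolding L'_def by (rule nest_Inter[OF N]) auto
  have subL: "M \<subseteq> L" if "M \<in> N" "\<not> infd M" for M
    unfolding L_def using that by (intro subset_closure_cspan) simp
  consider "infd L" | "\<not> infd L" "infd L'" | "\<not> infd L'" by blast
  thus ?thesis
  proof cases
    case 1
    thus ?thesis using left_condition_infinite_union[OF N] by (simp add: L_def)
  next
    case 2
    have "L \<subseteq> L'" using nest_chain[OF N L L'] 2 infd_mono by blast
    then have "infd (L' \<inter> ocomp L)"
      using 2 L L' nest_closed_csubspace[OF N]
      by (intro infd_relative_complement) (auto simp: closed_csubspace_def)
    then obtain e where e: "orthonormal e" "\<And>i. e i \<in> L'" by (auto simp: infd_def)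
    have dich: "x \<in> M \<or> M \<subseteq> L" if "M \<in> N" "x \<in> L'" for M x
      using subL[OF that(1)] that unfolding L'_def by blast
    have "\<exists>x. norm x = 1 \<and> (\<forall>M\<in>N. M = {0} \<or> x \<in> M)"
    proof (cases "L = {0}")
      case True
      have "0 \<in> M" if "M \<in> N" for M
        using nest_closed_csubspace[OF N that] by (simp add: closed_csubspace_def csubspace_zero)
      thus ?thesis using True dich e orthonormalD(1)[OF e(1)] by (intro exI[of _ "e 0"]) blast
    next
      case False
      show ?thesis by (rule nest_bottom_vector_finite[OF N L False 2(1)])
    qed
    thus ?thesis unfolding left_condition_def using e dich L 2
      by (intro disjI1 conjI impI exI[of _ e] exI[of _ "\<lambda>_. L"]) auto
  next
    case 3
    \<comment> \<open>By \<open>no\<close>, complements of infinite-dimensional members are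
      finite-dimensional and thus lie in \<open>K\<close>. So the complement of \<open>K\<close>
      lies in \<open>L'\<close>, and \<open>K\<close> is infinite-dimensional.\<close>
    define K where "K = closure (cspan (\<Union>{M\<in>ocomp ` N. \<not> infd M}))"
    have K: "closed_csubspace K"
      by (simp add: K_def closed_csubspace_def csubspace_closure complex_vector.subspace_span)
    have "ocomp K = \<Inter>(ocomp ` {M\<in>ocomp ` N. \<not> infd M})" by (simp add: K_def ocomp_span_Union)
    also have "\<dots> \<subseteq> L'"
    proof
      fix x assume x: "x \<in> \<Inter>(ocomp ` {M\<in>ocomp ` N. \<not> infd M})"
      have "x \<in> M" if "M \<in> N" "infd M" for M
        using x no[OF that] that nest_closed_csubspace[OF N that(1)] ocomp_ocomp by fastforce
      thus "x \<in> L'" by (simp add: L'_def)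
    qed
    finally have "\<not> infd (ocomp K)" using 3 infd_mono by blast
    hence "infd (UNIV \<inter> ocomp (ocomp K))"
      using True by (intro infd_relative_complement closed_csubspace_ocomp) auto
    hence "infd K" by (simp add: ocomp_ocomp[OF K])
    thus ?thesis using left_condition_infinite_union[OF nest_ocomp[OF N]] by (simp add: K_def)
  qed
qed

section \<open>Homomorphisms converging to the identity\<close>

text \<open>Sequential form of strong continuity at time 0: \<open>a k\<close> will be the flow at
  the k-th term of a null sequence of times. The axioms are stable under passing to adjoints, which
  gives access to the mirror image of every result.\<close>

locale approx_hom =
  fixes B :: "('a::chilbert_space \<Rightarrow>\<^sub>L 'a) set"
    and a :: "nat \<Rightarrow> ('a \<Rightarrow>\<^sub>L 'a) \<Rightarrow> ('a \<Rightarrow>\<^sub>L 'a)"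
  assumes B_bounded: "T \<in> B \<Longrightarrow> T \<in> bounded_operators"
    and B_add: "S \<in> B \<Longrightarrow> T \<in> B \<Longrightarrow> S + T \<in> B"
    and B_scaleC: "T \<in> B \<Longrightarrow> blinfun_scaleC c T \<in> B"
    and B_compose: "S \<in> B \<Longrightarrow> T \<in> B \<Longrightarrow> S o\<^sub>L T \<in> B"
    and a_bounded: "T \<in> B \<Longrightarrow> a k T \<in> bounded_operators"
    and a_add: "S \<in> B \<Longrightarrow> T \<in> B \<Longrightarrow> a k (S + T) = a k S + a k T"
    and a_scaleC: "T \<in> B \<Longrightarrow> a k (blinfun_scaleC c T) = blinfun_scaleC c (a k T)"
    and a_compose: "S \<in> B \<Longrightarrow> T \<in> B \<Longrightarrow> a k (S o\<^sub>L T) = a k S o\<^sub>L a k T"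
    and a_lim: "T \<in> B \<Longrightarrow> (\<lambda>k. a k T) \<longlonglongrightarrow> T"
begin

definition err :: "nat \<Rightarrow> ('a \<Rightarrow>\<^sub>L 'a) \<Rightarrow> ('a \<Rightarrow>\<^sub>L 'a)"
  where "err k T = a k T - T"

lemma err_add: "S \<in> B \<Longrightarrow> T \<in> B \<Longrightarrow> err k (S + T) = err k S + err k T"
  by (simp add: err_def a_add)

lemma err_scaleC: "T \<in> B \<Longrightarrow> err k (blinfun_scaleC c T) = blinfun_scaleC c (err k T)"
  by (rule blinfun_eqI) (simp add: err_def a_scaleC blinfun.diff_left scaleC_diff_right)

lemma eventually_err_le:
  assumes "T \<in> B" "\<eta> > 0"
  shows "\<forall>\<^sub>F k in sequentially. norm (err k T) \<le> \<eta>"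
proof -
  have "(\<lambda>k. norm (err k T)) \<longlonglongrightarrow> norm (T - T)"
    unfolding err_def by (intro tendsto_intros a_lim assms)
  hence "\<forall>\<^sub>F k in sequentially. norm (err k T) < \<eta>"
    using assms(2) by (intro order_tendstoD(2)[of _ "norm (T - T)"]) auto
  thus ?thesis by (rule eventually_mono) simp
qed

lemma norm_a_le: "norm (a k T) \<le> norm (err k T) + norm T"
  unfolding err_def by (metis diff_add_cancel norm_triangle_ineq)

text \<open>A discrete product rule; \<open>norm (a k T)\<close> on the right is in turn controlled
  by \<open>norm_a_le\<close>.\<close>

lemma norm_err_compose:
  assumes "S \<in> B" "T \<in> B"
  shows "norm (err k (S o\<^sub>L T)) \<le> norm (err k S) * norm (a k T) + norm S * norm (err k T)"
proof -
  have "err k (S o\<^sub>L T) = (err k S o\<^sub>L a k T) + (S o\<^sub>L err k T)"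
    by (rule blinfun_eqI)
       (simp add: err_def a_compose assms blinfun.diff_left blinfun.diff_right blinfun.add_left)
  thus ?thesis by (metis norm_triangle_mono norm_blinfun_compose)
qed

text \<open>Over a finite-dimensional space of vectors \<open>u\<close> pointwise convergence is
  uniform, since only finitely many coefficients occur. Nonemptiness of \<open>S\<close> provides a
  member of \<open>B\<close>, which by the axioms might be empty.\<close>

lemma eventually_err_finite_span:
  assumes "finite S" "\<And>b. b \<in> S \<Longrightarrow> rank1 x b \<in> B" "S \<noteq> {}" "\<eta> > 0"
  shows "\<forall>\<^sub>F k in sequentially. \<forall>u. norm (err k (rank1 x (sproj S u))) \<le> \<eta> * norm u"
proof -
  have B: "rank1 x (sproj F u) \<in> B" if "finite F" "F \<noteq> {}" "F \<subseteq> S" for F u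
    using that
  proof (induction F rule: finite_ne_induct)
    case (singleton b)
    thus ?case using assms(2) by (simp add: sproj_def rank1_scaleC_right B_scaleC)
  next
    case (insert b F)
    thus ?case using assms(2) by (simp add: sproj_insert rank1_add_right rank1_scaleC_right B_add B_scaleC)
  qed
  have single: "\<forall>\<^sub>F k in sequentially. \<forall>u. norm (err k (rank1 x (cinner u b *\<^sub>C b))) \<le> \<delta> * norm u"
    if b: "b \<in> S" and d: "\<delta> > 0" for b \<delta>
  proof -
    have "\<forall>\<^sub>F k in sequentially. norm (err k (rank1 x b)) \<le> \<delta> / (norm b + 1)"
      using d by (intro eventually_err_le assms(2)[OF b]) (simp add: add_nonneg_pos)
    thus ?thesis
    proof (eventually_elim, intro allI)
      fix k u assume k: "norm (err k (rank1 x b)) \<le> \<delta> / (norm b + 1)"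
      have "norm (err k (rank1 x (cinner u b *\<^sub>C b))) = cmod (cinner u b) * norm (err k (rank1 x b))"
        by (simp add: rank1_scaleC_right err_scaleC assms(2)[OF b] norm_blinfun_scaleC)
      also have "\<dots> \<le> (norm u * norm b) * (\<delta> / (norm b + 1))"
        by (intro mult_mono Cauchy_Schwarz k) auto
      also have "\<dots> = (norm b / (norm b + 1)) * (\<delta> * norm u)" by simp
      also have "\<dots> \<le> 1 * (\<delta> * norm u)"
        using d by (intro mult_right_mono) (auto simp: divide_le_eq_1 add_nonneg_pos)
      finally show "norm (err k (rank1 x (cinner u b *\<^sub>C b))) \<le> \<delta> * norm u" by simp
    qed
  qed
  \<comment> \<open>The tolerance is quantified inside the induction because every insertion halves
    it.\<close>
  have "\<forall>\<delta>>0. \<forall>\<^sub>F k in sequentially. \<forall>u. norm (err k (rank1 x (sproj F u))) \<le> \<delta> * norm u"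
    if "finite F" "F \<noteq> {}" "F \<subseteq> S" for F
    using that
  proof (induction F rule: finite_ne_induct)
    case (singleton b)
    thus ?case using single by (simp add: sproj_def)
  next
    case (insert b F)
    show ?case
    proof (intro allI impI)
      fix \<delta> :: real assume d: "\<delta> > 0"
      have "\<forall>\<^sub>F k in sequentially. \<forall>u. norm (err k (rank1 x (sproj F u))) \<le> \<delta>/2 * norm u"
        using insert.IH insert.prems half_gt_zero[OF d] by blast
      moreover have "\<forall>\<^sub>F k in sequentially. \<forall>u. norm (err k (rank1 x (cinner u b *\<^sub>C b))) \<le> \<delta>/2 * norm u"
        using insert d by (intro single) auto
      ultimately show "\<forall>\<^sub>F k in sequentially. \<forall>u. norm (err k (rank1 x (sproj (insert b F) u))) \<le> \<delta> * norm u"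
      proof (eventually_elim, intro allI)
        fix k u
        assume 1: "\<forall>u. norm (err k (rank1 x (sproj F u))) \<le> \<delta>/2 * norm u"
          and 2: "\<forall>u. norm (err k (rank1 x (cinner u b *\<^sub>C b))) \<le> \<delta>/2 * norm u"
        have "err k (rank1 x (sproj (insert b F) u))
            = err k (rank1 x (cinner u b *\<^sub>C b)) + err k (rank1 x (sproj F u))"
          using insert B[of F u] assms(2)[of b]
          by (simp add: sproj_insert rank1_add_right err_add rank1_scaleC_right B_scaleC)
        thus "norm (err k (rank1 x (sproj (insert b F) u))) \<le> \<delta> * norm u"
          using norm_triangle_mono[OF 2[rule_format, of u] 1[rule_format, of u]] by simp
      qed
    qed
  qed
  thus ?thesis using assms by simp
qed

text \<open>If no index worked infinitely often, slowly chosen bad vectors \<open>u i\<close> would give a member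
  \<open>T = \<Sum>i. rank1 (e i) (u i)\<close> of the algebra. Since \<open>rank1 (x i) (e i) o\<^sub>L T = rank1 (x i) (u i)\<close>
  and both factors converge, multiplicativity contradicts the choice of \<open>u i\<close>.\<close>

lemma eventually_err_rank1:
  assumes E: "csubspace E" and x: "\<And>i. norm (x i) = 1" and e: "orthonormal e"
    and r1: "\<And>i. rank1 (x i) (e i) \<in> B"
    and r2: "\<And>i u. u \<in> E \<Longrightarrow> rank1 (x i) u \<in> B"
    and G: "\<And>i. finite (G i)" "\<And>i. G i \<subseteq> E"
    and diag: "\<And>u. orthonormal u \<Longrightarrow> (\<And>i. u i \<in> E) \<Longrightarrow> (\<And>i g. g \<in> G i \<Longrightarrow> cinner (u i) g = 0) \<Longrightarrow>
      \<exists>T\<in>B. \<forall>v. (\<lambda>i. cinner v (u i) *\<^sub>C e i) sums blinfun_apply T v"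
    and \<eta>: "\<eta> > 0"
  shows "\<forall>\<^sub>F k in sequentially. \<exists>i. \<forall>u\<in>E. norm (err k (rank1 (x i) u)) \<le> \<eta> * norm u"
proof (rule ccontr)
  assume "\<not> ?thesis"
  hence bad: "\<exists>\<^sub>F k in sequentially. \<forall>i. \<exists>u\<in>E. norm (err k (rank1 (x i) u)) > \<eta> * norm u"
    by (simp add: not_eventually not_le)
  \<comment> \<open>At stage \<open>i\<close> the set \<open>U\<close> holds the vectors chosen
    before. The condition \<open>i \<le> k\<close> makes the chosen indices tend to infinity, and
    the bound \<open>1 / real (Suc i)\<close> makes the errors of \<open>rank1 (x i) (e i)\<close>
    vanish along them although these operators vary with \<open>i\<close>.\<close>
  define Q where "Q i U k u \<longleftrightarrow> i \<le> k \<and> u \<in> E \<and> norm u = 1 \<and> (\<forall>g\<in>U \<union> G i. cinner u g = 0) \<and>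
      norm (err k (rank1 (x i) (e i))) \<le> 1 / real (Suc i) \<and>
      norm (err k (rank1 (x i) u)) > \<eta> / 2" for i U k and u :: 'a
  have step: "\<exists>k u. Q i U k u" if U: "finite U" "U \<subseteq> E" for i U
  proof -
    from Gram_Schmidt[of "U \<union> G i" E] E U G obtain S where
      S: "finite S" "orthonormal_set S" "S \<subseteq> E"
      and orth: "\<And>u g. \<forall>b\<in>S. cinner u b = 0 \<Longrightarrow> g \<in> U \<union> G i \<Longrightarrow> cinner u g = 0" by auto
    have "\<forall>\<^sub>F k in sequentially. norm (err k (rank1 (x i) (e i))) \<le> 1 / real (Suc i)"
      by (intro eventually_err_le r1) simp
    moreover have "\<forall>\<^sub>F k in sequentially. \<forall>u. norm (err k (rank1 (x i) (sproj S u))) \<le> \<eta>/2 * norm u"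
    proof (cases "S = {}")
      case True
      have "0 \<in> B" using r2[of 0 i] E by (simp add: csubspace_zero)
      from err_add[OF this this] have "err k 0 = 0" for k by simp
      thus ?thesis using \<eta> by (simp add: sproj_def True)
    next
      case False
      thus ?thesis using S r2 \<eta> by (intro eventually_err_finite_span) auto
    qed
    moreover have "\<forall>\<^sub>F k in sequentially. i \<le> k" by (rule eventually_ge_at_top)
    ultimately have "\<forall>\<^sub>F k in sequentially. norm (err k (rank1 (x i) (e i))) \<le> 1 / real (Suc i) \<and>
      (\<forall>u. norm (err k (rank1 (x i) (sproj S u))) \<le> \<eta>/2 * norm u) \<and> i \<le> k"
      by eventually_elim simp
    from frequently_ex[OF frequently_eventually_frequently[OF bad this]]
    obtain k where k: "\<forall>i. \<exists>u\<in>E. norm (err k (rank1 (x i) u)) > \<eta> * norm u"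
      "norm (err k (rank1 (x i) (e i))) \<le> 1 / real (Suc i)"
      "\<And>u. norm (err k (rank1 (x i) (sproj S u))) \<le> \<eta>/2 * norm u" "i \<le> k" by blast
    then obtain u where u: "u \<in> E" "norm (err k (rank1 (x i) u)) > \<eta> * norm u" by blast
    \<comment> \<open>Removing the component along the finite set \<open>S\<close> makes
      \<open>w\<close> orthogonal to all earlier vectors. The error on the removed part is at most
      \<open>\<eta>/2 * norm u\<close>, so half of the badness survives on \<open>w\<close>.\<close>
    define w where "w = u - sproj S u"
    have w: "w \<in> E" "norm w \<le> norm u"
      using u E S by (auto simp: w_def csubspace_diff sproj_in norm_minus_sproj)
    have "rank1 (x i) u = rank1 (x i) w + rank1 (x i) (sproj S u)"
      by (simp add: w_def rank1_add_right[symmetric])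
    hence "err k (rank1 (x i) u) = err k (rank1 (x i) w) + err k (rank1 (x i) (sproj S u))"
      using w E S r2 by (simp add: err_add sproj_in)
    hence "norm (err k (rank1 (x i) u)) \<le> norm (err k (rank1 (x i) w)) + \<eta>/2 * norm u"
      using norm_triangle_mono[OF order_refl k(3)[of u]] by metis
    hence "norm (err k (rank1 (x i) w)) > \<eta>/2 * norm u" using u(2) by simp
    moreover have "\<eta>/2 * norm u \<ge> \<eta>/2 * norm w" using w \<eta> by simp
    ultimately have big: "norm (err k (rank1 (x i) w)) > \<eta>/2 * norm w" by linarith
    have w0: "w \<noteq> 0"
    proof
      assume "w = 0"
      have "0 \<in> B" using r2[of 0 i] E by (simp add: csubspace_zero)
      from err_add[OF this this] have "err k 0 = 0" by simp
      thus False using big \<open>w = 0\<close> by simp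
    qed
    define z where "z = complex_of_real (1 / norm w) *\<^sub>C w"
    have "norm (err k (rank1 (x i) z)) = norm (err k (rank1 (x i) w)) / norm w"
      using r2[OF w(1)]
      by (simp add: z_def rank1_scaleC_right err_scaleC norm_blinfun_scaleC norm_divide)
    hence "norm (err k (rank1 (x i) z)) > \<eta> / 2" using big w0 by (simp add: less_divide_eq)
    moreover have "cinner z g = 0" if "g \<in> U \<union> G i" for g
      using orth[of w, OF _ that] sproj_orth[OF S(1,2)] by (simp add: z_def w_def cinner_scaleC_left)
    moreover have "z \<in> E" "norm z = 1"
      using w E w0 by (auto simp: z_def csubspace_scaleC norm_scaleC norm_divide)
    ultimately have "Q i U k z" using k unfolding Q_def by blast
    thus ?thesis by blast
  qed
  define fk where "fk i U = (SOME k. \<exists>u. Q i U k u)" for i U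
  define fu where "fu i U = (SOME u. Q i U (fk i U) u)" for i U
  have f: "Q i U (fk i U) (fu i U)" if "finite U" "U \<subseteq> E" for i U
    unfolding fu_def by (rule someI_ex) (use someI_ex[OF step[OF that]] in \<open>simp add: fk_def\<close>)
  \<comment> \<open>Recursion over the stages, each one adding its vector to the set that later
    vectors must avoid.\<close>
  define U where "U = rec_nat {} (\<lambda>i V. insert (fu i V) V)"
  have Us: "U 0 = {}" "U (Suc i) = insert (fu i (U i)) (U i)" for i by (simp_all add: U_def)
  define u where "u i = fu i (U i)" for i
  define k where "k i = fk i (U i)" for i
  have U: "finite (U i) \<and> U i \<subseteq> E" for i
  proof (induction i)
    case (Suc i)
    thus ?case using f[of "U i" i] by (auto simp: Us Q_def)
  qed (simp add: Us)
  have Q: "Q i (U i) (k i) (u i)" for i using f U by (simp add: k_def u_def)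
  have mem: "u i \<in> U j" if "i < j" for i j
    using that by (induction j) (auto simp: Us u_def less_Suc_eq)
  have on: "orthonormal u"
    using Q mem by (intro orthonormalI) (auto simp: Q_def)
  from diag[OF on] Q obtain T where T: "T \<in> B" "\<And>v. (\<lambda>i. cinner v (u i) *\<^sub>C e i) sums T v"
    by (auto simp: Q_def)
  have prod: "rank1 (x i) (e i) o\<^sub>L T = rank1 (x i) (u i)" for i
  proof (rule blinfun_eqI)
    fix v
    have "(\<lambda>j. cinner (cinner v (u j) *\<^sub>C e j) (e i)) sums cinner (T v) (e i)"
      by (rule bounded_linear.sums[OF bounded_bilinear.bounded_linear_left[OF bounded_bilinear_cinner] T(2)])
    moreover have "(\<lambda>j. cinner (cinner v (u j) *\<^sub>C e j) (e i)) = (\<lambda>j. if j = i then cinner v (u j) else 0)"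
      using e by (auto simp: fun_eq_iff cinner_scaleC_left orthonormal_def)
    ultimately have "cinner (T v) (e i) = cinner v (u i)"
      using sums_unique2[OF _ sums_single[of i "\<lambda>j. cinner v (u j)"]] by metis
    thus "(rank1 (x i) (e i) o\<^sub>L T) v = rank1 (x i) (u i) v" by simp
  qed
  have k: "filterlim k at_top sequentially"
    by (rule filterlim_at_top_mono[OF filterlim_ident]) (use Q in \<open>auto simp: Q_def\<close>)
  have l1: "(\<lambda>i. 1 / real (Suc i) * norm (a (k i) T)) \<longlonglongrightarrow> 0 * norm T"
    by (intro tendsto_intros filterlim_compose[OF a_lim[OF T(1)] k]
        LIMSEQ_inverse_real_of_nat[unfolded inverse_eq_divide])
  have l2: "(\<lambda>i. norm (a (k i) T - T)) \<longlonglongrightarrow> norm (T - T)"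
    by (intro tendsto_intros filterlim_compose[OF a_lim[OF T(1)] k])
  have "\<eta> / 2 \<le> 1 / real (Suc i) * norm (a (k i) T) + norm (a (k i) T - T)" for i
  proof -
    have "\<eta> / 2 \<le> norm (err (k i) (rank1 (x i) (u i)))" using Q[of i] by (simp add: Q_def)
    also have "\<dots> \<le> norm (err (k i) (rank1 (x i) (e i))) * norm (a (k i) T)
        + norm (rank1 (x i) (e i)) * norm (err (k i) T)"
      using norm_err_compose[OF r1 T(1), of "k i" i] by (simp add: prod)
    also have "\<dots> \<le> 1 / real (Suc i) * norm (a (k i) T) + 1 * norm (a (k i) T - T)"
      using Q[of i] x e by (intro add_mono mult_mono) (auto simp: Q_def norm_rank1 orthonormalD err_def)
    finally show ?thesis by simp
  qed
  hence "\<eta> / 2 \<le> 0 * norm T + norm (T - T)"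
    by (intro LIMSEQ_le_const[OF tendsto_add[OF l1 l2]]) blast
  thus False using \<eta> by simp
qed

text \<open>Multiplication by \<open>rank1 x u\<close> from the left collapses \<open>T\<close> to
  \<open>rank1 x (adj T u)\<close>. The matrix entry of \<open>err k T\<close> at \<open>v\<close>
  and \<open>u\<close>, carried by the unit vector \<open>x\<close>, is therefore a difference of
  two errors of rank-one operators.\<close>

lemma cinner_err_le:
  assumes x: "norm x = 1" and r: "\<And>u. u \<in> E \<Longrightarrow> rank1 x u \<in> B"
    and small: "\<And>u. u \<in> E \<Longrightarrow> norm (err k (rank1 x u)) \<le> \<eta> * norm u"
    and T: "T \<in> B" "\<And>u. u \<in> E \<Longrightarrow> adj T u \<in> E" and u: "u \<in> E" and \<eta>: "0 \<le> \<eta>"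
  shows "cmod (cinner (err k T v) u) \<le> \<eta> * (norm (a k T) + norm T) * norm v * norm u"
proof -
  define W where "W = rank1 x (adj T u)"
  have W: "W \<in> B" "rank1 x u o\<^sub>L T = W"
    using T u r by (auto simp: W_def rank1_compose B_bounded)
  have aW: "a k W = a k (rank1 x u) o\<^sub>L a k T" using a_compose[OF r[OF u] T(1)] W(2) by simp
  have eq: "cinner (err k T v) u *\<^sub>C x = err k W v - err k (rank1 x u) (a k T v)"
    using arg_cong[OF W(2), of "\<lambda>F. F v"] arg_cong[OF aW, of "\<lambda>F. F v"]
    by (simp add: err_def blinfun.diff_left cinner_diff_left scaleC_diff_left)
  have n: "norm (adj T u) \<le> norm T * norm u"
    using norm_blinfun[of "adj T" u] by (simp add: norm_adj B_bounded T)
  have "norm (err k W v) \<le> (\<eta> * (norm T * norm u)) * norm v"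
    using small[OF T(2)[OF u]] mult_left_mono[OF n \<eta>] unfolding W_def
    by (intro order_trans[OF norm_blinfun] mult_right_mono) auto
  moreover have "norm (err k (rank1 x u) (a k T v)) \<le> (\<eta> * norm u) * (norm (a k T) * norm v)"
    using small[OF u] \<eta> by (intro order_trans[OF norm_blinfun] mult_mono norm_blinfun) auto
  moreover have "cmod (cinner (err k T v) u) = norm (cinner (err k T v) u *\<^sub>C x)"
    by (simp add: norm_scaleC x)
  hence "cmod (cinner (err k T v) u) \<le> norm (err k W v) + norm (err k (rank1 x u) (a k T v))"
    unfolding eq by (rule ord_eq_le_trans) (rule norm_triangle_ineq4)
  ultimately show ?thesis by (simp add: algebra_simps)
qed

text \<open>As \<open>norm (a k T)\<close> is at most \<open>norm (err k T) + norm T\<close>, for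
  \<eta> at most 1/2 half of the left-hand side absorbs the error on the right. This stands in for
  an a priori bound on the maps \<open>a k\<close>.\<close>

lemma absorb_err:
  assumes "norm (err k T) \<le> \<eta> * (norm (a k T) + norm T)" "0 \<le> \<eta>" "\<eta> \<le> 1/2"
  shows "norm (err k T) \<le> 4 * \<eta> * norm T"
proof -
  have "norm (err k T) \<le> \<eta> * (norm (err k T) + 2 * norm T)"
    using assms(1) mult_left_mono[OF norm_a_le[of k T] assms(2)] by (simp add: algebra_simps)
  also have "\<dots> \<le> 1/2 * norm (err k T) + 2 * \<eta> * norm T"
    using mult_right_mono[OF assms(3) norm_ge_zero[of "err k T"]] by (simp add: algebra_simps)
  finally show ?thesis by simp
qed

text \<open>A uniform estimate on all of \<open>rank1 x u\<close> for one fixed \<open>x\<close> already controls the algebra.\<close>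

lemma err_le_of_rank1:
  assumes "norm x = 1" "\<And>u. rank1 x u \<in> B" "\<And>u. norm (err k (rank1 x u)) \<le> \<eta> * norm u"
    "0 \<le> \<eta>" "\<eta> \<le> 1/2" "T \<in> B"
  shows "norm (err k T) \<le> 4 * \<eta> * norm T"
proof (rule absorb_err[OF _ assms(4,5)])
  show "norm (err k T) \<le> \<eta> * (norm (a k T) + norm T)"
    using cinner_err_le[of x UNIV k \<eta> T] assms by (intro norm_le_sesquilinear) auto
qed

text \<open>Test the error against \<open>u1\<close> in \<open>E\<close> and \<open>u2\<close>
  orthogonal to \<open>E\<close>. For \<open>u1\<close> the estimate \<open>cinner_err_le\<close>
  applies. For \<open>u2\<close> one uses that \<open>proj E\<close> fixes \<open>rank1 y w\<close>:
  up to the error of \<open>proj E\<close> itself, the result lies in \<open>E\<close>. The two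
  parts give \<open>2 * \<eta>\<close>, and absorption multiplies this by 4.\<close>

lemma err_corner_rank1:
  assumes E: "closed_csubspace E" "proj E \<in> B" and x: "norm x = 1" and r: "\<And>u. u \<in> E \<Longrightarrow> rank1 x u \<in> B"
    and small: "\<And>u. u \<in> E \<Longrightarrow> norm (err k (rank1 x u)) \<le> \<eta> * norm u"
    and P: "norm (err k (proj E)) \<le> \<eta>" and \<eta>: "0 \<le> \<eta>" "\<eta> \<le> 1/4"
    and yw: "y \<in> E" "w \<in> E" "rank1 y w \<in> B"
  shows "norm (err k (rank1 y w)) \<le> 8 * \<eta> * (norm y * norm w)"
proof -
  define A where "A = rank1 y w"
  have A: "A \<in> B" using yw by (simp add: A_def)
  have cE: "csubspace E" using E by (simp add: closed_csubspace_def)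
  have PA: "proj E o\<^sub>L A = A"
    by (simp add: A_def compose_rank1 proj_bounded E proj_id yw)
  have adjE: "adj A u \<in> E" if "u \<in> E" for u
    using that yw cE by (simp add: A_def adj_rank1 csubspace_scaleC)
  have "norm (err k A) \<le> (2 * \<eta>) * (norm (a k A) + norm A)"
  proof (rule norm_le_sesquilinear)
    fix v u
    define u1 u2 where "u1 = proj E u" and "u2 = u - proj E u"
    have u: "u = u1 + u2" "u1 \<in> E" "u2 \<in> ocomp E" "norm u1 \<le> norm u" "norm u2 \<le> norm u"
      using E norm_proj_le[OF closed_csubspace_ocomp, of E u]
      by (auto simp: u1_def u2_def proj_in minus_proj_in_ocomp norm_proj_le proj_ocomp)
    have b1: "cmod (cinner (err k A v) u1) \<le> \<eta> * (norm (a k A) + norm A) * norm v * norm u1"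
      by (rule cinner_err_le[OF x r small A adjE u(2) \<eta>(1)]) auto
    have z: "cinner z u2 = 0" if "z \<in> E" for z using that u(3) ocomp_sym by blast
    have "a k A = a k (proj E) o\<^sub>L a k A" using a_compose[OF E(2) A, of k] PA by simp
    hence "err k A v = err k (proj E) (a k A v) + (proj E (a k A v) - proj E (A v))"
      using PA by (metis (no_types, lifting) err_def blinfun.diff_left blinfun_apply_blinfun_compose
          diff_add_cancel add_diff_eq)
    hence "cinner (err k A v) u2 = cinner (err k (proj E) (a k A v)) u2"
      by (simp add: cinner_add_left cinner_diff_left z proj_in E)
    note e2 = this
    have b2: "cmod (cinner (err k A v) u2) \<le> \<eta> * (norm (a k A) * norm v) * norm u2"
      using mult_right_mono[OF order_trans[OF norm_blinfun[of "err k (proj E)" "a k A v"]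
            mult_mono[OF P norm_blinfun[of "a k A" v] \<eta>(1) norm_ge_zero]] norm_ge_zero[of u2]]
        Cauchy_Schwarz[of "err k (proj E) (a k A v)" u2] unfolding e2 by linarith
    have "cmod (cinner (err k A v) u) \<le> cmod (cinner (err k A v) u1) + cmod (cinner (err k A v) u2)"
      by (subst u(1)) (simp add: cinner_add_right norm_triangle_ineq)
    also have "\<dots> \<le> \<eta> * (norm (a k A) + norm A) * norm v * norm u1 + \<eta> * (norm (a k A) * norm v) * norm u2"
      using b1 b2 by linarith
    also have "\<dots> \<le> \<eta> * (norm (a k A) + norm A) * norm v * norm u + \<eta> * ((norm (a k A) + norm A) * norm v) * norm u"
      using \<eta> u by (intro add_mono mult_mono mult_nonneg_nonneg add_nonneg_nonneg) auto
    finally show "cmod (cinner (err k A v) u) \<le> 2 * \<eta> * (norm (a k A) + norm A) * norm v * norm u"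
      by (simp add: algebra_simps)
  qed (use \<eta> in simp)
  from absorb_err[OF this] \<eta> show ?thesis by (simp add: A_def norm_rank1)
qed

text \<open>The identity \<open>rank1 x e T rank1 y w = \<langle>Ty, e\<rangle> rank1 x w\<close> transports smallness from a few
  rank-one operators to a matrix entry of an arbitrary \<open>T\<close>.\<close>

lemma cinner_err_sandwich:
  assumes n: "norm x0 = 1" "norm w0 = 1" "norm x = 1" "norm w = 1"
    and r: "rank1 x e \<in> B" "rank1 x x0 \<in> B" "rank1 x0 w0 \<in> B" "rank1 w0 w \<in> B" "rank1 y w \<in> B"
    and small: "norm (err k (rank1 x e)) \<le> \<eta> * norm e" "norm (err k (rank1 x x0)) \<le> \<eta>"
      "norm (err k (rank1 x0 w0)) \<le> \<eta>" "norm (err k (rank1 w0 w)) \<le> \<eta>"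
      "norm (err k (rank1 y w)) \<le> \<eta> * norm y"
    and T: "T \<in> B" and \<eta>: "0 \<le> \<eta>" "\<eta> \<le> 1"
  shows "cmod (cinner (err k T y) e) \<le> 7 * \<eta> * (norm (a k T) + norm T) * norm y * norm e"
proof -
  \<comment> \<open>\<open>rank1 x w\<close> is reached through \<open>x0\<close> and
    \<open>w0\<close> as a product of three rank-one operators with error at most \<eta>. The
    product rule gives first \<eta>(\<eta> + 1) + \<eta>, at most 3\<eta>, and then 3\<eta>(\<eta> +
    1) + \<eta>, at most 7\<eta>.\<close>
  define Z where "Z = rank1 x w"
  define c where "c = cinner (T y) e"
  have Z2: "rank1 x w0 = rank1 x x0 o\<^sub>L rank1 x0 w0"
    by (rule blinfun_eqI) (simp add: rank1_rank1 cinner_self n)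
  have Z3: "Z = rank1 x w0 o\<^sub>L rank1 w0 w"
    unfolding Z_def by (rule blinfun_eqI) (simp add: rank1_rank1 cinner_self n)
  have B2: "rank1 x w0 \<in> B" using Z2 r B_compose by simp
  have ZB: "Z \<in> B" using Z3 r B2 B_compose by simp
  have \<eta>\<eta>: "\<eta> * \<eta> \<le> \<eta>" using \<eta> by (simp add: mult_left_le)
  have "norm (err k (rank1 x w0)) \<le> \<eta> * (\<eta> + 1) + 1 * \<eta>"
    unfolding Z2
    by (rule order_trans[OF norm_err_compose[OF r(2,3)]], intro add_mono mult_mono)
       (use n small \<eta> norm_a_le[of k "rank1 x0 w0"] in \<open>auto simp: norm_rank1\<close>)
  hence e2: "norm (err k (rank1 x w0)) \<le> 3 * \<eta>" using \<eta>\<eta> by (simp add: algebra_simps)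
  have "norm (err k Z) \<le> (3 * \<eta>) * (\<eta> + 1) + 1 * \<eta>"
    unfolding Z3
    by (rule order_trans[OF norm_err_compose[OF B2 r(4)]], intro add_mono mult_mono)
       (use n small e2 \<eta> norm_a_le[of k "rank1 w0 w"] in \<open>auto simp: norm_rank1\<close>)
  hence eZ: "norm (err k Z) \<le> 7 * \<eta>" using \<eta>\<eta> by (simp add: algebra_simps)
  define S1 S2 where "S1 = rank1 x e" and "S2 = rank1 y w"
  have S: "S1 \<in> B" "S2 \<in> B" using r by (auto simp: S1_def S2_def)
  have prod: "S1 o\<^sub>L R o\<^sub>L S2 = blinfun_scaleC (cinner (R y) e) Z" if "R \<in> bounded_operators" for R
    by (rule blinfun_eqI)
       (simp add: S1_def S2_def Z_def bounded_operators_scaleC[OF that] cinner_scaleC_left scaleC_scaleC mult.commute)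
  have "a k (S1 o\<^sub>L T o\<^sub>L S2) = a k S1 o\<^sub>L a k T o\<^sub>L a k S2"
    using S T by (simp add: a_compose B_compose)
  hence aT: "blinfun_scaleC c (a k Z) = a k S1 o\<^sub>L a k T o\<^sub>L a k S2"
    using prod[OF B_bounded[OF T]] by (simp add: c_def a_scaleC ZB)
  \<comment> \<open>The product rule for the three factors \<open>S1\<close>, \<open>T\<close>,
    \<open>S2\<close>, solved for the error of the middle one.\<close>
  have eq: "blinfun_scaleC (cinner (err k T y) e) Z
      = blinfun_scaleC c (err k Z) - (err k S1 o\<^sub>L a k T o\<^sub>L a k S2) - (S1 o\<^sub>L a k T o\<^sub>L err k S2)"
    (is "_ = ?R")
  proof -
    have "blinfun_scaleC (cinner (err k T y) e) Z = (S1 o\<^sub>L a k T o\<^sub>L S2) - blinfun_scaleC c Z"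
      unfolding prod[OF a_bounded[OF T]]
      by (rule blinfun_eqI) (simp add: err_def c_def blinfun.diff_left cinner_diff_left scaleC_diff_left)
    also have "\<dots> = ?R"
    proof (rule blinfun_eqI)
      fix v
      have "c *\<^sub>C a k Z v = a k S1 (a k T (a k S2 v))"
        using arg_cong[OF aT, of "\<lambda>F. F v"] by simp
      thus "((S1 o\<^sub>L a k T o\<^sub>L S2) - blinfun_scaleC c Z) v = ?R v"
        by (simp add: err_def blinfun.diff_left blinfun.diff_right scaleC_diff_right)
    qed
    finally show ?thesis .
  qed
  have c: "cmod c \<le> norm T * norm y * norm e" unfolding c_def by (rule cmod_cinner_blinfun)
  have aS2: "norm (a k S2) \<le> 2 * norm y"
    using norm_a_le[of k S2] small(5) \<eta> mult_right_mono[OF \<eta>(2) norm_ge_zero[of y]] n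
    by (simp add: S2_def norm_rank1)
  have t1: "norm (blinfun_scaleC c (err k Z)) \<le> (norm T * norm y * norm e) * (7 * \<eta>)"
    unfolding norm_blinfun_scaleC using c eZ by (intro mult_mono) auto
  have t2: "norm (err k S1 o\<^sub>L a k T o\<^sub>L a k S2) \<le> ((\<eta> * norm e) * norm (a k T)) * (2 * norm y)"
    using aS2 small(1) \<eta>
    by (intro order_trans[OF norm_blinfun_compose] mult_mono order_refl)
       (auto simp: S1_def intro!: order_trans[OF norm_blinfun_compose] mult_mono)
  have t3: "norm (S1 o\<^sub>L a k T o\<^sub>L err k S2) \<le> (norm e * norm (a k T)) * (\<eta> * norm y)"
    using small(5) \<eta> n
    by (intro order_trans[OF norm_blinfun_compose] mult_mono order_refl)
       (auto simp: S1_def S2_def norm_rank1 intro!: order_trans[OF norm_blinfun_compose] mult_mono)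
  have "cmod (cinner (err k T y) e) = norm (blinfun_scaleC (cinner (err k T y) e) Z)"
    by (simp add: norm_blinfun_scaleC Z_def norm_rank1 n)
  also have "\<dots> \<le> (norm T * norm y * norm e) * (7 * \<eta>) + ((\<eta> * norm e) * norm (a k T)) * (2 * norm y)
      + (norm e * norm (a k T)) * (\<eta> * norm y)"
    unfolding eq using norm_triangle_ineq4[of "blinfun_scaleC c (err k Z) - (err k S1 o\<^sub>L a k T o\<^sub>L a k S2)"
        "S1 o\<^sub>L a k T o\<^sub>L err k S2"] norm_triangle_ineq4[of "blinfun_scaleC c (err k Z)"
        "err k S1 o\<^sub>L a k T o\<^sub>L a k S2"] t1 t2 t3 by linarith
  also have "\<dots> = \<eta> * (7 * norm T + 3 * norm (a k T)) * norm y * norm e" by (simp add: algebra_simps)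
  also have "\<dots> \<le> \<eta> * (7 * (norm (a k T) + norm T)) * norm y * norm e"
    using \<eta> by (intro mult_right_mono mult_left_mono) auto
  finally show ?thesis by (simp add: algebra_simps)
qed

text \<open>Adjoints reverse products twice here, so conjugating \<open>a k\<close> by
  \<open>adj\<close> leaves it multiplicative.\<close>

lemma approx_hom_adj: "approx_hom (adj ` B) (\<lambda>k S. adj (a k (adj S)))"
proof
  have adj: "adj T \<in> B" if "T \<in> adj ` B" for T using that by (auto simp: adj_adj B_bounded)
  fix S T k c
  assume T: "T \<in> adj ` B"
  then obtain T' where T': "T' \<in> B" "T = adj T'" by blast
  show "T \<in> bounded_operators" using T' by (simp add: B_bounded)
  note bd = this
  show "blinfun_scaleC c T \<in> adj ` B"
    by (rule image_eqI[of _ _ "blinfun_scaleC (cnj c) T'"])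
       (simp_all add: T' B_scaleC adj_scaleC B_bounded)
  show "adj (a k (adj T)) \<in> bounded_operators" using adj[OF T] by (simp add: a_bounded)
  show "adj (a k (adj (blinfun_scaleC c T))) = blinfun_scaleC c (adj (a k (adj T)))"
    using adj[OF T] bd by (simp add: adj_scaleC a_scaleC a_bounded)
  have "(\<lambda>k. norm (a k T' - T')) \<longlonglongrightarrow> 0"
    by (rule tendsto_norm_zero[OF LIM_zero[OF a_lim[OF T'(1)]]])
  moreover have "norm (adj (a k (adj T)) - T) = norm (a k T' - T')" for k
    using T' by (simp add: adj_adj B_bounded adj_diff[symmetric] a_bounded norm_adj)
  ultimately have "(\<lambda>k. norm (adj (a k (adj T)) - T)) \<longlonglongrightarrow> 0" by simp
  thus "(\<lambda>k. adj (a k (adj T))) \<longlonglongrightarrow> T"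
    by (rule LIM_zero_cancel[OF tendsto_norm_zero_cancel])
  assume S: "S \<in> adj ` B"
  then obtain S' where S': "S' \<in> B" "S = adj S'" by blast
  have bdS: "S \<in> bounded_operators" using S' by (simp add: B_bounded)
  show "S + T \<in> adj ` B"
    by (rule image_eqI[of _ _ "S' + T'"]) (simp_all add: S' T' B_add adj_add B_bounded)
  show "S o\<^sub>L T \<in> adj ` B"
    by (rule image_eqI[of _ _ "T' o\<^sub>L S'"]) (simp_all add: S' T' B_compose adj_compose B_bounded)
  show "adj (a k (adj (S + T))) = adj (a k (adj S)) + adj (a k (adj T))"
    using adj[OF T] adj[OF S] bd bdS by (simp add: adj_add a_add a_bounded)
  show "adj (a k (adj (S o\<^sub>L T))) = adj (a k (adj S)) o\<^sub>L adj (a k (adj T))"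
    using adj[OF T] adj[OF S] bd bdS by (simp add: adj_compose a_compose a_bounded)
qed

lemma norm_err_adj:
  assumes "T \<in> B"
  shows "norm (approx_hom.err (\<lambda>k S. adj (a k (adj S))) k (adj T)) = norm (err k T)"
  using assms unfolding approx_hom.err_def[OF approx_hom_adj] err_def
  by (simp add: adj_adj B_bounded adj_diff[symmetric] a_bounded norm_adj)

end

section \<open>Rank-one operators available inside a member of a nest\<close>

lemma not_infd_zero: "\<not> infd {0::'a::chilbert_space}"
  by (rule not_infd_cspan[of "{}"]) auto

text \<open>Vectors \<open>f\<close> that share a left partner \<open>y\<close> with
  \<open>x\<close>: the sandwich identity needs \<open>rank1 y f\<close> and
  \<open>rank1 y x\<close> in the algebra for one and the same \<open>y\<close>.\<close>

definition test_set :: "'a::chilbert_space set set \<Rightarrow> 'a set \<Rightarrow> 'a \<Rightarrow> 'a set"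
  where "test_set N M x = {f \<in> M. \<exists>y\<in>M. norm y = 1 \<and>
    rank1 y f \<in> nest_algebra N \<and> rank1 y x \<in> nest_algebra N}"

text \<open>If the nonzero members have a common unit vector \<open>z\<close>, it serves as
  \<open>x0\<close> and as every \<open>x i\<close>. Otherwise \<open>e\<close> runs along an
  infinite descending chain starting at \<open>M\<close>, and \<open>x i = e (Suc i)\<close> lies
  one step further down than \<open>e i\<close>.\<close>

lemma nest_test_vectors:
  assumes N: "nest N" and M: "M \<in> N" "infd M"
  shows "\<exists>x0 x e. norm x0 = 1 \<and> x0 \<in> M \<and> orthonormal e \<and>
    (\<forall>i::nat. norm (x i) = 1 \<and> x i \<in> M \<and> e i \<in> M \<and>
      rank1 (x i) (e i) \<in> nest_algebra N \<and> rank1 (x i) x0 \<in> nest_algebra N) \<and>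
    M \<subseteq> closure (test_set N M x0)"
proof -
  have M0: "M \<noteq> {0}"
  proof
    assume "M = {0}"
    thus False using M(2) not_infd_zero[where 'a = 'a] by simp
  qed
  note cl = nest_closed_csubspace[OF N]
  show ?thesis
  proof (cases "\<Inter>{L\<in>N. L \<noteq> {0}} = {0}")
    case False
    then obtain z where z: "norm z = 1" "\<And>L. L \<in> N \<Longrightarrow> L = {0} \<or> z \<in> L"
      using nest_bottom_vector[OF N False] by blast
    have r: "rank1 z u \<in> nest_algebra N" for u
      by (rule rank1_in_nest_algebra[OF N]) (metis z(2) ocomp_zero UNIV_I)
    have "z \<in> M" using z M M0 by blast
    moreover obtain e where "orthonormal e" "range e \<subseteq> M" using M by (auto simp: infd_def)
    moreover have "M \<subseteq> closure (test_set N M z)"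
      by (rule order_trans[OF _ closure_subset]) (use \<open>z \<in> M\<close> z r in \<open>auto simp: test_set_def\<close>)
    ultimately show ?thesis using z(1) r
      by (intro exI[of _ z] exI[of _ "\<lambda>_. z"] exI[of _ e]) (simp add: image_subset_iff)
  next
    case True
    from nest_descending[OF N this M(1) M0] obtain L
      where L': "L 0 = M" "\<forall>n. L n \<in> N \<and> L n \<noteq> {0} \<and> L (Suc n) \<subset> L n"
      by (elim exE conjE)
    hence L: "L 0 = M" "\<And>n. L n \<in> N" "\<And>n. L n \<noteq> {0}" "\<And>n. L (Suc n) \<subset> L n"
      by simp_all
    from descending_orthonormal[of L, OF cl[OF L(2)] L(4)] obtain e where
      e': "orthonormal e" "\<forall>n. e n \<in> L n \<and> e n \<in> ocomp (L (Suc n))" by (elim exE conjE)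
    hence e: "orthonormal e" "\<And>n. e n \<in> L n" "\<And>n. e n \<in> ocomp (L (Suc n))" by simp_all
    have "antimono L" by (rule decseq_SucI) (rule psubset_imp_subset[OF L(4)])
    have anti: "L n \<subseteq> L m" if "m \<le> n" for m n using antimonoD[OF \<open>antimono L\<close> that] .
    have LM: "L n \<subseteq> M" for n using anti[of 0 n] L by simp
    have r1: "rank1 (e (Suc n)) (e n) \<in> nest_algebra N" for n
      by (rule rank1_in_nest_algebra_at[OF N L(2) e(2,3)])
    have "e (Suc n) \<in> L (Suc 0)" for n using e(2) anti[of "Suc 0" "Suc n"] by blast
    hence r2: "rank1 (e (Suc n)) (e 0) \<in> nest_algebra N" for n
      by (rule rank1_in_nest_algebra_at[OF N L(2) _ e(3)])
    \<comment> \<open>The complements of nonzero members increase to a subspace, which is dense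
      because these members meet in zero.\<close>
    define U where "U = \<Union>(ocomp ` {K\<in>N. K \<noteq> {0}})"
    have "csubspace U"
    proof (rule csubspaceI)
      have "0 \<in> ocomp M" by (simp add: ocomp_def)
      thus "0 \<in> U" using M M0 by (auto simp: U_def)
      fix c x y assume x: "x \<in> U"
      then obtain K where K: "K \<in> N" "K \<noteq> {0}" "x \<in> ocomp K" by (auto simp: U_def)
      thus "c *\<^sub>C x \<in> U"
        using closed_csubspace_ocomp[of K] by (auto simp: U_def closed_csubspace_def intro: csubspace_scaleC)
      assume "y \<in> U"
      then obtain K' where K': "K' \<in> N" "K' \<noteq> {0}" "y \<in> ocomp K'" by (auto simp: U_def)
      have "x + y \<in> ocomp K \<or> x + y \<in> ocomp K'"
      proof (cases "K \<subseteq> K'")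
        case True
        hence "y \<in> ocomp K" using subsetD[OF ocomp_antimono K'(3)] by blast
        thus ?thesis using K(3) closed_csubspace_ocomp[of K]
          by (simp add: closed_csubspace_def csubspace_add)
      next
        case False
        hence "K' \<subseteq> K" using nest_chain[OF N K(1) K'(1)] by blast
        hence "x \<in> ocomp K'" by (rule subsetD[OF ocomp_antimono K(3)])
        thus ?thesis using K'(3) closed_csubspace_ocomp[of K']
          by (simp add: closed_csubspace_def csubspace_add)
      qed
      thus "x + y \<in> U" using K K' by (auto simp: U_def)
    qed
    moreover have "ocomp U \<subseteq> {0}"
    proof
      fix x assume x: "x \<in> ocomp U"
      have "x \<in> K" if "K \<in> N" "K \<noteq> {0}" for K
      proof -
        have "ocomp K \<subseteq> U" using that by (auto simp: U_def)
        hence "x \<in> ocomp (ocomp K)" by (rule subsetD[OF ocomp_antimono x])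
        thus ?thesis using ocomp_ocomp[OF cl[OF that(1)]] by simp
      qed
      thus "x \<in> {0}" using True by blast
    qed
    ultimately have dense: "closure U = UNIV" by (rule ocomp_trivial_dense)
    have "M \<subseteq> closure (test_set N M (e 0))"
    proof
      fix f assume f: "f \<in> M"
      show "f \<in> closure (test_set N M (e 0))"
        unfolding closure_approachable
      proof (intro allI impI)
        fix \<epsilon> :: real assume "\<epsilon> > 0"
        moreover have "f \<in> closure U" by (simp add: dense)
        ultimately obtain g where g: "g \<in> U" "dist g f < \<epsilon>" unfolding closure_approachable by blast
        then obtain K where K: "K \<in> N" "K \<noteq> {0}" "g \<in> ocomp K" by (auto simp: U_def)
        \<comment> \<open>Projections of the nest map \<open>K\<close> into itself, so by
          self-adjointness \<open>proj M\<close> also preserves the complement of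
          \<open>K\<close>.\<close>
        have orth: "proj M g \<in> ocomp K"
          using K proj_commute_nest[OF N M(1) K(1)]
          by (auto simp: ocomp_def proj_self_adjoint[OF cl[OF M(1)]])
        have "norm (proj M (g - f)) \<le> norm (g - f)" by (rule norm_proj_le[OF cl[OF M(1)]])
        hence near: "dist (proj M g) f < \<epsilon>"
          using g proj_id[OF cl[OF M(1)] f] by (simp add: blinfun.diff_right dist_norm)
        \<comment> \<open>A nonzero member below both \<open>K\<close> and \<open>L 1\<close>
          supplies one \<open>y\<close> that suits both \<open>proj M g\<close> and
          \<open>e 0\<close>.\<close>
        obtain J where J: "J \<in> N" "J \<noteq> {0}" "J \<subseteq> K" "J \<subseteq> L (Suc 0)"
          using nest_chain[OF N K(1) L(2)[of "Suc 0"]] K L by blast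
        then obtain y where y: "y \<in> J" "norm y = 1"
          using exists_unit[of J] cl by (auto simp: closed_csubspace_def)
        have "rank1 y (proj M g) \<in> nest_algebra N"
          by (rule rank1_in_nest_algebra_at[OF N K(1) _ orth]) (use y J in blast)
        moreover have "rank1 y (e 0) \<in> nest_algebra N"
          by (rule rank1_in_nest_algebra_at[OF N L(2) _ e(3)]) (use y J in blast)
        moreover have "y \<in> M" using y J LM by blast
        ultimately show "\<exists>h\<in>test_set N M (e 0). dist h f < \<epsilon>"
          using near y proj_in[OF cl[OF M(1)]] unfolding test_set_def by blast
      qed
    qed
    moreover have "e n \<in> M" for n using e(2) LM by blast
    ultimately show ?thesis using e(1) r1 r2 orthonormalD(1)[OF e(1)]
      by (intro exI[of _ "e 0"] exI[of _ "\<lambda>i. e (Suc i)"] exI[of _ e] conjI allI) simp_all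
  qed
qed

lemma nest_algebra_ocomp_subset:
  assumes N: "nest N" and sub: "nest_algebra N \<subseteq> B"
  shows "nest_algebra (ocomp ` N) \<subseteq> adj ` B"
proof
  fix T assume T: "T \<in> nest_algebra (ocomp ` N)"
  have "adj T \<in> nest_algebra N"
    using adj_nest_algebra[OF nest_ocomp[OF N] T] N by (simp add: ocomp_ocomp_nest)
  thus "T \<in> adj ` B" using sub adj_adj[OF nest_algebra_bounded[OF T]]
    by (intro image_eqI[of _ _ "adj T"]) auto
qed

section \<open>Uniform convergence on the whole algebra\<close>

context approx_hom
begin

text \<open>Here a single \<open>x\<close> works for all \<open>u\<close>. The finite-dimensional
  \<open>F i\<close> enters through a finite basis \<open>G i\<close>, to which the bad vector
  \<open>u i\<close> is kept orthogonal, so that \<open>rank1 (e i) (u i)\<close> is in the nest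
  algebra.\<close>

lemma uniform_left:
  assumes N: "nest N" and sub: "nest_algebra N \<subseteq> B" and lc: "left_condition N" and \<eta>: "\<eta> > 0"
  shows "\<forall>\<^sub>F k in sequentially. \<forall>T\<in>B. norm (err k T) \<le> \<eta> * norm T"
proof -
  obtain x where x: "norm x = 1" "\<And>M. M \<in> N \<Longrightarrow> M = {0} \<or> x \<in> M"
    using lc by (auto simp: left_condition_def)
  have r: "rank1 x u \<in> B" for u
    by (rule subsetD[OF sub rank1_in_nest_algebra[OF N]]) (metis x(2) ocomp_zero UNIV_I)
  \<comment> \<open>The factor 4 lost in \<open>err_le_of_rank1\<close>, and the bound 1/2 asked for
    there.\<close>
  define \<delta> where "\<delta> = min (1/2) (\<eta>/4)"
  have \<delta>: "\<delta> > 0" "\<delta> \<le> 1/2" "4 * \<delta> \<le> \<eta>" using \<eta> by (auto simp: \<delta>_def)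
  have "\<forall>\<^sub>F k in sequentially. \<forall>u. norm (err k (rank1 x u)) \<le> \<delta> * norm u"
  proof (cases "infd (UNIV :: 'a set)")
    case False
    from not_infd_basis[OF complex_vector.subspace_UNIV this] obtain S
      where S': "finite S" "\<forall>u\<in>UNIV. (u::'a) = sproj S u" by (elim exE conjE)
    hence S: "finite S" "\<And>u. sproj S u = u" by simp_all
    have "S \<noteq> {}" using x S(2)[of x] by (auto simp: sproj_def)
    from eventually_err_finite_span[OF S(1) r this \<delta>(1)] show ?thesis by (simp add: S(2))
  next
    case True
    hence "\<exists>e F. orthonormal e \<and> (\<forall>i. F i \<in> N \<and> \<not> infd (F i) \<and> (\<forall>M\<in>N. e i \<in> M \<or> M \<subseteq> F i))"
      using lc by (simp add: left_condition_def)
    then obtain e F where e: "orthonormal e"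
      and F': "\<forall>i. F i \<in> N \<and> \<not> infd (F i) \<and> (\<forall>M\<in>N. e i \<in> M \<or> M \<subseteq> F i)"
      by (elim exE conjE)
    have F: "F i \<in> N" "\<not> infd (F i)" "M \<in> N \<Longrightarrow> e i \<in> M \<or> M \<subseteq> F i" for i M
      using F' by blast+
    have "\<exists>G. finite G \<and> (\<forall>x\<in>F i. x = sproj G x)" for i
    proof -
      have "csubspace (F i)" using nest_closed_csubspace[OF N F(1)] by (simp add: closed_csubspace_def)
      from not_infd_basis[OF this F(2)] show ?thesis by (elim exE conjE) (intro exI conjI)
    qed
    hence "\<exists>G. \<forall>i. finite (G i) \<and> (\<forall>x\<in>F i. x = sproj (G i) x)" by (rule choice[OF allI])
    then obtain G where G': "\<forall>i. finite (G i) \<and> (\<forall>x\<in>F i. x = sproj (G i) x)" by (rule exE)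
    have G: "finite (G i)" "x \<in> F i \<Longrightarrow> sproj (G i) x = x" for i x using G' by auto
    have "\<forall>\<^sub>F k in sequentially. \<exists>i::nat. \<forall>u\<in>UNIV. norm (err k (rank1 x u)) \<le> \<delta> * norm u"
    proof (rule eventually_err_rank1[where e = e and G = G])
      fix u :: "nat \<Rightarrow> 'a"
      assume u: "orthonormal u" "\<And>i g. g \<in> G i \<Longrightarrow> cinner (u i) g = 0"
      obtain T where T: "T \<in> bounded_operators" "\<And>v. (\<lambda>i. cinner v (u i) *\<^sub>C e i) sums T v"
        using orthonormal_diagonal_operator[OF e u(1)] by blast
      have orth: "u i \<in> ocomp (F i)" for i
      proof -
        have "cinner (u i) m = 0" if "m \<in> F i" for m
        proof -
          have "cinner (u i) (sproj (G i) m) = 0"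
            using u(2) by (simp add: sproj_def cinner_sum_right cinner_scaleC_right)
          thus ?thesis using G(2)[OF that] by simp
        qed
        thus ?thesis by (simp add: ocomp_def)
      qed
      have "rank1 (e i) (u i) \<in> nest_algebra N" for i
      proof (rule rank1_in_nest_algebra[OF N])
        fix M assume "M \<in> N"
        from F(3)[OF this, of i] show "e i \<in> M \<or> u i \<in> ocomp M"
          using subsetD[OF ocomp_antimono orth, of M i] by (elim disjE) simp_all
      qed
      hence "T \<in> nest_algebra N"
        by (intro nest_algebra_sums[OF N T(1), of "\<lambda>i. rank1 (e i) (u i)"]) (simp_all add: T)
      thus "\<exists>T\<in>B. \<forall>v. (\<lambda>i. cinner v (u i) *\<^sub>C e i) sums blinfun_apply T v" using T sub by blast
    qed (use x e r G \<delta> in \<open>auto simp: complex_vector.subspace_UNIV\<close>)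
    thus ?thesis by simp
  qed
  thus ?thesis
  proof (eventually_elim, intro ballI)
    fix k T assume "\<forall>u. norm (err k (rank1 x u)) \<le> \<delta> * norm u" "T \<in> B"
    hence "norm (err k T) \<le> 4 * \<delta> * norm T"
      using x r \<delta> by (intro err_le_of_rank1) auto
    also have "\<dots> \<le> \<eta> * norm T" using \<delta> by (intro mult_right_mono) auto
    finally show "norm (err k T) \<le> \<eta> * norm T" .
  qed
qed

text \<open>With \<open>e\<close> in \<open>M\<close> and \<open>u\<close> orthogonal to
  \<open>M\<close>, every \<open>rank1 (e i) (u i)\<close> is in the nest algebra, so
  \<open>G\<close> can be empty. The second clause comes from \<open>err_corner_rank1\<close>,
  whence the factor 8. Both clauses are stated for one \<open>k\<close> since they are used
  together.\<close>

lemma eventually_err_corner: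
  assumes N: "nest N" and sub: "nest_algebra N \<subseteq> B" and M: "M \<in> N"
    and x: "\<And>i::nat. norm (x i) = 1" "\<And>i. x i \<in> M" and e: "orthonormal e" "\<And>i. e i \<in> M"
    and r: "\<And>i. rank1 (x i) (e i) \<in> nest_algebra N" and \<eta>: "\<eta> > 0"
  shows "\<forall>\<^sub>F k in sequentially. (\<exists>i. \<forall>u\<in>ocomp M. norm (err k (rank1 (x i) u)) \<le> \<eta> * norm u) \<and>
    (\<forall>y\<in>ocomp M. \<forall>w\<in>ocomp M. rank1 y w \<in> B \<longrightarrow> norm (err k (rank1 y w)) \<le> \<eta> * (norm y * norm w))"
proof -
  define \<delta> where "\<delta> = min (1/4) (\<eta>/8)"
  have \<delta>: "\<delta> > 0" "\<delta> \<le> 1/4" "8 * \<delta> \<le> \<eta>" "\<delta> \<le> \<eta>" using \<eta> by (auto simp: \<delta>_def)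
  note cl = nest_closed_csubspace[OF N M]
  have rB: "rank1 (x i) u \<in> B" if "u \<in> ocomp M" for i u
    using rank1_in_nest_algebra_at[OF N M x(2) that] sub by blast
  have "proj (ocomp M) = id_blinfun - proj M"
    by (rule blinfun_eqI) (simp add: proj_ocomp cl blinfun.diff_left)
  also have "\<dots> = id_blinfun + blinfun_scaleC (-1) (proj M)"
    by (rule blinfun_eqI) (simp add: blinfun.diff_left blinfun.add_left)
  also have "\<dots> \<in> nest_algebra N"
    by (intro nest_algebra_closed_under[OF N] proj_in_nest_algebra[OF N M])
  finally have PB: "proj (ocomp M) \<in> B" using sub by blast
  have "\<forall>\<^sub>F k in sequentially. \<exists>i. \<forall>u\<in>ocomp M. norm (err k (rank1 (x i) u)) \<le> \<delta> * norm u"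
  proof (rule eventually_err_rank1[where e = e and G = "\<lambda>_. {}"])
    fix u :: "nat \<Rightarrow> 'a"
    assume u: "orthonormal u" "\<And>i. u i \<in> ocomp M"
    obtain T where T: "T \<in> bounded_operators" "\<And>v. (\<lambda>i. cinner v (u i) *\<^sub>C e i) sums T v"
      using orthonormal_diagonal_operator[OF e(1) u(1)] by blast
    have "T \<in> nest_algebra N"
      using rank1_in_nest_algebra_at[OF N M e(2) u(2)]
      by (intro nest_algebra_sums[OF N T(1), of "\<lambda>i. rank1 (e i) (u i)"]) (simp_all add: T)
    thus "\<exists>T\<in>B. \<forall>v. (\<lambda>i. cinner v (u i) *\<^sub>C e i) sums blinfun_apply T v" using T sub by blast
  qed (use x e r rB sub \<delta> closed_csubspace_ocomp[of M] in \<open>auto simp: closed_csubspace_def\<close>)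
  moreover have "\<forall>\<^sub>F k in sequentially. norm (err k (proj (ocomp M))) \<le> \<delta>"
    by (intro eventually_err_le PB \<delta>)
  ultimately show ?thesis
  proof eventually_elim
    fix k
    assume "\<exists>i. \<forall>u\<in>ocomp M. norm (err k (rank1 (x i) u)) \<le> \<delta> * norm u"
      and P: "norm (err k (proj (ocomp M))) \<le> \<delta>"
    then obtain i where i: "\<And>u. u \<in> ocomp M \<Longrightarrow> norm (err k (rank1 (x i) u)) \<le> \<delta> * norm u" by blast
    have "norm (err k (rank1 (x i) u)) \<le> \<eta> * norm u" if "u \<in> ocomp M" for u
      using i[OF that] mult_right_mono[OF \<delta>(4) norm_ge_zero[of u]] by linarith
    moreover have "norm (err k (rank1 y w)) \<le> \<eta> * (norm y * norm w)"
      if "y \<in> ocomp M" "w \<in> ocomp M" "rank1 y w \<in> B" for y w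
    proof -
      have "norm (err k (rank1 y w)) \<le> 8 * \<delta> * (norm y * norm w)"
        using that \<delta> P by (intro err_corner_rank1[OF closed_csubspace_ocomp PB x(1) rB i]) auto
      also have "\<dots> \<le> \<eta> * (norm y * norm w)" using \<delta> by (intro mult_right_mono) auto
      finally show ?thesis .
    qed
    ultimately show "(\<exists>i. \<forall>u\<in>ocomp M. norm (err k (rank1 (x i) u)) \<le> \<eta> * norm u) \<and>
      (\<forall>y\<in>ocomp M. \<forall>w\<in>ocomp M. rank1 y w \<in> B \<longrightarrow> norm (err k (rank1 y w)) \<le> \<eta> * (norm y * norm w))"
      by blast
  qed
qed

text \<open>Matrix entries of \<open>err k T\<close> are estimated by
  \<open>cinner_err_sandwich\<close> on the four blocks given by \<open>M\<close> and its
  complement. The operator \<open>rank1 x0 w0\<close>, with \<open>x0\<close> in \<open>M\<close>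
  and \<open>w0\<close> orthogonal to \<open>M\<close>, links vectors chosen in \<open>M\<close> for
  the left factor with vectors chosen in the complement for the right one. The latter come from the
  same lemmas applied to the adjoint algebra.\<close>

lemma uniform_split:
  assumes N: "nest N" and sub: "nest_algebra N \<subseteq> B" and M: "M \<in> N" "infd M" "infd (ocomp M)"
    and \<eta>: "\<eta> > 0"
  shows "\<forall>\<^sub>F k in sequentially. \<forall>T\<in>B. norm (err k T) \<le> \<eta> * norm T"
proof -
  interpret dual: approx_hom "adj ` B" "\<lambda>k S. adj (a k (adj S))" by (rule approx_hom_adj)
  define N' where "N' = ocomp ` N"
  have N': "nest N'" unfolding N'_def by (rule nest_ocomp[OF N])
  have M': "ocomp M \<in> N'" using M by (simp add: N'_def)
  note cl = nest_closed_csubspace[OF N M(1)]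
  have flip: "rank1 v u \<in> nest_algebra N" if "rank1 u v \<in> nest_algebra N'" for u v
    using adj_nest_algebra[OF N' that] N by (simp add: N'_def ocomp_ocomp_nest adj_rank1)
  have sub': "nest_algebra N' \<subseteq> adj ` B" unfolding N'_def by (rule nest_algebra_ocomp_subset[OF N sub])
  from nest_test_vectors[OF N M(1,2)] obtain x0 x e where
    x: "norm x0 = 1" "x0 \<in> M" "orthonormal e" "\<And>i::nat. norm (x i) = 1" "\<And>i. x i \<in> M" "\<And>i. e i \<in> M"
      "\<And>i. rank1 (x i) (e i) \<in> nest_algebra N" "\<And>i. rank1 (x i) x0 \<in> nest_algebra N"
    and dx: "M \<subseteq> closure (test_set N M x0)"
    by blast
  from nest_test_vectors[OF N' M' M(3)] obtain w0 w f where
    w: "norm w0 = 1" "w0 \<in> ocomp M" "orthonormal f" "\<And>i::nat. norm (w i) = 1" "\<And>i. w i \<in> ocomp M"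
      "\<And>i. f i \<in> ocomp M" "\<And>i. rank1 (w i) (f i) \<in> nest_algebra N'" "\<And>i. rank1 (w i) w0 \<in> nest_algebra N'"
    and dw: "ocomp M \<subseteq> closure (test_set N' (ocomp M) w0)"
    by blast
  have r0: "rank1 x0 w0 \<in> B"
    using rank1_in_nest_algebra_at[OF N M(1) x(2) w(2)] sub by blast
  \<comment> \<open>The sandwich costs a factor 7, the four blocks a factor 4, and the absorption
    another 4: altogether 112. Absorption asks that \<open>28 * \<delta>\<close> be at most
    1/2.\<close>
  define \<delta> where "\<delta> = min (1/56) (\<eta>/112)"
  have \<delta>: "\<delta> > 0" "28 * \<delta> \<le> 1/2" "112 * \<delta> \<le> \<eta>" "\<delta> \<le> 1" using \<eta> by (auto simp: \<delta>_def)
  have err_rank1: "norm (dual.err k (rank1 u v)) = norm (err k (rank1 v u))" if "rank1 v u \<in> B" for k u v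
    using norm_err_adj[OF that, of k] by (simp add: adj_rank1)
  note ev1 = eventually_err_corner[OF N sub M(1) x(4,5,3,6,7) \<delta>(1)]
  note ev2 = dual.eventually_err_corner[OF N' sub' M' w(4,5,3,6,7) \<delta>(1), unfolded ocomp_ocomp[OF cl]]
  from ev1 ev2 eventually_err_le[OF r0 \<delta>(1)] show ?thesis
  proof (eventually_elim, intro ballI)
    fix k T assume T: "T \<in> B"
    assume "(\<exists>i. \<forall>u\<in>ocomp M. norm (err k (rank1 (x i) u)) \<le> \<delta> * norm u) \<and>
        (\<forall>y\<in>ocomp M. \<forall>w\<in>ocomp M. rank1 y w \<in> B \<longrightarrow> norm (err k (rank1 y w)) \<le> \<delta> * (norm y * norm w))"
      and "(\<exists>i. \<forall>u\<in>M. norm (dual.err k (rank1 (w i) u)) \<le> \<delta> * norm u) \<and>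
        (\<forall>y\<in>M. \<forall>w\<in>M. rank1 y w \<in> adj ` B \<longrightarrow> norm (dual.err k (rank1 y w)) \<le> \<delta> * (norm y * norm w))"
      and s0: "norm (err k (rank1 x0 w0)) \<le> \<delta>"
    then obtain i j where
      i: "\<And>u. u \<in> ocomp M \<Longrightarrow> norm (err k (rank1 (x i) u)) \<le> \<delta> * norm u" and
      c1: "\<And>y w. y \<in> ocomp M \<Longrightarrow> w \<in> ocomp M \<Longrightarrow> rank1 y w \<in> B \<Longrightarrow>
        norm (err k (rank1 y w)) \<le> \<delta> * (norm y * norm w)" and
      j: "\<And>u. u \<in> M \<Longrightarrow> norm (dual.err k (rank1 (w j) u)) \<le> \<delta> * norm u" and
      c2: "\<And>y w. y \<in> M \<Longrightarrow> w \<in> M \<Longrightarrow> rank1 y w \<in> adj ` B \<Longrightarrow>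
        norm (dual.err k (rank1 y w)) \<le> \<delta> * (norm y * norm w)" by blast
    have c2': "norm (err k (rank1 w y)) \<le> \<delta> * (norm y * norm w)"
      if "y \<in> M" "w \<in> M" "rank1 w y \<in> B" for y w
    proof -
      have "rank1 y w \<in> adj ` B" by (rule image_eqI[OF _ that(3)]) (simp add: adj_rank1)
      thus ?thesis using c2[OF that(1,2)] err_rank1[OF that(3)] by simp
    qed
    \<comment> \<open>\<open>L\<close> and \<open>R\<close> collect the vectors that can stand on
      the right and on the left of an entry. For \<open>L\<close>, the complement of
      \<open>M\<close> is covered by \<open>x i\<close> and a dense part of \<open>M\<close> by test
      vectors; for \<open>R\<close> the roles of \<open>M\<close> and its complement are
      exchanged.\<close>
    define L where "L = {f. \<exists>y. norm y = 1 \<and> rank1 y f \<in> B \<and> rank1 y x0 \<in> B \<and>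
      norm (err k (rank1 y f)) \<le> \<delta> * norm f \<and> norm (err k (rank1 y x0)) \<le> \<delta>}"
    define R where "R = {g. \<exists>y. norm y = 1 \<and> rank1 g y \<in> B \<and> rank1 w0 y \<in> B \<and>
      norm (err k (rank1 g y)) \<le> \<delta> * norm g \<and> norm (err k (rank1 w0 y)) \<le> \<delta>}"
    have "test_set N M x0 \<subseteq> L"
    proof
      fix f assume "f \<in> test_set N M x0"
      then obtain y where y: "f \<in> M" "y \<in> M" "norm y = 1" "rank1 y f \<in> B" "rank1 y x0 \<in> B"
        using sub unfolding test_set_def by blast
      show "f \<in> L" unfolding L_def using y c2'[OF y(1,2,4)] c2'[OF x(2) y(2,5)] x(1) by auto
    qed
    hence denL: "M \<subseteq> closure L" by (rule order_trans[OF dx closure_mono])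
    have "ocomp M \<subseteq> L"
    proof
      fix u assume u: "u \<in> ocomp M"
      have "rank1 (x i) u \<in> B" "rank1 (x i) x0 \<in> B"
        using rank1_in_nest_algebra_at[OF N M(1) x(5) u] x(8) sub by blast+
      thus "u \<in> L" unfolding L_def using i[OF u] c2'[OF x(2,5)] x(1,4) by auto
    qed
    hence denL': "ocomp M \<subseteq> closure L" by (rule order_trans[OF _ closure_subset])
    have "test_set N' (ocomp M) w0 \<subseteq> R"
    proof
      fix f assume "f \<in> test_set N' (ocomp M) w0"
      then obtain y where y: "f \<in> ocomp M" "y \<in> ocomp M" "norm y = 1" "rank1 f y \<in> B" "rank1 w0 y \<in> B"
        using flip sub unfolding test_set_def by blast
      show "f \<in> R" unfolding R_def using y c1[OF y(1,2,4)] c1[OF w(2) y(2,5)] w(1) by auto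
    qed
    hence denR': "ocomp M \<subseteq> closure R" by (rule order_trans[OF dw closure_mono])
    have "M \<subseteq> R"
    proof
      fix u assume u: "u \<in> M"
      have B: "rank1 u (w j) \<in> B" "rank1 w0 (w j) \<in> B"
        using rank1_in_nest_algebra_at[OF N M(1) u w(5)] flip[OF w(8)] sub by blast+
      show "u \<in> R" unfolding R_def using B j[OF u] err_rank1[OF B(1)] c1[OF w(2,5) B(2)] w(1,4) by auto
    qed
    hence denR: "M \<subseteq> closure R" by (rule order_trans[OF _ closure_subset])
    define K where "K = 7 * \<delta> * (norm (a k T) + norm T)"
    have K0: "K \<ge> 0" using \<delta> by (simp add: K_def)
    have base: "cmod (cinner (err k T y) u) \<le> K * norm y * norm u" if "y \<in> R" "u \<in> L" for y u
      using that cinner_err_sandwich[OF x(1) w(1) _ _ _ _ r0 _ _ _ _ s0 _ _ T] \<delta> by (auto simp: L_def R_def K_def)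
    \<comment> \<open>Both sides are continuous in each vector, so the estimate passes to the
      closures one variable at a time.\<close>
    have base2: "cmod (cinner (err k T y) u) \<le> K * norm y * norm u" if "y \<in> R" "u \<in> closure L" for y u
    proof -
      have "closed {u. cmod (cinner (err k T y) u) \<le> K * norm y * norm u}"
        by (intro closed_Collect_le continuous_intros)
      hence "closure L \<subseteq> {u. cmod (cinner (err k T y) u) \<le> K * norm y * norm u}"
        by (rule closure_minimal[rotated]) (use base that in auto)
      thus ?thesis using that by blast
    qed
    have base3: "cmod (cinner (err k T y) u) \<le> K * norm y * norm u" if "y \<in> closure R" "u \<in> closure L" for y u
    proof -
      have "closed {y. cmod (cinner (err k T y) u) \<le> K * norm y * norm u}"
        by (intro closed_Collect_le continuous_intros)
      hence "closure R \<subseteq> {y. cmod (cinner (err k T y) u) \<le> K * norm y * norm u}"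
        by (rule closure_minimal[rotated]) (use base2 that in auto)
      thus ?thesis using that by blast
    qed
    have "norm (err k T) \<le> 4 * K"
    proof (rule norm_le_sesquilinear)
      fix v u
      have split: "\<exists>z1 z2. z = z1 + z2 \<and> z1 \<in> M \<and> z2 \<in> ocomp M \<and> norm z1 \<le> norm z \<and> norm z2 \<le> norm z" for z
        using norm_proj_le[OF closed_csubspace_ocomp, of M z]
        by (intro exI[of _ "proj M z"] exI[of _ "z - proj M z"])
           (simp add: cl proj_in minus_proj_in_ocomp norm_proj_le proj_ocomp)
      obtain v1 v2 where v: "v = v1 + v2" "v1 \<in> closure R" "v2 \<in> closure R" "norm v1 \<le> norm v" "norm v2 \<le> norm v"
        using split[of v] denR denR' by blast
      obtain u1 u2 where u: "u = u1 + u2" "u1 \<in> closure L" "u2 \<in> closure L" "norm u1 \<le> norm u" "norm u2 \<le> norm u"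
        using split[of u] denL denL' by blast
      have b: "cmod (cinner (err k T y) z) \<le> K * norm v * norm u"
        if "y \<in> closure R" "z \<in> closure L" "norm y \<le> norm v" "norm z \<le> norm u" for y z
        using K0 that by (intro order_trans[OF base3[OF that(1,2)]] mult_mono mult_nonneg_nonneg) auto
      have "cinner (err k T v) u = (cinner (err k T v1) u1 + cinner (err k T v1) u2) +
          (cinner (err k T v2) u1 + cinner (err k T v2) u2)"
        by (simp add: v(1) u(1) blinfun.add_right cinner_add_left cinner_add_right)
      also have "cmod \<dots> \<le> (K * norm v * norm u + K * norm v * norm u) + (K * norm v * norm u + K * norm v * norm u)"
        by (intro norm_triangle_mono b u v)
      finally show "cmod (cinner (err k T v) u) \<le> 4 * K * norm v * norm u"
        by (simp add: mult_ac)
    qed (use K0 in simp)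
    hence "norm (err k T) \<le> (28 * \<delta>) * (norm (a k T) + norm T)" by (simp add: K_def)
    hence "norm (err k T) \<le> 4 * (28 * \<delta>) * norm T" using \<delta> by (intro absorb_err) auto
    also have "\<dots> \<le> \<eta> * norm T" using \<delta> by (intro mult_right_mono) auto
    finally show "norm (err k T) \<le> \<eta> * norm T" .
  qed
qed

theorem uniform:
  assumes N: "nest N" and sub: "nest_algebra N \<subseteq> B" and \<eta>: "\<eta> > 0"
  shows "\<forall>\<^sub>F k in sequentially. \<forall>T\<in>B. norm (err k T) \<le> \<eta> * norm T"
proof (cases "(UNIV :: 'a set) = {0}")
  \<comment> \<open>\<open>left_condition\<close> asks for a unit vector, so the trivial space is
    treated apart.\<close>
  case True
  have z: "z = 0" for z :: 'a using UNIV_I[of z] unfolding True by simp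
  have "T = 0" for T :: "'a \<Rightarrow>\<^sub>L 'a"
    by (rule blinfun_eqI, rule trans[OF z z[symmetric]])
  hence "norm (err k T) = 0" for k T by (simp only: norm_eq_zero)
  thus ?thesis using \<eta> by simp
next
  case False
  consider "\<exists>M\<in>N. infd M \<and> infd (ocomp M)" | "left_condition N" | "left_condition (ocomp ` N)"
    using left_condition_cases[OF N False] by metis
  thus ?thesis
  proof cases
    case 1
    then obtain M where "M \<in> N" "infd M" "infd (ocomp M)" by (elim bexE conjE)
    thus ?thesis by (rule uniform_split[OF N sub _ _ _ \<eta>])
  next
    case 2 thus ?thesis by (rule uniform_left[OF N sub _ \<eta>])
  next
    case 3
    interpret dual: approx_hom "adj ` B" "\<lambda>k S. adj (a k (adj S))" by (rule approx_hom_adj)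
    from dual.uniform_left[OF nest_ocomp[OF N] nest_algebra_ocomp_subset[OF N sub] 3 \<eta>] show ?thesis
      by eventually_elim (auto simp: norm_err_adj norm_adj B_bounded)
  qed
qed

end

section \<open>Compact operators\<close>

lemma compact_operators_bounded: "T \<in> compact_operators \<Longrightarrow> T \<in> bounded_operators"
  by (simp add: compact_operators_def)

text \<open>By completeness, compact closure of the image of the ball is total boundedness. Finite
  nets are easily transported through sums, products and norm limits.\<close>

lemma compact_operators_iff:
  fixes T :: "'a::chilbert_space \<Rightarrow>\<^sub>L 'a"
  assumes "T \<in> bounded_operators"
  shows "T \<in> compact_operators \<longleftrightarrow>
    (\<forall>e>0. \<exists>F. finite F \<and> (\<forall>x. norm x \<le> 1 \<longrightarrow> (\<exists>y\<in>F. dist y (T x) < e)))"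
proof
  assume "T \<in> compact_operators"
  hence "compact (closure (T ` cball 0 1))" by (simp add: compact_operators_def)
  hence *: "\<forall>e>0. \<exists>k. finite k \<and> closure (T ` cball 0 1) \<subseteq> (\<Union>x\<in>k. ball x e)"
    by (simp add: compact_eq_totally_bounded)
  show "\<forall>e>0. \<exists>F. finite F \<and> (\<forall>x. norm x \<le> 1 \<longrightarrow> (\<exists>y\<in>F. dist y (T x) < e))"
  proof (intro allI impI)
    fix e :: real assume "e > 0"
    with * obtain k where k: "finite k" "closure (T ` cball 0 1) \<subseteq> (\<Union>x\<in>k. ball x e)" by meson
    have "\<exists>y\<in>k. dist y (T x) < e" if "norm x \<le> 1" for x
    proof -
      have "T x \<in> T ` cball 0 1" using that by simp
      hence "T x \<in> (\<Union>x\<in>k. ball x e)" using k(2) closure_subset[of "T ` cball 0 1"] by blast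
      thus ?thesis by simp
    qed
    thus "\<exists>F. finite F \<and> (\<forall>x. norm x \<le> 1 \<longrightarrow> (\<exists>y\<in>F. dist y (T x) < e))"
      using k(1) by (intro exI[of _ k]) simp
  qed
next
  assume tb: "\<forall>e>0. \<exists>F. finite F \<and> (\<forall>x. norm x \<le> 1 \<longrightarrow> (\<exists>y\<in>F. dist y (T x) < e))"
  have "\<exists>k. finite k \<and> closure (T ` cball 0 1) \<subseteq> (\<Union>x\<in>k. ball x e)" if "e > 0" for e
  proof -
    from tb[rule_format, of "e/2"] that obtain F where F: "finite F"
      "\<And>x. norm x \<le> 1 \<Longrightarrow> \<exists>y\<in>F. dist y (T x) < e/2" by auto
    have "T ` cball 0 1 \<subseteq> (\<Union>y\<in>F. cball y (e/2))"
    proof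
      fix z assume "z \<in> T ` cball 0 1"
      then obtain x where "norm x \<le> 1" "z = T x" by auto
      thus "z \<in> (\<Union>y\<in>F. cball y (e/2))" using F(2)[of x] by force
    qed
    hence "closure (T ` cball 0 1) \<subseteq> (\<Union>y\<in>F. cball y (e/2))"
      using F(1) by (intro closure_minimal closed_UN) auto
    also have "\<dots> \<subseteq> (\<Union>y\<in>F. ball y e)" using that by (intro UN_mono) auto
    finally show ?thesis using F(1) by (intro exI[of _ F]) simp
  qed
  thus "T \<in> compact_operators"
    using assms by (simp add: compact_operators_def compact_eq_totally_bounded complete_eq_closed)
qed

lemma compact_operatorsE:
  assumes "T \<in> compact_operators" "e > 0"
  obtains F where "finite F" "\<And>x. norm x \<le> 1 \<Longrightarrow> \<exists>y\<in>F. dist y (blinfun_apply T x) < e"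
proof -
  from assms compact_operators_iff[OF compact_operators_bounded[OF assms(1)]]
  have "\<exists>F. finite F \<and> (\<forall>x. norm x \<le> 1 \<longrightarrow> (\<exists>y\<in>F. dist y (T x) < e))" by simp
  thus thesis using that by (elim exE conjE) simp
qed

lemma compact_operators_add:
  assumes "S \<in> compact_operators" "T \<in> compact_operators"
  shows "S + T \<in> compact_operators"
proof (subst compact_operators_iff)
  note b = compact_operators_bounded[OF assms(1)] compact_operators_bounded[OF assms(2)]
  show "S + T \<in> bounded_operators" using b by simp
  show "\<forall>e>0. \<exists>F. finite F \<and> (\<forall>x. norm x \<le> 1 \<longrightarrow> (\<exists>y\<in>F. dist y ((S + T) x) < e))"
  proof (intro allI impI)
    fix e :: real assume "e > 0"
    hence e: "e/2 > 0" by simp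
    obtain F where F: "finite F" "\<And>x. norm x \<le> 1 \<Longrightarrow> \<exists>y\<in>F. dist y (S x) < e/2"
      by (rule compact_operatorsE[OF assms(1) e]) (rule that)
    obtain G where G: "finite G" "\<And>x. norm x \<le> 1 \<Longrightarrow> \<exists>y\<in>G. dist y (T x) < e/2"
      by (rule compact_operatorsE[OF assms(2) e]) (rule that)
    have "\<exists>y\<in>(\<lambda>(u,v). u + v) ` (F \<times> G). dist y ((S + T) x) < e" if x: "norm x \<le> 1" for x
    proof -
      obtain u v where uv: "u \<in> F" "dist u (S x) < e/2" "v \<in> G" "dist v (T x) < e/2"
        using F(2)[OF x] G(2)[OF x] by auto
      have "dist (u + v) ((S + T) x) \<le> dist u (S x) + dist v (T x)"
        by (simp add: blinfun.add_left dist_triangle_add)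
      hence "dist (u + v) ((S + T) x) < e" using uv by simp
      thus ?thesis using uv by (intro bexI[of _ "u + v"]) auto
    qed
    thus "\<exists>F. finite F \<and> (\<forall>x. norm x \<le> 1 \<longrightarrow> (\<exists>y\<in>F. dist y ((S + T) x) < e))"
      using F G by (intro exI[of _ "(\<lambda>(u,v). u + v) ` (F \<times> G)"]) simp
  qed
qed

lemma compact_operators_compose_left:
  assumes "A \<in> bounded_operators" "T \<in> compact_operators"
  shows "A o\<^sub>L T \<in> compact_operators"
proof (subst compact_operators_iff)
  note b = compact_operators_bounded[OF assms(2)]
  show "A o\<^sub>L T \<in> bounded_operators" using b assms by simp
  show "\<forall>e>0. \<exists>F. finite F \<and> (\<forall>x. norm x \<le> 1 \<longrightarrow> (\<exists>y\<in>F. dist y ((A o\<^sub>L T) x) < e))"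
  proof (intro allI impI)
    fix e :: real assume "e > 0"
    hence e: "e / (norm A + 1) > 0" by (simp add: add_nonneg_pos)
    obtain F where F: "finite F" "\<And>x. norm x \<le> 1 \<Longrightarrow> \<exists>y\<in>F. dist y (T x) < e / (norm A + 1)"
      by (rule compact_operatorsE[OF assms(2) e]) (rule that)
    have "\<exists>y\<in>A ` F. dist y ((A o\<^sub>L T) x) < e" if x: "norm x \<le> 1" for x
    proof -
      obtain u where u: "u \<in> F" "dist u (T x) < e / (norm A + 1)" using F(2)[OF x] by auto
      have "dist (A u) ((A o\<^sub>L T) x) = norm (A (u - T x))" by (simp add: dist_norm blinfun.diff_right)
      also have "\<dots> \<le> norm A * dist u (T x)" unfolding dist_norm by (rule norm_blinfun)
      also have "\<dots> \<le> (norm A + 1) * dist u (T x)" by (intro mult_right_mono) auto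
      also have "\<dots> < e" using u(2) by (simp add: less_divide_eq add_nonneg_pos mult.commute)
      finally show ?thesis using u by blast
    qed
    thus "\<exists>F. finite F \<and> (\<forall>x. norm x \<le> 1 \<longrightarrow> (\<exists>y\<in>F. dist y ((A o\<^sub>L T) x) < e))"
      using F by (intro exI[of _ "A ` F"]) simp
  qed
qed

lemma compact_operators_compose_right:
  assumes "T \<in> compact_operators" "A \<in> bounded_operators"
  shows "T o\<^sub>L A \<in> compact_operators"
proof (subst compact_operators_iff)
  note b = compact_operators_bounded[OF assms(1)]
  define K where "K = norm A + 1"
  have K: "K > 0" by (simp add: K_def add_nonneg_pos)
  show "T o\<^sub>L A \<in> bounded_operators" using b assms by simp
  show "\<forall>e>0. \<exists>F. finite F \<and> (\<forall>x. norm x \<le> 1 \<longrightarrow> (\<exists>y\<in>F. dist y ((T o\<^sub>L A) x) < e))"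
  proof (intro allI impI)
    fix e :: real assume "e > 0"
    hence e: "e / K > 0" using K by simp
    obtain F where F: "finite F" "\<And>x. norm x \<le> 1 \<Longrightarrow> \<exists>y\<in>F. dist y (T x) < e / K"
      by (rule compact_operatorsE[OF assms(1) e]) (rule that)
    have "\<exists>y\<in>(\<lambda>u. K *\<^sub>R u) ` F. dist y ((T o\<^sub>L A) x) < e" if x: "norm x \<le> 1" for x
    proof -
      have "norm (A x) \<le> norm A * 1" using x by (intro order_trans[OF norm_blinfun] mult_left_mono) auto
      hence "norm ((1/K) *\<^sub>R A x) \<le> 1" using K by (simp add: K_def divide_le_eq_1)
      then obtain u where u: "u \<in> F" "dist u (T ((1/K) *\<^sub>R A x)) < e / K" using F(2) by meson
      have "(T o\<^sub>L A) x = K *\<^sub>R T ((1/K) *\<^sub>R A x)" using K by (simp add: blinfun.scaleR_right)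
      hence "dist (K *\<^sub>R u) ((T o\<^sub>L A) x) = K * dist u (T ((1/K) *\<^sub>R A x))"
        using K by (simp only: dist_norm scaleR_diff_right[symmetric] norm_scaleR abs_of_pos)
      also have "\<dots> < e" using u(2) K by (simp add: less_divide_eq mult.commute)
      finally show ?thesis using u by blast
    qed
    thus "\<exists>F. finite F \<and> (\<forall>x. norm x \<le> 1 \<longrightarrow> (\<exists>y\<in>F. dist y ((T o\<^sub>L A) x) < e))"
      using F by (intro exI[of _ "(\<lambda>u. K *\<^sub>R u) ` F"]) simp
  qed
qed

lemma compact_operators_limit:
  fixes T :: "'a::chilbert_space \<Rightarrow>\<^sub>L 'a"
  assumes "T \<in> bounded_operators" "\<And>e. e > 0 \<Longrightarrow> \<exists>S\<in>compact_operators. norm (T - S) < e"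
  shows "T \<in> compact_operators"
proof (subst compact_operators_iff[OF assms(1)], intro allI impI)
  fix e :: real assume "e > 0"
  hence e: "e/2 > 0" by simp
  obtain S where S: "S \<in> compact_operators" "norm (T - S) < e/2" using assms(2)[OF e] by auto
  obtain F where F: "finite F" "\<And>x. norm x \<le> 1 \<Longrightarrow> \<exists>y\<in>F. dist y (S x) < e/2"
    by (rule compact_operatorsE[OF S(1) e]) (rule that)
  have "\<exists>y\<in>F. dist y (T x) < e" if x: "norm x \<le> 1" for x
  proof -
    obtain u where u: "u \<in> F" "dist u (S x) < e/2" using F(2)[OF x] by auto
    have "dist (S x) (T x) = norm ((T - S) x)" by (simp add: dist_norm blinfun.diff_left norm_minus_commute)
    also have "\<dots> \<le> norm (T - S) * norm x" by (rule norm_blinfun)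
    also have "\<dots> \<le> norm (T - S) * 1" using x by (intro mult_left_mono) auto
    finally have "dist u (T x) < e" using u(2) S(2) dist_triangle[of u "T x" "S x"] by simp
    thus ?thesis using u by blast
  qed
  thus "\<exists>F. finite F \<and> (\<forall>x. norm x \<le> 1 \<longrightarrow> (\<exists>y\<in>F. dist y (T x) < e))" using F(1) by (intro exI[of _ F]) simp
qed

lemma compact_operators_zero: "0 \<in> compact_operators"
  by (subst compact_operators_iff) (auto intro!: exI[of _ "{0}"])

lemma compact_operators_scaleC:
  assumes "T \<in> compact_operators"
  shows "blinfun_scaleC c T \<in> compact_operators"
proof -
  have "blinfun_scaleC c T = blinfun_scaleC c id_blinfun o\<^sub>L T" by (rule blinfun_eqI) simp
  thus ?thesis using compact_operators_compose_left[OF _ assms] by simp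
qed

lemma compact_operators_minus:
  assumes "S \<in> compact_operators" shows "- S \<in> compact_operators"
proof -
  have "- S = blinfun_scaleC (-1) S" by (rule blinfun_eqI) (simp add: blinfun.minus_left)
  thus ?thesis using compact_operators_scaleC[OF assms] by simp
qed

lemma compact_operators_diff:
  "S \<in> compact_operators \<Longrightarrow> T \<in> compact_operators \<Longrightarrow> S - T \<in> compact_operators"
  using compact_operators_add[OF _ compact_operators_minus, of S T] by simp

lemma compact_operators_scaleR:
  assumes "T \<in> compact_operators" shows "r *\<^sub>R T \<in> compact_operators"
proof -
  have "r *\<^sub>R T = blinfun_scaleC (of_real r) T"
    by (rule blinfun_eqI) (simp add: blinfun.scaleR_left scaleC_complex_of_real)
  thus ?thesis using compact_operators_scaleC[OF assms] by simp
qed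

lemma compact_operators_sum:
  "(\<And>i. i \<in> I \<Longrightarrow> f i \<in> compact_operators) \<Longrightarrow> sum f I \<in> compact_operators"
  by (induction I rule: infinite_finite_induct) (auto simp: compact_operators_zero compact_operators_add)

lemma rank1_compact: "rank1 x y \<in> compact_operators"
proof (subst compact_operators_iff)
  show "rank1 x y \<in> bounded_operators" by simp
  show "\<forall>e>0. \<exists>F. finite F \<and> (\<forall>v. norm v \<le> 1 \<longrightarrow> (\<exists>z\<in>F. dist z (rank1 x y v) < e))"
  proof (intro allI impI)
    fix e :: real assume e: "e > 0"
    define K where "K = norm x + 1"
    have K: "K > 0" by (simp add: K_def add_nonneg_pos)
    have "compact (cball (0::complex) (norm y))" by simp
    then obtain k where k: "finite k" "cball (0::complex) (norm y) \<subseteq> (\<Union>c\<in>k. ball c (e/K))"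
      using e K unfolding compact_eq_totally_bounded by (metis divide_pos_pos)
    have "\<exists>z\<in>(\<lambda>c. c *\<^sub>C x) ` k. dist z (rank1 x y v) < e" if v: "norm v \<le> 1" for v
    proof -
      have "cmod (cinner v y) \<le> 1 * norm y"
        using v by (intro order_trans[OF Cauchy_Schwarz] mult_right_mono) auto
      hence "cinner v y \<in> cball 0 (norm y)" by simp
      hence "cinner v y \<in> (\<Union>c\<in>k. ball c (e/K))" by (rule subsetD[OF k(2)])
      then obtain c where c: "c \<in> k" "cmod (c - cinner v y) < e/K" by (auto simp: dist_norm)
      have "dist (c *\<^sub>C x) (rank1 x y v) = cmod (c - cinner v y) * norm x"
        by (simp add: dist_norm scaleC_diff_left[symmetric] norm_scaleC)
      also have "\<dots> \<le> cmod (c - cinner v y) * K" by (intro mult_left_mono) (auto simp: K_def)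
      also have "\<dots> < e" using c(2) K by (simp add: less_divide_eq)
      finally show ?thesis using c by blast
    qed
    thus "\<exists>F. finite F \<and> (\<forall>v. norm v \<le> 1 \<longrightarrow> (\<exists>z\<in>F. dist z (rank1 x y v) < e))"
      using k(1) by (intro exI[of _ "(\<lambda>c. c *\<^sub>C x) ` k"]) simp
  qed
qed

lemma compact_operators_subsequence:
  assumes "T \<in> compact_operators" "\<And>n::nat. norm (x n) \<le> 1"
  shows "\<exists>r z. strict_mono r \<and> (\<lambda>n. T (x (r n))) \<longlonglongrightarrow> z"
proof -
  have "seq_compact (closure (T ` cball 0 1))"
    using assms(1) by (simp add: compact_operators_def compact_imp_seq_compact)
  moreover have "\<forall>n. T (x n) \<in> closure (T ` cball 0 1)"
    using assms(2) closure_subset[of "T ` cball 0 1"] by auto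
  ultimately obtain z r where "strict_mono r" "((\<lambda>n. T (x n)) \<circ> r) \<longlonglongrightarrow> z"
    by (rule seq_compactE)
  thus ?thesis by (intro exI[of _ r] exI[of _ z]) (simp add: comp_def)
qed

section \<open>Completing block matrices\<close>

lemma proj_proj_subset:
  assumes "closed_csubspace M" "closed_csubspace M'" "M \<subseteq> M'"
  shows "proj M (proj M' x) = proj M x" "proj M' (proj M x) = proj M x"
proof -
  show 2: "proj M' (proj M x) = proj M x" for x
    using assms proj_in[OF assms(1), of x] by (intro proj_id) auto
  show "proj M (proj M' x) = proj M x"
    by (rule cinner_eqI) (simp add: proj_self_adjoint[symmetric] assms 2)
qed

text \<open>For closed subspaces \<open>A \<subseteq> B\<close> this is the projection onto the part
  of \<open>B\<close> orthogonal to \<open>A\<close>, the projection of an interval of the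
  nest.\<close>

definition gap :: "'a::chilbert_space set \<Rightarrow> 'a set \<Rightarrow> 'a \<Rightarrow>\<^sub>L 'a"
  where "gap A B = proj B - proj A"

lemma gap_apply: "gap A B x = proj B x - proj A x"
  by (simp add: gap_def blinfun.diff_left)

lemma gap_self [simp]: "gap A A = 0"
  by (simp add: gap_def)

context
  fixes A B :: "'a::chilbert_space set"
  assumes A: "closed_csubspace A" and B: "closed_csubspace B" and AB: "A \<subseteq> B"
begin

lemma gap_bounded: "gap A B \<in> bounded_operators"
  by (simp add: gap_def proj_bounded A B)

lemma gap_in: "gap A B x \<in> B"
  using B proj_in[OF A, of x] proj_in[OF B, of x] AB
  by (auto simp: gap_apply closed_csubspace_def intro: csubspace_diff)

lemma gap_in_ocomp: "gap A B x \<in> ocomp A"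
  using minus_proj_in_ocomp[OF A, of "proj B x"] by (simp add: gap_apply proj_proj_subset A B AB)

lemma gap_lower: "x \<in> A \<Longrightarrow> gap A B x = 0"
  using AB by (simp add: gap_apply proj_id A B subset_iff)

lemma gap_upper: "x \<in> ocomp B \<Longrightarrow> gap A B x = 0"
  using subsetD[OF ocomp_antimono[OF AB], of x] proj_zero_iff[OF A, of x] proj_zero_iff[OF B, of x]
  by (auto simp: gap_apply)

lemma gap_gap: "gap A B (gap A B x) = gap A B x"
  by (simp add: gap_apply blinfun.diff_right proj_proj_subset A B AB proj_id proj_in)

lemma gap_self_adjoint: "cinner (gap A B x) y = cinner x (gap A B y)"
  by (simp add: gap_apply cinner_diff_left cinner_diff_right proj_self_adjoint A B)

lemma cinner_gap: "cinner (gap A B x) x = complex_of_real ((norm (gap A B x))\<^sup>2)"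
  by (metis gap_gap gap_self_adjoint cinner_self)

lemma norm_gap: "norm (gap A B x) \<le> norm x"
proof -
  have "norm (gap A B x) * norm (gap A B x) \<le> norm (gap A B x) * norm x"
    using Cauchy_Schwarz[of "gap A B x" x] by (simp add: cinner_gap norm_mult norm_power power2_eq_square)
  thus ?thesis by (cases "gap A B x = 0") auto
qed

lemma proj_plus_gap: "proj B x = proj A x + gap A B x"
  by (simp add: gap_apply)

lemma norm_proj_gap: "(norm (proj B x))\<^sup>2 = (norm (proj A x))\<^sup>2 + (norm (gap A B x))\<^sup>2"
  unfolding proj_plus_gap
  by (rule pythagoras) (rule ocomp_sym[OF gap_in_ocomp proj_in[OF A]])

end

text \<open>Bessel's inequality for mutually orthogonal projections: the partial sum
  \<open>p\<close> satisfies \<open>cinner p x = (norm p)\<^sup>2\<close>, and Cauchy-Schwarz bounds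
  it by \<open>norm x\<close>.\<close>

lemma sum_norm_gap_le:
  fixes G :: "nat \<Rightarrow> 'a::chilbert_space \<Rightarrow>\<^sub>L 'a"
  assumes "\<And>i j. i \<noteq> j \<Longrightarrow> cinner (G i x) (G j x) = 0"
    "\<And>i. cinner (G i x) x = complex_of_real ((norm (G i x))\<^sup>2)"
  shows "(\<Sum>i<n. (norm (G i x))\<^sup>2) \<le> (norm x)\<^sup>2"
proof -
  define p where "p = (\<Sum>i<n. G i x)"
  have n: "(norm p)\<^sup>2 = (\<Sum>i<n. (norm (G i x))\<^sup>2)"
    unfolding p_def by (rule norm_sum_orthogonal) (auto intro: assms)
  have "cinner p x = complex_of_real ((norm p)\<^sup>2)"
    unfolding n by (simp add: p_def cinner_sum_left assms)
  hence "norm p * norm p \<le> norm p * norm x"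
    using Cauchy_Schwarz[of p x] by (simp add: norm_mult norm_power power2_eq_square)
  hence "norm p \<le> norm x" by (cases "p = 0") auto
  thus ?thesis unfolding n[symmetric] by (simp add: power_mono)
qed

text \<open>The lower-left corner of \<open>X\<close> with respect to \<open>M\<close>, that is, the
  obstruction to invariance of \<open>M\<close>.\<close>

definition low :: "'a::chilbert_space set \<Rightarrow> ('a \<Rightarrow>\<^sub>L 'a) \<Rightarrow> ('a \<Rightarrow>\<^sub>L 'a)"
  where "low M X = (id_blinfun - proj M) o\<^sub>L X o\<^sub>L proj M"

lemma low_apply: "low M X v = X (proj M v) - proj M (X (proj M v))"
  by (simp add: low_def blinfun.diff_left)

lemma low_add: "low M (X + Y) = low M X + low M Y"
  by (rule blinfun_eqI) (simp add: low_apply blinfun.add_left blinfun.add_right)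

lemma low_diff: "low M (X - Y) = low M X - low M Y"
  by (rule blinfun_eqI) (simp add: low_apply blinfun.diff_left blinfun.diff_right)

lemma low_scaleR: "low M (r *\<^sub>R X) = r *\<^sub>R low M X"
  by (rule blinfun_eqI) (simp add: low_apply blinfun.scaleR_left blinfun.scaleR_right scaleR_diff_right)

lemma norm_low: assumes "closed_csubspace M" shows "norm (low M X) \<le> norm X"
proof (rule norm_blinfun_bound)
  fix v
  have "norm (low M X v) = norm (proj (ocomp M) (X (proj M v)))"
    by (simp add: low_apply proj_ocomp assms)
  also have "\<dots> \<le> norm (X (proj M v))" by (rule norm_proj_le[OF closed_csubspace_ocomp])
  also have "\<dots> \<le> norm X * norm (proj M v)" by (rule norm_blinfun)
  also have "\<dots> \<le> norm X * norm v" by (intro mult_left_mono norm_proj_le assms) simp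
  finally show "norm (low M X v) \<le> norm X * norm v" .
qed simp

lemma low_compact: "closed_csubspace M \<Longrightarrow> T \<in> compact_operators \<Longrightarrow> low M T \<in> compact_operators"
  unfolding low_def
  by (intro compact_operators_compose_right compact_operators_compose_left) (simp_all add: proj_bounded)

lemma low_zero_iff:
  assumes "closed_csubspace M"
  shows "low M X = 0 \<longleftrightarrow> (\<forall>x\<in>M. X x \<in> M)"
proof
  assume l: "low M X = 0"
  show "\<forall>x\<in>M. X x \<in> M"
  proof
    fix x assume "x \<in> M"
    hence "X x = proj M (X x)" using arg_cong[OF l, of "\<lambda>F. F x"] by (simp add: low_apply proj_id assms)
    thus "X x \<in> M" using proj_in[OF assms] by metis
  qed
next
  assume "\<forall>x\<in>M. X x \<in> M"
  thus "low M X = 0"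
    by (intro blinfun_eqI) (simp add: low_apply proj_id proj_in assms)
qed

text \<open>Parrott's completion of a \<open>2 \<times> 2\<close> block matrix. With first column \<open>Y\<close> and last row
  \<open>A, B\<close>, the missing corner is \<open>- proj M' Y W\<close> where \<open>W = (1 - A\<^sup>*A)\<inverse> A\<^sup>*B\<close>. As opposed to the usual
  choice it involves no square roots, and it is compact if \<open>Y\<close> is.\<close>

lemma Parrott_completion:
  fixes X Y :: "'a::chilbert_space \<Rightarrow>\<^sub>L 'a"
  assumes M: "closed_csubspace M" "closed_csubspace M'" "M \<subseteq> M'"
    and X: "X \<in> bounded_operators" and low: "low M' X \<in> compact_operators" "norm (low M' X) \<le> c" "c < 1"
    and Y: "Y \<in> compact_operators" "norm Y \<le> 1" "Y o\<^sub>L proj M = Y" "\<And>x. x \<in> M \<Longrightarrow> X x - Y x \<in> M"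
  shows "\<exists>Y'\<in>compact_operators. norm Y' \<le> 1 \<and> Y' o\<^sub>L proj M' = Y' \<and> (\<forall>x\<in>M. blinfun_apply Y' x = Y x) \<and>
    (\<forall>x\<in>M'. X x - blinfun_apply Y' x \<in> M')"
proof -
  define P P' E where "P = proj M" and "P' = proj M'" and "E = gap M M'"
  define Z where "Z = low M' X"
  define A where "A = Z o\<^sub>L P"
  define Bm where "Bm = Z o\<^sub>L E"
  have Zb: "Z \<in> bounded_operators" using low compact_operators_bounded by (simp add: Z_def)
  have bd: "P \<in> bounded_operators" "P' \<in> bounded_operators" "E \<in> bounded_operators"
    "A \<in> bounded_operators" "Bm \<in> bounded_operators" "Y \<in> bounded_operators"
    using M Zb Y compact_operators_bounded gap_bounded[OF M]
    by (simp_all add: P_def P'_def E_def A_def Bm_def proj_bounded)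
  have c0: "0 \<le> c" using low(2) norm_ge_zero[of "low M' X"] by linarith
  have nA: "norm A \<le> c"
  proof -
    have "norm A \<le> norm Z * norm P" unfolding A_def by (rule norm_blinfun_compose)
    also have "\<dots> \<le> c * 1" using low(2) norm_proj[OF M(1)] c0
      by (intro mult_mono) (auto simp: Z_def P_def)
    finally show ?thesis by simp
  qed
  \<comment> \<open>The inverse in the formula for \<open>W\<close> is obtained as the fixed point
    of \<open>f\<close>, a contraction with factor \<open>c * c\<close>.\<close>
  define f where "f W = adj A o\<^sub>L (Bm + (A o\<^sub>L W))" for W
  have "\<exists>!W\<in>bounded_operators. f W = W"
  proof (rule Banach_fix)
    show "complete (bounded_operators :: ('a \<Rightarrow>\<^sub>L 'a) set)"
      by (simp add: complete_eq_closed closed_bounded_operators)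
    show "bounded_operators \<noteq> ({} :: ('a \<Rightarrow>\<^sub>L 'a) set)" using Zb by auto
    show "0 \<le> c * c" by simp
    show "c * c < 1" using mult_strict_mono[of c 1 c 1] low(3) c0 by simp
    show "f ` bounded_operators \<subseteq> bounded_operators" using bd by (auto simp: f_def)
    show "dist (f W) (f W') \<le> c * c * dist W W'" for W W'
    proof -
      have "f W - f W' = adj A o\<^sub>L (A o\<^sub>L (W - W'))"
        by (rule blinfun_eqI) (simp add: f_def blinfun.diff_left blinfun.add_left blinfun.diff_right blinfun.add_right)
      also have "norm \<dots> \<le> norm (adj A) * (norm A * norm (W - W'))"
        by (intro order_trans[OF norm_blinfun_compose] mult_left_mono norm_blinfun_compose) simp
      also have "\<dots> \<le> c * (c * norm (W - W'))"
        using nA c0 by (intro mult_mono) (auto simp: norm_adj bd)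
      finally show ?thesis by (simp add: dist_norm mult.assoc)
    qed
  qed
  then obtain W where W: "W \<in> bounded_operators" "f W = W" by auto
  define Y' where "Y' = Y + Bm - (P' o\<^sub>L (Y o\<^sub>L (W o\<^sub>L E)))"
  have Y'v: "Y' v = Y v + Bm v - P' (Y (W (E v)))" for v
    by (simp add: Y'_def blinfun.diff_left blinfun.add_left)
  have Yc: "Y' \<in> compact_operators"
    unfolding Y'_def Bm_def
    using low(1) Y(1) bd W
    by (intro compact_operators_diff compact_operators_add compact_operators_compose_left
        compact_operators_compose_right) (simp_all add: Z_def)
  have YP: "Y (P v) = Y v" for v using arg_cong[OF Y(3), of "\<lambda>F. F v"] by (simp add: P_def)
  have ZP': "Z (P' v) = Z v" for v by (simp add: Z_def P'_def low_apply proj_id proj_in M)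
  have P'Z: "P' (Z v) = 0" for v
    by (simp add: Z_def P'_def low_apply blinfun.diff_right proj_id proj_in M)
  have E: "E v = P' v - P v" for v by (simp add: E_def P_def P'_def gap_apply)
  have A_Bm: "A v + Bm v = Z v" for v by (simp add: A_def Bm_def E blinfun.diff_right ZP')
  \<comment> \<open>The component of \<open>Y\<close> off \<open>M'\<close> is forced: it is that of
    \<open>X\<close> on \<open>M\<close>, namely \<open>A\<close>.\<close>
  have QY: "Y v - P' (Y v) = A v" for v
  proof -
    have PM: "P v \<in> M" by (simp add: P_def proj_in M)
    have "X (P v) - Y (P v) \<in> M'" using Y(4)[OF PM] M by blast
    hence "P' (X (P v) - Y (P v)) = X (P v) - Y (P v)" by (simp add: P'_def proj_id M)
    hence "Y (P v) - P' (Y (P v)) = X (P v) - P' (X (P v))" by (simp add: blinfun.diff_right algebra_simps)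
    moreover have "P' (P v) = P v" using PM M by (auto simp: P'_def intro: proj_id)
    ultimately show ?thesis by (simp add: A_def Z_def low_apply YP P'_def)
  qed
  have "norm Y' \<le> 1"
  proof (rule norm_blinfun_bound)
    fix v
    define x y where "x = P v" and "y = E v"
    \<comment> \<open>Completing the square. In terms of \<open>h\<close> the value
      \<open>Y' v\<close> splits into the orthogonal parts \<open>A h + q\<close> and
      \<open>P' (Y h)\<close>, and the equation for \<open>W\<close> turns the cross term
      \<open>cinner (A h) q\<close> into \<open>cinner h (W y)\<close>. The sum is then at most the
      squared norm of \<open>h + W y\<close>, which is \<open>x\<close>, plus that of
      \<open>y\<close>.\<close>
    define h where "h = x - W y"
    have EE: "E y = y" by (simp add: y_def E_def gap_gap M)
    have Wy: "adj A (Bm y + A (W y)) = W y"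
      using arg_cong[OF W(2), of "\<lambda>F. F y"] by (simp add: f_def blinfun.add_left)
    have Ax: "A v = A x" by (simp add: A_def x_def P_def proj_id proj_in M)
    have By: "Bm v = Bm y" by (simp add: Bm_def y_def E_def gap_gap M)
    define q where "q = A (W y) + Bm y"
    have hx: "x = h + W y" by (simp add: h_def)
    have Y'split: "Y' v = (A h + q) + P' (Y h)"
    proof -
      have "Y v = A v + P' (Y x)" using QY[of v] YP[of v] by (simp add: x_def algebra_simps)
      hence "Y' v = A x + P' (Y x) + Bm y - P' (Y (W y))" by (simp add: Y'v Ax By y_def)
      thus ?thesis unfolding q_def hx by (simp add: blinfun.add_right algebra_simps)
    qed
    have PAq: "P' (A h + q) = 0" by (simp add: q_def A_def Bm_def blinfun.add_right P'Z)
    have "cinner (A h + q) (P' (Y h)) = cinner (P' (A h + q)) (Y h)"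
      by (simp add: P'_def proj_self_adjoint M)
    hence n1: "(norm (Y' v))\<^sup>2 = (norm (A h + q))\<^sup>2 + (norm (P' (Y h)))\<^sup>2"
      unfolding Y'split by (intro pythagoras) (simp add: PAq)
    have "cinner (A h) (P' (Y h)) = cinner (P' (A h)) (Y h)"
      by (simp add: P'_def proj_self_adjoint M)
    hence "(norm (A h + P' (Y h)))\<^sup>2 = (norm (A h))\<^sup>2 + (norm (P' (Y h)))\<^sup>2"
      by (intro pythagoras) (simp add: A_def P'Z)
    moreover have "A h + P' (Y h) = Y h" using QY[of h] by (simp add: algebra_simps)
    moreover have "norm (Y h) \<le> norm h"
      using norm_blinfun[of Y h] mult_right_mono[OF Y(2) norm_ge_zero[of h]] by simp
    ultimately have n2: "(norm (A h))\<^sup>2 + (norm (P' (Y h)))\<^sup>2 \<le> (norm h)\<^sup>2"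
      by (metis power_mono norm_ge_zero)
    have cross: "cinner (A h) q = cinner h (W y)"
      using Wy by (simp add: cinner_adj bd q_def add.commute)
    have Pyo: "cinner u y = 0" if "u \<in> M" for u
      unfolding y_def E_def by (rule ocomp_sym[OF gap_in_ocomp[OF M] that])
    have n3: "(norm q)\<^sup>2 \<le> (norm (W y))\<^sup>2 + (norm y)\<^sup>2"
    proof -
      \<comment> \<open>\<open>P (W y)\<close> lies in \<open>M\<close> and \<open>y\<close> is
        orthogonal to \<open>M\<close>, so the argument of the contraction \<open>Z\<close> obeys
        Pythagoras.\<close>
      have "q = Z (P (W y) + y)" by (simp add: q_def A_def Bm_def EE blinfun.add_right)
      hence "norm q \<le> norm Z * norm (P (W y) + y)" using norm_blinfun by metis
      also have "\<dots> \<le> 1 * norm (P (W y) + y)" using low by (intro mult_right_mono) (auto simp: Z_def)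
      finally have "(norm q)\<^sup>2 \<le> (norm (P (W y) + y))\<^sup>2" by (simp add: power_mono)
      also have "\<dots> = (norm (P (W y)))\<^sup>2 + (norm y)\<^sup>2"
        by (intro pythagoras Pyo) (simp add: P_def proj_in M)
      also have "(norm (P (W y)))\<^sup>2 \<le> (norm (W y))\<^sup>2"
        by (intro power_mono) (simp_all add: P_def norm_proj_le M)
      finally show ?thesis by simp
    qed
    have n4: "(norm x)\<^sup>2 + (norm y)\<^sup>2 \<le> (norm v)\<^sup>2"
      using norm_proj_gap[OF M, of v] power_mono[OF norm_proj_le[OF M(2), of v] norm_ge_zero, of 2]
      by (simp add: x_def y_def P_def E_def)
    have "(norm (Y' v))\<^sup>2 \<le> (norm h)\<^sup>2 + (norm (W y))\<^sup>2 + (norm y)\<^sup>2 + 2 * Re (cinner h (W y))"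
      unfolding n1 norm_add_square[of "A h" q] cross using n2 n3 by simp
    also have "\<dots> = (norm x)\<^sup>2 + (norm y)\<^sup>2" unfolding hx norm_add_square by simp
    finally have "(norm (Y' v))\<^sup>2 \<le> (norm v)\<^sup>2" using n4 by (rule order_trans)
    hence "norm (Y' v) \<le> norm v" by (rule power2_le_imp_le) simp
    thus "norm (Y' v) \<le> 1 * norm v" by simp
  qed simp
  moreover have "Y' o\<^sub>L proj M' = Y'"
  proof (rule blinfun_eqI)
    fix v
    have "P (P' v) = P v" "P' (P' v) = P' v"
      by (simp_all add: P_def P'_def proj_proj_subset M proj_id proj_in)
    hence "E (P' v) = E v" "Y (P' v) = Y v" using YP[of "P' v"] YP[of v] by (simp_all add: E)
    thus "(Y' o\<^sub>L proj M') v = Y' v" by (simp add: Y'v Bm_def P'_def)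
  qed
  moreover have "Y' x = Y x" if "x \<in> M" for x
    using that by (simp add: Y'v Bm_def E_def gap_lower M)
  moreover have "X x - Y' x \<in> M'" if x: "x \<in> M'" for x
  proof -
    have "P' (Y' x) + Z x = Y' x"
    proof -
      have "Y' x - P' (Y' x) = (Y x - P' (Y x)) + Bm x"
        by (simp add: Y'v blinfun.add_right blinfun.diff_right Bm_def P'Z)
           (simp add: P'_def proj_id proj_in M)
      thus ?thesis using A_Bm[of x] by (simp add: QY algebra_simps)
    qed
    moreover have "X x = P' (X x) + Z x" using x by (simp add: Z_def low_apply P'_def proj_id M)
    ultimately have "X x - Y' x = (P' (X x) + Z x) - (P' (Y' x) + Z x)" by metis
    also have "\<dots> = P' (X x) - P' (Y' x)" by simp
    also have "\<dots> = P' (X x - Y' x)" by (simp add: blinfun.diff_right)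
    finally show ?thesis using proj_in[OF M(2)] unfolding P'_def by metis
  qed
  ultimately show ?thesis using Yc by blast
qed

text \<open>Parrott's completion climbs the chain one member at a time. A step prescribes
  \<open>Y\<close> on the next member without altering it on the previous one, so invariance already
  achieved persists and the norm never exceeds 1.\<close>

lemma compact_completion_chain:
  fixes L :: "nat \<Rightarrow> 'a::chilbert_space set"
  assumes L: "\<And>i. i \<le> n \<Longrightarrow> closed_csubspace (L i)" "\<And>i. i < n \<Longrightarrow> L i \<subseteq> L (Suc i)" "L 0 = {0}"
    and X: "X \<in> bounded_operators" "\<And>i. i \<le> n \<Longrightarrow> low (L i) X \<in> compact_operators"
      "\<And>i. i \<le> n \<Longrightarrow> norm (low (L i) X) \<le> c" "c < 1"
  shows "\<exists>Y\<in>compact_operators. norm Y \<le> 1 \<and> (\<forall>i\<le>n. \<forall>x\<in>L i. X x - blinfun_apply Y x \<in> L i)"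
proof -
  have "m \<le> n \<Longrightarrow> \<exists>Y\<in>compact_operators. norm Y \<le> 1 \<and> Y o\<^sub>L proj (L m) = Y \<and>
    (\<forall>i\<le>m. \<forall>x\<in>L i. X x - blinfun_apply Y x \<in> L i)" for m
  proof (induction m)
    case 0
    show ?case by (intro bexI[of _ 0]) (auto simp: L compact_operators_zero intro: blinfun_eqI)
  next
    case (Suc m)
    then obtain Y where Y: "Y \<in> compact_operators" "norm Y \<le> 1" "Y o\<^sub>L proj (L m) = Y"
      "\<And>i x. i \<le> m \<Longrightarrow> x \<in> L i \<Longrightarrow> X x - Y x \<in> L i" by auto
    have sub: "L m \<subseteq> L (Suc m)" using L(2) Suc.prems by simp
    have "\<exists>Y'\<in>compact_operators. norm Y' \<le> 1 \<and> Y' o\<^sub>L proj (L (Suc m)) = Y' \<and>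
        (\<forall>x\<in>L m. blinfun_apply Y' x = Y x) \<and> (\<forall>x\<in>L (Suc m). X x - blinfun_apply Y' x \<in> L (Suc m))"
      using Suc.prems by (intro Parrott_completion[OF L(1) L(1) sub X(1) X(2) X(3) X(4) Y(1-3) Y(4)]) auto
    then obtain Y' where Y': "Y' \<in> compact_operators" "norm Y' \<le> 1" "Y' o\<^sub>L proj (L (Suc m)) = Y'"
      "\<And>x. x \<in> L m \<Longrightarrow> Y' x = Y x" "\<And>x. x \<in> L (Suc m) \<Longrightarrow> X x - Y' x \<in> L (Suc m)" by auto
    have mono: "i \<le> k \<Longrightarrow> k \<le> m \<Longrightarrow> L i \<subseteq> L k" for i k
    proof (induction k rule: dec_induct)
      case (step k)
      thus ?case using L(2)[of k] Suc.prems by auto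
    qed simp
    show ?case
    proof (intro bexI[OF _ Y'(1)] conjI Y'(2,3) allI impI ballI)
      fix i x assume i: "i \<le> Suc m" "x \<in> L i"
      show "X x - Y' x \<in> L i"
      proof (cases "i = Suc m")
        case False
        hence "i \<le> m" using i by simp
        hence "x \<in> L m" using mono[of i m] i(2) by auto
        thus ?thesis using Y(4)[OF \<open>i \<le> m\<close> i(2)] Y'(4) by simp
      qed (use i Y'(5) in simp)
    qed
  qed
  from this[of n] show ?thesis by auto
qed

section \<open>Quasi-triangular algebras\<close>

lemma zero_in_nest_algebra: "nest N \<Longrightarrow> 0 \<in> nest_algebra N"
  using nest_closed_csubspace[of N]
  by (intro nest_algebraI) (auto simp: closed_csubspace_def csubspace_zero)

lemma nest_algebra_subset_quasitriangular: "nest_algebra N \<subseteq> quasitriangular_algebra N"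
proof
  fix T assume "T \<in> nest_algebra N"
  thus "T \<in> quasitriangular_algebra N"
    unfolding quasitriangular_algebra_def
    using compact_operators_zero by (intro CollectI exI[of _ T] exI[of _ 0]) simp
qed

lemma compact_subset_quasitriangular:
  fixes N :: "'a::chilbert_space set set"
  assumes "nest N" shows "compact_operators \<subseteq> quasitriangular_algebra N"
proof
  fix T :: "'a \<Rightarrow>\<^sub>L 'a" assume "T \<in> compact_operators"
  thus "T \<in> quasitriangular_algebra N"
    unfolding quasitriangular_algebra_def
    using zero_in_nest_algebra[OF assms] by (intro CollectI exI[of _ 0] exI[of _ T]) simp
qed

lemma quasitriangular_closed_under:
  assumes "nest N"
  shows "S \<in> quasitriangular_algebra N \<Longrightarrow> S \<in> bounded_operators"
    and "S \<in> quasitriangular_algebra N \<Longrightarrow> T \<in> quasitriangular_algebra N \<Longrightarrow> S + T \<in> quasitriangular_algebra N"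
    and "S \<in> quasitriangular_algebra N \<Longrightarrow> blinfun_scaleC c S \<in> quasitriangular_algebra N"
    and "S \<in> quasitriangular_algebra N \<Longrightarrow> T \<in> quasitriangular_algebra N \<Longrightarrow> S o\<^sub>L T \<in> quasitriangular_algebra N"
proof -
  assume "S \<in> quasitriangular_algebra N"
  then obtain S1 S2 where S: "S = S1 + S2" "S1 \<in> nest_algebra N" "S2 \<in> compact_operators"
    by (auto simp: quasitriangular_algebra_def)
  note b = nest_algebra_bounded[OF S(2)] compact_operators_bounded[OF S(3)]
  show "S \<in> bounded_operators" using S b by simp
  have "blinfun_scaleC c S = blinfun_scaleC c S1 + blinfun_scaleC c S2"
    by (rule blinfun_eqI) (simp add: S blinfun.add_left scaleC_add_right)
  thus "blinfun_scaleC c S \<in> quasitriangular_algebra N"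
    unfolding quasitriangular_algebra_def
    using nest_algebra_closed_under(2)[OF assms S(2)] compact_operators_scaleC[OF S(3)] by blast
  assume "T \<in> quasitriangular_algebra N"
  then obtain T1 T2 where T: "T = T1 + T2" "T1 \<in> nest_algebra N" "T2 \<in> compact_operators"
    by (auto simp: quasitriangular_algebra_def)
  note b' = nest_algebra_bounded[OF T(2)] compact_operators_bounded[OF T(3)]
  have "S + T = (S1 + T1) + (S2 + T2)" by (simp add: S T)
  thus "S + T \<in> quasitriangular_algebra N"
    unfolding quasitriangular_algebra_def
    using nest_algebra_closed_under(1)[OF assms S(2) T(2)] compact_operators_add[OF S(3) T(3)] by blast
  have "(S o\<^sub>L T) = (S1 o\<^sub>L T1) + ((S1 o\<^sub>L T2) + ((S2 o\<^sub>L T1) + (S2 o\<^sub>L T2)))"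
    by (rule blinfun_eqI) (simp add: S T blinfun.add_left blinfun.add_right)
  moreover have "(S1 o\<^sub>L T2) + ((S2 o\<^sub>L T1) + (S2 o\<^sub>L T2)) \<in> compact_operators"
    using S T b b' by (intro compact_operators_add)
      (auto intro: compact_operators_compose_left compact_operators_compose_right)
  ultimately show "S o\<^sub>L T \<in> quasitriangular_algebra N"
    unfolding quasitriangular_algebra_def
    using nest_algebra_closed_under(3)[OF assms S(2) T(2)] by blast
qed

text \<open>Commutators are only asked to lie in the closure, because closedness of the
  quasi-triangular algebra is itself deduced from the theorem about this notion.\<close>

definition almost_derives :: "'a::chilbert_space set set \<Rightarrow> ('a \<Rightarrow>\<^sub>L 'a) \<Rightarrow> bool"
  where "almost_derives N X \<longleftrightarrow> X \<in> bounded_operators \<and>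
    (\<forall>T\<in>nest_algebra N. (X o\<^sub>L T) - (T o\<^sub>L X) \<in> closure (quasitriangular_algebra N))"

text \<open>The summand from the nest algebra has no corner, so corners of nearby members of the
  algebra are compact.\<close>

lemma low_quasitriangular_compact:
  assumes N: "nest N" and M: "M \<in> N" and S: "S \<in> closure (quasitriangular_algebra N)"
  shows "low M S \<in> compact_operators"
proof (rule compact_operators_limit)
  note cl = nest_closed_csubspace[OF N M]
  have "closure (quasitriangular_algebra N) \<subseteq> bounded_operators"
    by (intro closure_minimal closed_bounded_operators subsetI quasitriangular_closed_under(1)[OF N])
  hence "S \<in> bounded_operators" using S by blast
  thus "low M S \<in> bounded_operators" by (simp add: low_def proj_bounded cl)
  fix e :: real assume "e > 0"
  then obtain S' where S': "S' \<in> quasitriangular_algebra N" "dist S' S < e"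
    using S unfolding closure_approachable by blast
  then obtain T K where T: "S' = T + K" "T \<in> nest_algebra N" "K \<in> compact_operators"
    by (auto simp: quasitriangular_algebra_def)
  have "low M T = 0" using nest_algebra_invariant[OF T(2) M] by (simp add: low_zero_iff[OF cl])
  hence "low M S' = low M K" by (simp add: T low_add)
  moreover have "norm (low M S - low M S') < e"
    using norm_low[OF cl, of "S - S'"] S'(2) by (simp add: low_diff dist_norm norm_minus_commute)
  ultimately show "\<exists>C\<in>compact_operators. norm (low M S - C) < e"
    using low_compact[OF cl T(3)] by auto
qed

text \<open>\<open>X\<close> and its commutator with \<open>proj M\<close> have the same corner at
  \<open>M\<close>.\<close>

lemma almost_derives_low_compact:
  assumes N: "nest N" and X: "almost_derives N X" and M: "M \<in> N"
  shows "low M X \<in> compact_operators"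
proof -
  note cl = nest_closed_csubspace[OF N M]
  have "low M X = low M ((X o\<^sub>L proj M) - (proj M o\<^sub>L X))"
    by (rule blinfun_eqI)
       (simp add: low_apply blinfun.diff_left blinfun.diff_right proj_id proj_in cl)
  thus ?thesis using X proj_in_nest_algebra[OF N M]
    by (simp add: almost_derives_def low_quasitriangular_compact[OF N M])
qed

lemma almost_derives_add_compact:
  assumes N: "nest N" and X: "almost_derives N X" and C: "C \<in> compact_operators"
  shows "almost_derives N (X + C)"
  unfolding almost_derives_def
proof (intro conjI ballI)
  show "X + C \<in> bounded_operators" using X C by (simp add: almost_derives_def compact_operators_bounded)
  fix T assume T: "T \<in> nest_algebra N"
  let ?Q = "quasitriangular_algebra N"
  define D where "D = (C o\<^sub>L T) - (T o\<^sub>L C)"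
  have "D \<in> compact_operators" unfolding D_def
    using C nest_algebra_bounded[OF T]
    by (intro compact_operators_diff compact_operators_compose_left compact_operators_compose_right)
  hence D: "D \<in> ?Q" using compact_subset_quasitriangular[OF N] by blast
  have "(X o\<^sub>L T) - (T o\<^sub>L X) + D \<in> closure ?Q"
    unfolding closure_approachable
  proof (intro allI impI)
    fix e :: real assume "e > 0"
    then obtain S where S: "S \<in> ?Q" "dist S ((X o\<^sub>L T) - (T o\<^sub>L X)) < e"
      using X T unfolding almost_derives_def closure_approachable by blast
    have "S + D \<in> ?Q" by (rule quasitriangular_closed_under(2)[OF N S(1) D])
    moreover have "dist (S + D) ((X o\<^sub>L T) - (T o\<^sub>L X) + D) < e" using S(2) by (simp add: dist_norm)
    ultimately show "\<exists>y\<in>?Q. dist y ((X o\<^sub>L T) - (T o\<^sub>L X) + D) < e" by blast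
  qed
  moreover have "((X + C) o\<^sub>L T) - (T o\<^sub>L (X + C)) = (X o\<^sub>L T) - (T o\<^sub>L X) + D"
    by (rule blinfun_eqI) (simp add: D_def blinfun.diff_left blinfun.add_left blinfun.add_right)
  ultimately show "((X + C) o\<^sub>L T) - (T o\<^sub>L (X + C)) \<in> closure ?Q" by simp
qed

lemma gap_in_nest_algebra:
  assumes "nest N" "A \<in> N" "B \<in> N"
  shows "gap A B \<in> nest_algebra N"
proof -
  have "gap A B = proj B + blinfun_scaleC (-1) (proj A)"
    by (rule blinfun_eqI) (simp add: gap_apply blinfun.add_left)
  thus ?thesis
    using nest_algebra_closed_under(1,2)[OF assms(1)] proj_in_nest_algebra assms by metis
qed

text \<open>Were the lower corners of \<open>X\<close> bounded below on infinitely many disjoint intervals, then the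
  commutator of \<open>X\<close> with the projection \<open>T\<close> onto the lower halves of these intervals would have
  lower corners bounded below as well. They are those of a compact operator, up to a small error.\<close>

lemma no_bad_interval_sequence:
  fixes A R B :: "nat \<Rightarrow> 'a::chilbert_space set"
  assumes N: "nest N" and X: "almost_derives N X"
    and mem: "\<And>n. A n \<in> N" "\<And>n. R n \<in> N" "\<And>n. B n \<in> N"
    and sub: "\<And>n. A n \<subseteq> R n" "\<And>n. R n \<subseteq> B n"
    and disj: "\<And>m n. m < n \<Longrightarrow> B m \<subseteq> A n \<or> B n \<subseteq> A m"
    and \<epsilon>: "\<epsilon> > 0" and bad: "\<And>n. norm (gap (R n) (B n) o\<^sub>L X o\<^sub>L gap (A n) (R n)) > \<epsilon>"
  shows False
proof -
  note cl = nest_closed_csubspace[OF N]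
  note clA = cl[OF mem(1)] and clR = cl[OF mem(2)] and clB = cl[OF mem(3)]
  define F G where "F n = gap (A n) (R n)" and "G n = gap (R n) (B n)" for n
  have disj': "B m \<subseteq> A n \<or> B n \<subseteq> A m" if "m \<noteq> n" for m n
    using disj[of m n] disj[of n m] that by (metis nat_neq_iff)
  have FR: "F n v \<in> R n" and FA: "F n v \<in> ocomp (A n)" and GB: "G n v \<in> B n" and GR: "G n v \<in> ocomp (R n)"
    for n v
    unfolding F_def G_def
    by (rule gap_in[OF clA clR sub(1)] gap_in_ocomp[OF clA clR sub(1)]
        gap_in[OF clR clB sub(2)] gap_in_ocomp[OF clR clB sub(2)])+
  have orth: "cinner u v = 0" if "u \<in> B m" "u \<in> ocomp (A m)" "v \<in> B n" "v \<in> ocomp (A n)" "m \<noteq> n" for u v m n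
    using disj'[OF that(5)]
  proof
    assume "B m \<subseteq> A n"
    thus ?thesis using that ocomp_sym by blast
  next
    assume "B n \<subseteq> A m"
    hence "cinner v u = 0" using that ocomp_sym by blast
    thus ?thesis using cinner_commute_zero by blast
  qed
  have FB: "F n v \<in> B n" for n v using FR sub(2) by blast
  have GA: "G n v \<in> ocomp (A n)" for n v using subsetD[OF ocomp_antimono[OF sub(1)] GR] .
  have FF: "F m (F n v) = (if m = n then F n v else 0)" for m n v
  proof (cases "m = n")
    case True thus ?thesis by (simp add: F_def gap_gap clA clR sub)
  next
    case False
    have "cinner w (F m (F n v)) = 0" for w
      using orth[OF FB FA FB FA False, of w v]
      by (simp add: F_def gap_self_adjoint[OF clA clR sub(1), symmetric])
    thus ?thesis using False by (metis cinner_eq_zero_iff)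
  qed
  have GF: "G m (F n v) = 0" for m n v
  proof (cases "m = n")
    case True
    thus ?thesis using FR[of n v] by (simp add: G_def gap_lower[OF clR clB sub(2)])
  next
    case False
    have "cinner w (G m (F n v)) = 0" for w
      using orth[OF GB GA FB FA False, of w v]
      by (simp add: G_def gap_self_adjoint[OF clR clB sub(2), symmetric])
    thus ?thesis by (metis cinner_eq_zero_iff)
  qed
  have GG: "cinner (G m v) (G n w) = 0" if "m \<noteq> n" for m n v w
    by (rule orth[OF GB GA GB GA that])
  have sumF: "(\<Sum>i<n. (norm (F i v))\<^sup>2) \<le> (norm v)\<^sup>2" for n v
  proof (rule sum_norm_gap_le)
    show "cinner (F i v) (F j v) = 0" if "i \<noteq> j" for i j by (rule orth[OF FB FA FB FA that])
    show "cinner (F i v) v = complex_of_real ((norm (F i v))\<^sup>2)" for i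
      unfolding F_def by (rule cinner_gap[OF clA clR sub(1)])
  qed
  have sumG: "(\<Sum>i<n. (norm (G i v))\<^sup>2) \<le> (norm v)\<^sup>2" for n v
  proof (rule sum_norm_gap_le)
    show "cinner (G i v) (G j v) = 0" if "i \<noteq> j" for i j by (rule GG[OF that])
    show "cinner (G i v) v = complex_of_real ((norm (G i v))\<^sup>2)" for i
      unfolding G_def by (rule cinner_gap[OF clR clB sub(2)])
  qed
  have "\<exists>T\<in>bounded_operators. \<forall>v. (\<lambda>i. F i v) sums T v"
  proof (rule orthogonal_operator_sum)
    show "F i \<in> bounded_operators" for i unfolding F_def by (rule gap_bounded[OF clA clR sub(1)])
    show "cinner (F i v) (F j w) = 0" if "i \<noteq> j" for i j v w by (rule orth[OF FB FA FB FA that])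
  qed (rule sumF)
  then obtain T where T: "T \<in> bounded_operators" "\<And>v. (\<lambda>i. F i v) sums T v" by auto
  have TN: "T \<in> nest_algebra N"
    by (rule nest_algebra_sums[OF N T]) (simp add: F_def gap_in_nest_algebra[OF N mem(1,2)])
  have TF: "T (F n v) = F n v" for n v
  proof (rule sums_unique2[OF T(2)])
    show "(\<lambda>i. F i (F n v)) sums F n v"
      using sums_single[of n "\<lambda>i. F n v"] by (simp add: FF)
  qed
  \<comment> \<open>The range of \<open>T\<close> avoids all upper halves, so \<open>G n\<close>
    annihilates the second term of the commutator.\<close>
  have GT: "G n (T v) = 0" for n v
  proof (rule sums_unique2)
    show "(\<lambda>i. G n (F i v)) sums G n (T v)"
      by (rule bounded_linear.sums[OF blinfun.bounded_linear_right T(2)])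
    show "(\<lambda>i. G n (F i v)) sums 0" by (simp add: GF)
  qed
  have "(X o\<^sub>L T) - (T o\<^sub>L X) \<in> closure (quasitriangular_algebra N)"
    using X TN by (simp add: almost_derives_def)
  then obtain S where S: "S \<in> quasitriangular_algebra N" "dist S ((X o\<^sub>L T) - (T o\<^sub>L X)) < \<epsilon>/2"
    using \<epsilon> unfolding closure_approachable by (metis half_gt_zero)
  then obtain S1 C where C: "S = S1 + C" "S1 \<in> nest_algebra N" "C \<in> compact_operators"
    by (auto simp: quasitriangular_algebra_def)
  \<comment> \<open>Between \<open>G n\<close> and \<open>F n\<close> the commutator with
    \<open>T\<close> reduces to \<open>X\<close>, and \<open>S1\<close>, which leaves
    \<open>R n\<close> invariant, contributes nothing. So the corner of \<open>C\<close> differs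
    from that of \<open>X\<close> by at most \<epsilon>/2.\<close>
  have "\<exists>v. norm v \<le> 1 \<and> norm (G n (C (F n v))) > \<epsilon>/2" for n
  proof (rule ccontr)
    assume "\<not> ?thesis"
    hence small: "norm (G n (C (F n v))) \<le> \<epsilon>/2" if "norm v \<le> 1" for v using that by (metis not_le)
    have small': "norm (G n (C (F n v))) \<le> \<epsilon>/2 * norm v" for v
    proof (cases "v = 0")
      case False
      have "norm (G n (C (F n ((1 / norm v) *\<^sub>R v)))) \<le> \<epsilon>/2" using False by (intro small) simp
      thus ?thesis using False by (simp add: blinfun.scaleR_right divide_le_eq)
    qed simp
    have "norm (G n o\<^sub>L X o\<^sub>L F n) \<le> \<epsilon>"
    proof (rule norm_blinfun_bound)
      fix v
      define D where "D = ((X o\<^sub>L T) - (T o\<^sub>L X)) - S"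
      have nD: "norm D \<le> \<epsilon>/2" using S(2) by (simp add: D_def dist_norm norm_minus_commute)
      have "S1 (F n v) \<in> R n" by (rule nest_algebra_invariant[OF C(2) mem(2) FR])
      hence GS: "G n (S1 (F n v)) = 0" by (simp add: G_def gap_lower[OF clR clB sub(2)])
      have "D (F n v) = X (F n v) - T (X (F n v)) - S1 (F n v) - C (F n v)"
        by (simp add: D_def C(1) blinfun.diff_left blinfun.add_left TF)
      hence "G n (D (F n v)) = G n (X (F n v)) - G n (C (F n v))"
        by (simp add: blinfun.diff_right GT GS)
      hence "norm (G n (X (F n v))) \<le> norm (G n (D (F n v))) + norm (G n (C (F n v)))"
        by (metis diff_add_cancel norm_triangle_ineq)
      also have "norm (G n (D (F n v))) \<le> norm (D (F n v))"
        unfolding G_def by (rule norm_gap[OF clR clB sub(2)])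
      also have "norm (D (F n v)) \<le> norm D * norm (F n v)" by (rule norm_blinfun)
      also have "\<dots> \<le> \<epsilon>/2 * norm v"
        using nD \<epsilon> norm_gap[OF clA clR sub(1), of n v] by (intro mult_mono) (auto simp: F_def)
      finally show "norm ((G n o\<^sub>L X o\<^sub>L F n) v) \<le> \<epsilon> * norm v" using small'[of v] by simp
    qed (use \<epsilon> in simp)
    thus False using bad[of n] by (simp add: F_def G_def)
  qed
  then obtain v where v: "\<And>n. norm (v n) \<le> 1" "\<And>n. norm (G n (C (F n (v n)))) > \<epsilon>/2" by metis
  have "norm (F n (v n)) \<le> 1" for n
    using norm_gap[OF clA clR sub(1), of n "v n"] v(1)[of n] by (simp add: F_def)
  from compact_operators_subsequence[OF C(3), of "\<lambda>n. F n (v n)", OF this] obtain r z where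
    r: "strict_mono r" "(\<lambda>n. C (F (r n) (v (r n)))) \<longlonglongrightarrow> z" by auto
  \<comment> \<open>Compactness has provided a limit \<open>z\<close> of the vectors
    \<open>C (F n (v n))\<close> along \<open>r\<close>. By Bessel's inequality the orthogonal
    projections \<open>G i\<close> tend to 0 at \<open>z\<close>, against the lower bound
    \<epsilon>/2.\<close>
  have "summable (\<lambda>i. (norm (G i z))\<^sup>2)"
    by (rule summableI_nonneg_bounded[where x = "(norm z)\<^sup>2"]) (use sumG in auto)
  hence "(\<lambda>i. sqrt ((norm (G i z))\<^sup>2)) \<longlonglongrightarrow> sqrt 0"
    by (intro tendsto_intros summable_LIMSEQ_zero)
  hence Gz: "(\<lambda>i. norm (G i z)) \<longlonglongrightarrow> 0" by simp
  have "(\<lambda>n. norm (C (F (r n) (v (r n))) - z) + norm (G (r n) z)) \<longlonglongrightarrow> norm (z - z) + 0"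
    by (intro tendsto_intros r(2) filterlim_compose[OF Gz filterlim_subseq[OF r(1)]])
  moreover have "\<epsilon>/2 \<le> norm (C (F (r n) (v (r n))) - z) + norm (G (r n) z)" for n
  proof -
    define c where "c = C (F (r n) (v (r n)))"
    have "G (r n) c = G (r n) (c - z) + G (r n) z" by (simp add: blinfun.diff_right)
    hence "norm (G (r n) c) \<le> norm (G (r n) (c - z)) + norm (G (r n) z)" by (metis norm_triangle_ineq)
    also have "norm (G (r n) (c - z)) \<le> norm (c - z)"
      unfolding G_def by (rule norm_gap[OF clR clB sub(2)])
    finally show ?thesis using v(2)[of "r n"] by (simp add: c_def)
  qed
  ultimately have "\<epsilon>/2 \<le> norm (z - z) + 0" by (intro LIMSEQ_le_const) auto
  thus False using \<epsilon> by simp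
qed

text \<open>All lower corners of the compression of \<open>X\<close> to the interval from
  \<open>A\<close> to \<open>B\<close> have norm at most \<epsilon>.\<close>

definition small_interval :: "'a::chilbert_space set set \<Rightarrow> ('a \<Rightarrow>\<^sub>L 'a) \<Rightarrow> real \<Rightarrow> 'a set \<Rightarrow> 'a set \<Rightarrow> bool"
  where "small_interval N X \<epsilon> A B \<longleftrightarrow> (\<forall>R\<in>N. A \<subseteq> R \<longrightarrow> R \<subseteq> B \<longrightarrow> norm (gap R B o\<^sub>L X o\<^sub>L gap A R) \<le> \<epsilon>)"

lemma exists_bad_vector:
  fixes T :: "'a::chilbert_space \<Rightarrow>\<^sub>L 'a"
  assumes "\<epsilon> < norm T" "0 \<le> \<epsilon>"
  shows "\<exists>v. norm (T v) > \<epsilon> * norm v"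
proof (rule ccontr)
  assume "\<not> ?thesis"
  hence "norm T \<le> \<epsilon>" using assms(2) by (intro norm_blinfun_bound) (auto simp: not_less)
  thus False using assms by simp
qed

lemma norm_gt_of_vector:
  fixes T :: "'a::chilbert_space \<Rightarrow>\<^sub>L 'a"
  assumes "norm (T v) > \<epsilon> * norm v" "0 \<le> \<epsilon>"
  shows "norm T > \<epsilon>"
proof (rule ccontr)
  assume "\<not> ?thesis"
  hence "norm T * norm v \<le> \<epsilon> * norm v" by (intro mult_right_mono) auto
  thus False using norm_blinfun[of T v] assms by simp
qed

text \<open>Strong convergence of the projections of a chain to that of its closed span: the union
  of the chain is already a subspace, and it is dense in \<open>S\<close>.\<close>

lemma proj_approx_from_below:
  assumes N: "nest N" and F: "F \<subseteq> N" "F \<noteq> {}" and S: "S = closure (cspan (\<Union>F))" and \<delta>: "\<delta> > 0"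
  shows "\<exists>P\<in>F. \<forall>Q\<in>N. P \<subseteq> Q \<longrightarrow> Q \<subseteq> S \<longrightarrow> norm (proj S y - proj Q y) < \<delta>"
proof -
  note cl = nest_closed_csubspace[OF N]
  have SN: "S \<in> N" unfolding S by (rule nest_Union[OF N F(1)])
  have "csubspace (\<Union>F)"
  proof (rule csubspaceI)
    have "0 \<in> M" if "M \<in> F" for M
      using cl[of M] F(1) that by (auto simp: closed_csubspace_def csubspace_zero)
    thus "0 \<in> \<Union>F" using F(2) by blast
    fix c x y assume "x \<in> \<Union>F"
    then obtain M where M: "M \<in> F" "x \<in> M" by blast
    have sM: "csubspace M" using cl[of M] F(1) M by (auto simp: closed_csubspace_def)
    show "c *\<^sub>C x \<in> \<Union>F" using csubspace_scaleC[OF sM M(2), of c] M(1) by blast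
    assume "y \<in> \<Union>F"
    then obtain L where L: "L \<in> F" "y \<in> L" by blast
    have sL: "csubspace L" using cl[of L] F(1) L by (auto simp: closed_csubspace_def)
    have "L \<in> N" "M \<in> N" using L M F(1) by auto
    from nest_chain[OF N this] show "x + y \<in> \<Union>F"
    proof
      assume "L \<subseteq> M"
      hence "x + y \<in> M" using csubspace_add[OF sM M(2)] L(2) by blast
      thus ?thesis using M(1) by blast
    next
      assume "M \<subseteq> L"
      hence "x + y \<in> L" using csubspace_add[OF sL _ L(2)] M(2) by blast
      thus ?thesis using L(1) by blast
    qed
  qed
  hence "S = closure (\<Union>F)" by (simp add: S complex_vector.span_eq_iff[THEN iffD2])
  moreover have "proj S y \<in> S" by (rule proj_in[OF cl[OF SN]])
  ultimately have "proj S y \<in> closure (\<Union>F)" by simp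
  then obtain z where z: "z \<in> \<Union>F" "dist z (proj S y) < \<delta>"
    using \<delta> closure_approachableD[of "proj S y" "\<Union>F" \<delta>] by (auto simp: dist_commute)
  then obtain P where P: "P \<in> F" "z \<in> P" by blast
  have "norm (proj S y - proj Q y) < \<delta>" if Q: "Q \<in> N" "P \<subseteq> Q" "Q \<subseteq> S" for Q
  proof -
    have "z \<in> Q" using P Q by blast
    hence "proj S y - proj Q y = proj (ocomp Q) (proj S y - z)"
      by (simp add: proj_ocomp cl Q blinfun.diff_right proj_id proj_proj_subset[OF cl[OF Q(1)] cl[OF SN] Q(3)])
    hence "norm (proj S y - proj Q y) \<le> norm (proj S y - z)"
      using norm_proj_le[OF closed_csubspace_ocomp] by metis
    thus ?thesis using z(2) by (simp add: dist_norm norm_minus_commute)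
  qed
  thus ?thesis using P(1) by blast
qed

text \<open>The mirror image of \<open>proj_approx_from_below\<close> in the nest of
  complements.\<close>

lemma proj_approx_from_above:
  assumes N: "nest N" and F: "F \<subseteq> N" "F \<noteq> {}" and \<delta>: "\<delta> > 0"
  shows "\<exists>P\<in>F. \<forall>Q\<in>N. Q \<subseteq> P \<longrightarrow> \<Inter>F \<subseteq> Q \<longrightarrow> norm (proj Q y - proj (\<Inter>F) y) < \<delta>"
proof -
  note cl = nest_closed_csubspace[OF N]
  have IN: "\<Inter>F \<in> N" by (rule nest_Inter[OF N F(1)])
  have eq: "ocomp (\<Inter>F) = closure (cspan (\<Union>(ocomp ` F)))"
  proof -
    have "ocomp (closure (cspan (\<Union>(ocomp ` F)))) = \<Inter>(ocomp ` ocomp ` F)" by (rule ocomp_span_Union)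
    also have "ocomp ` ocomp ` F = (\<lambda>x. x) ` F"
      unfolding image_image using ocomp_ocomp[OF cl] F(1) by (intro image_cong) auto
    finally have "ocomp (ocomp (closure (cspan (\<Union>(ocomp ` F))))) = ocomp (\<Inter>F)" by simp
    thus ?thesis
      using ocomp_ocomp[of "closure (cspan (\<Union>(ocomp ` F)))"]
      by (simp add: closed_csubspace_def csubspace_closure complex_vector.subspace_span)
  qed
  have "\<exists>P'\<in>ocomp ` F. \<forall>Q\<in>ocomp ` N. P' \<subseteq> Q \<longrightarrow> Q \<subseteq> ocomp (\<Inter>F) \<longrightarrow> norm (proj (ocomp (\<Inter>F)) y - proj Q y) < \<delta>"
    using F by (intro proj_approx_from_below[OF nest_ocomp[OF N] _ _ eq \<delta>]) auto
  then obtain P where P: "P \<in> F" "\<And>Q. Q \<in> N \<Longrightarrow> ocomp P \<subseteq> ocomp Q \<Longrightarrow> ocomp Q \<subseteq> ocomp (\<Inter>F) \<Longrightarrow>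
      norm (proj (ocomp (\<Inter>F)) y - proj (ocomp Q) y) < \<delta>" by auto
  have "norm (proj Q y - proj (\<Inter>F) y) < \<delta>" if "Q \<in> N" "Q \<subseteq> P" "\<Inter>F \<subseteq> Q" for Q
    using P(2)[OF that(1) ocomp_antimono[OF that(2)] ocomp_antimono[OF that(3)]]
    by (simp add: proj_ocomp[OF cl[OF IN]] proj_ocomp[OF cl[OF that(1)]])
  thus ?thesis using P(1) by blast
qed

definition small_chain :: "'a::chilbert_space set set \<Rightarrow> ('a \<Rightarrow>\<^sub>L 'a) \<Rightarrow> real \<Rightarrow> nat \<Rightarrow> (nat \<Rightarrow> 'a set) \<Rightarrow> bool"
  where "small_chain N X \<epsilon> n L \<longleftrightarrow> L 0 = {0} \<and> (\<forall>i\<le>n. L i \<in> N) \<and>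
    (\<forall>i<n. L i \<subseteq> L (Suc i) \<and> small_interval N X \<epsilon> (L i) (L (Suc i)))"

lemma small_chain_extend:
  assumes "small_chain N X \<epsilon> n L" "M \<in> N" "L n \<subseteq> M" "small_interval N X \<epsilon> (L n) M"
  shows "small_chain N X \<epsilon> (Suc n) (L(Suc n := M))"
  using assms by (auto simp: small_chain_def le_Suc_eq less_Suc_eq)

text \<open>Let \<open>S\<close> be the closed span of the members reached by finite chains of small
  intervals. If \<open>S\<close> were not reached, bad intervals would follow one another below
  \<open>S\<close>; if it were reached but proper, they would descend towards \<open>S\<close> from
  above. Both contradict \<open>no_bad_interval_sequence\<close>.\<close>

lemma small_chain_UNIV:
  fixes N :: "'a::chilbert_space set set"
  assumes N: "nest N" and X: "almost_derives N X" and \<epsilon>: "\<epsilon> > 0"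
  shows "\<exists>n L. small_chain N X \<epsilon> n L \<and> L n = UNIV"
proof -
  note cl = nest_closed_csubspace[OF N]
  define reach where "reach M \<longleftrightarrow> M \<in> N \<and> (\<exists>n L. small_chain N X \<epsilon> n L \<and> L n = M)" for M
  have reach0: "reach {0}"
    unfolding reach_def small_chain_def using nest_zero[OF N]
    by (intro conjI exI[of _ 0] exI[of _ "\<lambda>_. {0}"]) auto
  have reach_step: "reach M'" if M: "reach M" "M' \<in> N" "M \<subseteq> M'" "small_interval N X \<epsilon> M M'" for M M'
  proof -
    obtain n L where "small_chain N X \<epsilon> n L" "L n = M" using M(1) by (auto simp: reach_def)
    with small_chain_extend[of N X \<epsilon> n L M'] M
    have "small_chain N X \<epsilon> (Suc n) (L(Suc n := M'))" by simp
    thus ?thesis unfolding reach_def using M(2)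
      by (intro conjI exI[of _ "Suc n"] exI[of _ "L(Suc n := M')"]) auto
  qed
  define bad where "bad A R B \<longleftrightarrow> norm (gap R B o\<^sub>L X o\<^sub>L gap A R) > \<epsilon>" for A R B
  have not_small: "\<exists>R\<in>N. A \<subseteq> R \<and> R \<subseteq> B \<and> bad A R B" if "\<not> small_interval N X \<epsilon> A B" for A B
    using that by (auto simp: small_interval_def bad_def not_le)
  define F where "F = {M. reach M}"
  define S where "S = closure (cspan (\<Union>F))"
  have FN: "F \<subseteq> N" by (auto simp: F_def reach_def)
  have F0: "F \<noteq> {}" using reach0 by (auto simp: F_def)
  have SN: "S \<in> N" unfolding S_def by (rule nest_Union[OF N FN])
  have FS: "M \<subseteq> S" if "reach M" for M
    unfolding S_def by (rule subset_closure_cspan) (simp add: F_def that)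
  have "reach S"
  proof (rule ccontr)
    assume nS: "\<not> reach S"
    have step: "\<exists>R P'. R \<in> N \<and> reach P' \<and> P \<subseteq> R \<and> R \<subseteq> P' \<and> bad P R P'" if P: "reach P" for P
    proof -
      have "\<not> small_interval N X \<epsilon> P S" using nS reach_step[OF P SN FS[OF P]] by blast
      then obtain R where R: "R \<in> N" "P \<subseteq> R" "R \<subseteq> S" "bad P R S" using not_small by blast
      from exists_bad_vector[of \<epsilon>] R(4) \<epsilon> obtain v where
        v: "norm ((gap R S o\<^sub>L X o\<^sub>L gap P R) v) > \<epsilon> * norm v" unfolding bad_def by force
      define y where "y = X (gap P R v)"
      have y: "norm (proj S y - proj R y) > \<epsilon> * norm v" using v by (simp add: y_def gap_apply)
      have "R \<noteq> S"
      proof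
        assume "R = S"
        hence "\<epsilon> * norm v < 0" using y by simp
        thus False using \<epsilon> by (simp add: mult_less_0_iff)
      qed
      have "\<exists>P''. reach P'' \<and> R \<subseteq> P''"
      proof (rule ccontr)
        assume no: "\<not> ?thesis"
        have "M \<subseteq> R" if "reach M" for M
          using no that nest_chain[OF N R(1), of M] by (auto simp: reach_def)
        hence "\<Union>F \<subseteq> R" by (auto simp: F_def)
        hence "S \<subseteq> R" unfolding S_def using cl[OF R(1)]
          by (intro closure_minimal complex_vector.span_minimal) (auto simp: closed_csubspace_def)
        thus False using R(3) \<open>R \<noteq> S\<close> by blast
      qed
      then obtain P'' where P'': "reach P''" "R \<subseteq> P''" by blast
      \<comment> \<open>Badness is a strict inequality at a single vector \<open>v\<close>. It
        survives when \<open>S\<close> is replaced by a reached member \<open>P'\<close> whose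
        projection is close enough to that of \<open>S\<close> at \<open>y\<close>.\<close>
      have "norm (proj S y - proj R y) - \<epsilon> * norm v > 0" using y by simp
      from proj_approx_from_below[OF N FN F0 S_def this, of y] obtain P0 where
        P0: "reach P0" "\<And>Q. Q \<in> N \<Longrightarrow> P0 \<subseteq> Q \<Longrightarrow> Q \<subseteq> S \<Longrightarrow>
          norm (proj S y - proj Q y) < norm (proj S y - proj R y) - \<epsilon> * norm v"
        by (auto simp: F_def)
      have "\<exists>P'. reach P' \<and> P'' \<subseteq> P' \<and> P0 \<subseteq> P'"
        using nest_chain[OF N, of P0 P''] P0(1) P''(1) by (auto simp: reach_def)
      then obtain P' where P': "reach P'" "P'' \<subseteq> P'" "P0 \<subseteq> P'" by blast
      have "norm (proj S y - proj P' y) < norm (proj S y - proj R y) - \<epsilon> * norm v"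
        using P' by (intro P0(2) FS) (auto simp: reach_def)
      moreover have "norm (proj S y - proj R y) \<le> norm (proj S y - proj P' y) + norm (proj P' y - proj R y)"
        using norm_triangle_ineq[of "proj S y - proj P' y" "proj P' y - proj R y"] by simp
      ultimately have "norm (proj P' y - proj R y) > \<epsilon> * norm v" by simp
      hence "norm ((gap R P' o\<^sub>L X o\<^sub>L gap P R) v) > \<epsilon> * norm v" by (simp add: y_def gap_apply)
      hence "bad P R P'" unfolding bad_def using \<epsilon> by (intro norm_gt_of_vector) auto
      thus ?thesis using R P' P'' by blast
    qed
    define fR where "fR P = (SOME R. \<exists>P'. R \<in> N \<and> reach P' \<and> P \<subseteq> R \<and> R \<subseteq> P' \<and> bad P R P')" for P
    define fP where "fP P = (SOME P'. fR P \<in> N \<and> reach P' \<and> P \<subseteq> fR P \<and> fR P \<subseteq> P' \<and> bad P (fR P) P')" for P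
    have f: "fR P \<in> N \<and> reach (fP P) \<and> P \<subseteq> fR P \<and> fR P \<subseteq> fP P \<and> bad P (fR P) (fP P)" if "reach P" for P
      unfolding fP_def by (rule someI_ex) (use someI_ex[OF step[OF that]] in \<open>simp add: fR_def\<close>)
    define P where "P n = (fP ^^ n) {0}" for n
    have Ps: "P (Suc n) = fP (P n)" for n by (simp add: P_def)
    have reachP: "reach (P n)" for n
    proof (induction n)
      case (Suc n)
      thus ?case using f[OF Suc] by (simp add: Ps)
    qed (simp add: P_def reach0)
    have fn: "fR (P n) \<in> N" "P n \<subseteq> fR (P n)" "fR (P n) \<subseteq> P (Suc n)" "bad (P n) (fR (P n)) (P (Suc n))" for n
      using f[OF reachP[of n]] unfolding Ps by blast+
    have mono: "P m \<subseteq> P n" if "m \<le> n" for m n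
      by (rule lift_Suc_mono_le[of P, OF order_trans[OF fn(2,3)] that])
    show False
    proof (rule no_bad_interval_sequence[OF N X, of P "\<lambda>n. fR (P n)" "\<lambda>n. P (Suc n)" \<epsilon>])
      show "P n \<in> N" "P (Suc n) \<in> N" for n using reachP[of n] reachP[of "Suc n"] by (simp_all add: reach_def)
      show "fR (P n) \<in> N" "P n \<subseteq> fR (P n)" "fR (P n) \<subseteq> P (Suc n)" for n by (rule fn)+
      show "P (Suc m) \<subseteq> P n \<or> P (Suc n) \<subseteq> P m" if "m < n" for m n using mono[of "Suc m" n] that by simp
      show "norm (gap (fR (P n)) (P (Suc n)) o\<^sub>L X o\<^sub>L gap (P n) (fR (P n))) > \<epsilon>" for n
        using fn(4)[of n] by (simp add: bad_def)
    qed (rule \<epsilon>)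
  qed
  have "S = UNIV"
  proof (rule ccontr)
    assume "S \<noteq> UNIV"
    define G where "G = {M\<in>N. S \<subset> M}"
    have GN: "G \<subseteq> N" and G0: "G \<noteq> {}" using nest_UNIV[OF N] \<open>S \<noteq> UNIV\<close> by (auto simp: G_def)
    have IN: "\<Inter>G \<in> N" by (rule nest_Inter[OF N GN])
    have SI: "S \<subseteq> \<Inter>G" by (auto simp: G_def)
    \<comment> \<open>Otherwise \<open>S\<close> has an immediate successor. The interval between
      them contains only its ends, so it is small and the successor would be reached.\<close>
    have "\<Inter>G = S"
    proof (rule ccontr)
      assume ne: "\<Inter>G \<noteq> S"
      have "small_interval N X \<epsilon> S (\<Inter>G)"
        unfolding small_interval_def
      proof (intro ballI impI)
        fix R assume R: "R \<in> N" "S \<subseteq> R" "R \<subseteq> \<Inter>G"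
        have "R = S \<or> R = \<Inter>G"
        proof (cases "R = S")
          case False
          hence "R \<in> G" using R by (auto simp: G_def)
          thus ?thesis using R(3) by blast
        qed simp
        thus "norm (gap R (\<Inter>G) o\<^sub>L X o\<^sub>L gap S R) \<le> \<epsilon>" using \<epsilon> by auto
      qed
      from FS[OF reach_step[OF \<open>reach S\<close> IN SI this]] SI ne show False by blast
    qed
    have step: "\<exists>R P'. R \<in> N \<and> P' \<in> G \<and> P' \<subseteq> R \<and> R \<subseteq> P \<and> bad P' R P" if P: "P \<in> G" for P
    proof -
      have PN: "P \<in> N" "S \<subseteq> P" "P \<noteq> S" using P by (auto simp: G_def)
      have "\<not> small_interval N X \<epsilon> S P" using FS[OF reach_step[OF \<open>reach S\<close> PN(1,2)]] PN by blast
      then obtain R where R: "R \<in> N" "S \<subseteq> R" "R \<subseteq> P" "bad S R P" using not_small by blast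
      from exists_bad_vector[of \<epsilon>] R(4) \<epsilon> obtain v where
        v: "norm ((gap R P o\<^sub>L X o\<^sub>L gap S R) v) > \<epsilon> * norm v" unfolding bad_def by force
      have "R \<noteq> S"
      proof
        assume "R = S"
        hence "\<epsilon> * norm v < 0" using v by simp
        thus False using \<epsilon> by (simp add: mult_less_0_iff)
      qed
      hence RG: "R \<in> G" using R by (auto simp: G_def)
      \<comment> \<open>This time the lower end of the interval moves, so the error passes through
        \<open>X\<close>; adding 1 keeps the divisor positive.\<close>
      define \<delta> where "\<delta> = (norm ((gap R P o\<^sub>L X o\<^sub>L gap S R) v) - \<epsilon> * norm v) / (norm X + 1)"
      have \<delta>: "\<delta> > 0" using v by (simp add: \<delta>_def add_nonneg_pos)
      from proj_approx_from_above[OF N GN G0 \<delta>, of v] obtain P0 where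
        P0: "P0 \<in> G" "\<And>Q. Q \<in> N \<Longrightarrow> Q \<subseteq> P0 \<Longrightarrow> S \<subseteq> Q \<Longrightarrow> norm (proj Q v - proj S v) < \<delta>"
        unfolding \<open>\<Inter>G = S\<close> by auto
      have "\<exists>P'\<in>G. P' \<subseteq> P0 \<and> P' \<subseteq> R"
        using nest_chain[OF N, of P0 R] P0(1) RG GN by auto
      then obtain P' where P': "P' \<in> G" "P' \<subseteq> P0" "P' \<subseteq> R" by blast
      have d: "norm (proj P' v - proj S v) < \<delta>" using P' by (intro P0(2)) (auto simp: G_def)
      define z where "z = X (proj P' v - proj S v)"
      have "norm z \<le> norm X * norm (proj P' v - proj S v)" unfolding z_def by (rule norm_blinfun)
      also have "\<dots> \<le> (norm X + 1) * norm (proj P' v - proj S v)" by (intro mult_right_mono) auto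
      also have "\<dots> < (norm X + 1) * \<delta>" using d by (intro mult_strict_left_mono) (auto simp: add_nonneg_pos)
      also have "\<dots> = norm ((gap R P o\<^sub>L X o\<^sub>L gap S R) v) - \<epsilon> * norm v"
      proof -
        have "norm X + 1 \<noteq> 0" using norm_ge_zero[of X] by linarith
        thus ?thesis by (simp add: \<delta>_def)
      qed
      finally have nz: "norm z < norm ((gap R P o\<^sub>L X o\<^sub>L gap S R) v) - \<epsilon> * norm v" .
      have "(gap R P o\<^sub>L X o\<^sub>L gap S R) v = (gap R P o\<^sub>L X o\<^sub>L gap P' R) v + gap R P z"
        by (simp add: z_def gap_apply blinfun.diff_right blinfun.diff_left)
      hence "norm ((gap R P o\<^sub>L X o\<^sub>L gap S R) v) \<le> norm ((gap R P o\<^sub>L X o\<^sub>L gap P' R) v) + norm (gap R P z)"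
        by (metis norm_triangle_ineq)
      moreover have "norm (gap R P z) \<le> norm z" by (rule norm_gap[OF cl[OF R(1)] cl[OF PN(1)] R(3)])
      ultimately have "norm ((gap R P o\<^sub>L X o\<^sub>L gap P' R) v) > \<epsilon> * norm v" using nz by linarith
      hence "bad P' R P" unfolding bad_def using \<epsilon> by (intro norm_gt_of_vector) auto
      thus ?thesis using R P' by blast
    qed
    define fR where "fR P = (SOME R. \<exists>P'. R \<in> N \<and> P' \<in> G \<and> P' \<subseteq> R \<and> R \<subseteq> P \<and> bad P' R P)" for P
    define fP where "fP P = (SOME P'. fR P \<in> N \<and> P' \<in> G \<and> P' \<subseteq> fR P \<and> fR P \<subseteq> P \<and> bad P' (fR P) P)" for P
    have f: "fR P \<in> N \<and> fP P \<in> G \<and> fP P \<subseteq> fR P \<and> fR P \<subseteq> P \<and> bad (fP P) (fR P) P" if "P \<in> G" for P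
      unfolding fP_def by (rule someI_ex) (use someI_ex[OF step[OF that]] in \<open>simp add: fR_def\<close>)
    define P where "P n = (fP ^^ n) UNIV" for n
    have Ps: "P (Suc n) = fP (P n)" for n by (simp add: P_def)
    have "UNIV \<in> G" using nest_UNIV[OF N] \<open>S \<noteq> UNIV\<close> by (auto simp: G_def)
    hence PG: "P n \<in> G" for n
    proof (induction n)
      case (Suc n)
      thus ?case using f[of "P n"] by (simp add: Ps)
    qed (simp add: P_def)
    have fn: "fR (P n) \<in> N" "P (Suc n) \<subseteq> fR (P n)" "fR (P n) \<subseteq> P n" "bad (P (Suc n)) (fR (P n)) (P n)" for n
      using f[OF PG[of n]] unfolding Ps by blast+
    have mono: "P n \<subseteq> P m" if "m \<le> n" for m n
      by (rule lift_Suc_antimono_le[of P, OF order_trans[OF fn(2,3)] that])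
    show False
    proof (rule no_bad_interval_sequence[OF N X, of "\<lambda>n. P (Suc n)" "\<lambda>n. fR (P n)" P \<epsilon>])
      show "P n \<in> N" "P (Suc n) \<in> N" for n using PG GN by auto
      show "fR (P n) \<in> N" "P (Suc n) \<subseteq> fR (P n)" "fR (P n) \<subseteq> P n" for n by (rule fn)+
      show "P m \<subseteq> P (Suc n) \<or> P n \<subseteq> P (Suc m)" if "m < n" for m n using mono[of "Suc m" n] that by simp
      show "norm (gap (fR (P n)) (P n) o\<^sub>L X o\<^sub>L gap (P (Suc n)) (fR (P n))) > \<epsilon>" for n
        using fn(4)[of n] by (simp add: bad_def)
    qed (rule \<epsilon>)
  qed
  thus ?thesis using \<open>reach S\<close> by (auto simp: reach_def)
qed

text \<open>A compact completion makes \<open>X - Y\<close> block upper triangular for the chain. Removing the block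
  diagonal of \<open>Y\<close> keeps this and leaves the diagonal blocks of \<open>X\<close> alone, whose lower corners are
  small.\<close>

lemma compact_correction:
  fixes N :: "'a::chilbert_space set set"
  assumes N: "nest N" and X: "almost_derives N X" and c: "\<And>R. R \<in> N \<Longrightarrow> norm (low R X) \<le> c" "c > 0"
    and \<epsilon>: "\<epsilon> > 0"
  shows "\<exists>C\<in>compact_operators. norm C \<le> 4 * c \<and> (\<forall>R\<in>N. norm (low R (X - C)) \<le> \<epsilon>)"
proof -
  note cl = nest_closed_csubspace[OF N]
  obtain n L where ch: "small_chain N X \<epsilon> n L" "L n = UNIV" using small_chain_UNIV[OF N X \<epsilon>] by blast
  have L: "L 0 = {0}" "\<And>i. i \<le> n \<Longrightarrow> L i \<in> N" "\<And>i. i < n \<Longrightarrow> L i \<subseteq> L (Suc i)"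
    "\<And>i. i < n \<Longrightarrow> small_interval N X \<epsilon> (L i) (L (Suc i))"
    using ch(1) by (auto simp: small_chain_def)
  have mono: "i \<le> k \<Longrightarrow> k \<le> n \<Longrightarrow> L i \<subseteq> L k" for i k
  proof (induction k rule: dec_induct)
    case (step k) thus ?case using L(3)[of k] by auto
  qed simp
  \<comment> \<open>The completion wants corners bounded by a number below 1; this scaling makes
    them at most 1/2. Scaling back gives \<open>C0\<close> norm at most \<open>2 * c\<close>, and
    its block diagonal \<open>D\<close> is no larger, whence \<open>4 * c\<close>.\<close>
  define X' where "X' = (1 / (2 * c)) *\<^sub>R X"
  have Xb: "X \<in> bounded_operators" using X by (simp add: almost_derives_def)
  have "\<exists>Y\<in>compact_operators. norm Y \<le> 1 \<and> (\<forall>i\<le>n. \<forall>x\<in>L i. X' x - blinfun_apply Y x \<in> L i)"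
  proof (rule compact_completion_chain[where c = "1/2"])
    show "low (L i) X' \<in> compact_operators" if "i \<le> n" for i
      using almost_derives_low_compact[OF N X L(2)[OF that]]
      by (simp add: X'_def low_scaleR compact_operators_scaleR)
    show "norm (low (L i) X') \<le> 1/2" if "i \<le> n" for i
      using c(1)[OF L(2)[OF that]] c(2) by (simp add: X'_def low_scaleR field_simps)
  qed (use L cl Xb in \<open>auto simp: X'_def\<close>)
  then obtain Y where Y: "Y \<in> compact_operators" "norm Y \<le> 1"
    "\<And>i x. i \<le> n \<Longrightarrow> x \<in> L i \<Longrightarrow> X' x - Y x \<in> L i" by auto
  define C0 where "C0 = (2 * c) *\<^sub>R Y"
  have C0: "C0 \<in> compact_operators" "norm C0 \<le> 2 * c"
    using Y c by (simp_all add: C0_def compact_operators_scaleR)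
  have C0L: "X x - C0 x \<in> L i" if "i \<le> n" "x \<in> L i" for i x
  proof -
    have "(2 * c) *\<^sub>R (X' x - Y x) \<in> L i"
      using cl[OF L(2)[OF that(1)]] Y(3)[OF that] by (auto simp: closed_csubspace_def intro: csubspace_scaleR)
    thus ?thesis using c(2) by (simp add: X'_def C0_def blinfun.scaleR_left scaleR_diff_right)
  qed
  define E where "E i = gap (L i) (L (Suc i))" for i
  have clL: "closed_csubspace (L i)" if "i \<le> n" for i by (rule cl[OF L(2)[OF that]])
  have Ein: "E i v \<in> L (Suc i)" "E i v \<in> ocomp (L i)" if "i < n" for i v
    unfolding E_def using that gap_in[OF clL clL L(3)] gap_in_ocomp[OF clL clL L(3)] by auto
  have Elow: "E j x = 0" if "x \<in> L k" "k \<le> j" "j < n" for j k x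
    unfolding E_def using that mono[of k j] by (intro gap_lower clL L) auto
  have Eup: "E j x = 0" if "x \<in> ocomp (L k)" "j < k" "k \<le> n" for j k x
  proof -
    have "x \<in> ocomp (L (Suc j))" using that subsetD[OF ocomp_antimono[OF mono[of "Suc j" k]]] by auto
    thus ?thesis unfolding E_def using that by (intro gap_upper clL L) auto
  qed
  have Eorth: "cinner (E i v) (E j w) = 0" if "i \<noteq> j" "i < n" "j < n" for i j v w
  proof -
    have less: "cinner (E i v) (E j w) = 0" if "i < j" "j < n" for i j v w
    proof -
      have "E i v \<in> L j" using Ein(1)[of i v] mono[of "Suc i" j] that by auto
      thus ?thesis using Ein(2)[OF that(2), of w] ocomp_sym by blast
    qed
    show ?thesis using less[of i j v w] less[of j i w v] that cinner_commute_zero[of "E i v" "E j w"]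
      by (cases i j rule: linorder_cases) auto
  qed
  define D where "D = (\<Sum>i<n. E i o\<^sub>L C0 o\<^sub>L E i)"
  have Dapp: "D v = (\<Sum>i<n. E i (C0 (E i v)))" for v by (simp add: D_def blinfun.sum_left)
  have Eb: "E i \<in> bounded_operators" if "i < n" for i
    unfolding E_def using that by (intro gap_bounded clL L) auto
  have Dc: "D \<in> compact_operators"
    unfolding D_def
    by (intro compact_operators_sum compact_operators_compose_left compact_operators_compose_right C0 Eb) auto
  have "norm D \<le> norm C0"
  proof (rule norm_blinfun_bound)
    fix v
    \<comment> \<open>The family is continued by 0 because \<open>sum_norm_gap_le\<close> speaks of
      all indices, while \<open>E i\<close> is known to be an interval projection only for
      \<open>i < n\<close>.\<close>
    have "(\<Sum>i<n. (norm ((if i < n then E i else 0) v))\<^sup>2) \<le> (norm v)\<^sup>2"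
    proof (rule sum_norm_gap_le)
      show "cinner ((if i < n then E i else 0) v) ((if j < n then E j else 0) v) = 0" if "i \<noteq> j" for i j
        using Eorth that by simp
      show "cinner ((if i < n then E i else 0) v) v = complex_of_real ((norm ((if i < n then E i else 0) v))\<^sup>2)" for i
      proof (cases "i < n")
        case True
        thus ?thesis unfolding E_def by (simp only: if_True) (intro cinner_gap clL L(3), auto)
      qed simp
    qed
    hence sumE: "(\<Sum>i<n. (norm (E i v))\<^sup>2) \<le> (norm v)\<^sup>2" by simp
    have "(norm (D v))\<^sup>2 = (\<Sum>i<n. (norm (E i (C0 (E i v))))\<^sup>2)"
      unfolding Dapp by (rule norm_sum_orthogonal) (auto intro: Eorth)
    also have "\<dots> \<le> (\<Sum>i<n. (norm C0 * norm (E i v))\<^sup>2)"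
    proof (intro sum_mono power_mono norm_ge_zero)
      fix i assume "i \<in> {..<n}"
      hence "norm (E i (C0 (E i v))) \<le> norm (C0 (E i v))"
        unfolding E_def by (intro norm_gap clL L) auto
      also have "\<dots> \<le> norm C0 * norm (E i v)" by (rule norm_blinfun)
      finally show "norm (E i (C0 (E i v))) \<le> norm C0 * norm (E i v)" .
    qed
    also have "\<dots> = (norm C0)\<^sup>2 * (\<Sum>i<n. (norm (E i v))\<^sup>2)"
      by (simp add: power_mult_distrib sum_distrib_left)
    also have "\<dots> \<le> (norm C0)\<^sup>2 * (norm v)\<^sup>2" using sumE by (intro mult_left_mono) auto
    finally have "(norm (D v))\<^sup>2 \<le> (norm C0 * norm v)\<^sup>2" by (simp add: power_mult_distrib)
    thus "norm (D v) \<le> norm C0 * norm v" by (rule power2_le_imp_le) simp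
  qed simp
  define C where "C = C0 - D"
  have Cc: "C \<in> compact_operators" unfolding C_def by (intro compact_operators_diff C0 Dc)
  have "norm C \<le> norm C0 + norm D" unfolding C_def by (rule norm_triangle_ineq4)
  hence nC: "norm C \<le> 4 * c" using \<open>norm D \<le> norm C0\<close> C0(2) by simp
  define Z where "Z = X - C"
  have DL: "D x \<in> L k" if k: "k \<le> n" and x: "x \<in> L k" for k x
  proof -
    have "E j (C0 (E j x)) \<in> L k" if "j < n" for j
    proof (cases "k \<le> j")
      case True
      hence "E j x = 0" using that x by (intro Elow)
      thus ?thesis using clL[OF k] by (simp add: closed_csubspace_def csubspace_zero)
    next
      case False
      thus ?thesis using Ein(1)[OF that] mono[of "Suc j" k] k by auto
    qed
    thus ?thesis unfolding Dapp using clL[OF k]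
      by (intro csubspace_sum) (auto simp: closed_csubspace_def)
  qed
  have ZL: "Z x \<in> L k" if "k \<le> n" "x \<in> L k" for k x
  proof -
    have "Z x = (X x - C0 x) + D x" by (simp add: Z_def C_def blinfun.diff_left)
    thus ?thesis using C0L[OF that] DL[OF that] clL[OF that(1)]
      by (simp add: closed_csubspace_def csubspace_add)
  qed
  have "norm (low R Z) \<le> \<epsilon>" if R: "R \<in> N" for R
  proof (cases "R = UNIV")
    case True
    have "low R Z = 0" using low_zero_iff[OF cl[OF R], of Z] True by simp
    thus ?thesis using \<epsilon> by simp
  next
    case False
    \<comment> \<open>The chain starts inside \<open>R\<close> and ends at the whole space, so some
      step leaves \<open>R\<close>, and \<open>R\<close> lies in the interval of that step.\<close>
    have "\<exists>i<n. L i \<subseteq> R \<and> \<not> L (Suc i) \<subseteq> R"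
    proof (rule ccontr)
      assume no: "\<not> ?thesis"
      have "i \<le> n \<Longrightarrow> L i \<subseteq> R" for i
      proof (induction i)
        case 0
        thus ?case using L(1) cl[OF R] by (simp add: closed_csubspace_def csubspace_zero)
      next
        case (Suc i)
        thus ?case using no by simp
      qed
      from this[of n] False ch(2) show False by auto
    qed
    then obtain i where i: "i < n" "L i \<subseteq> R" "\<not> L (Suc i) \<subseteq> R" by blast
    define A B where "A = L i" and "B = L (Suc i)"
    have AB: "A \<subseteq> R" "R \<subseteq> B" "A \<in> N" "B \<in> N"
      using i nest_chain[OF N R L(2)[of "Suc i"]] L(2) by (auto simp: A_def B_def)
    note cA = cl[OF AB(3)] and cB = cl[OF AB(4)] and cR = cl[OF R]
    have "low R Z = gap R B o\<^sub>L X o\<^sub>L gap A R"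
    proof (rule blinfun_eqI)
      fix v
      define u where "u = gap A R v"
      have u: "u \<in> R" "u \<in> ocomp A" unfolding u_def by (rule gap_in[OF cA cR AB(1)] gap_in_ocomp[OF cA cR AB(1)])+
      have uB: "u \<in> B" using u AB by blast
      have Zu: "Z u \<in> B" using ZL[of "Suc i" u] i uB by (simp add: B_def)
      have "Z (proj A v) \<in> A" using ZL[of i "proj A v"] i proj_in[OF cA] by (simp add: A_def)
      hence "proj R (Z (proj A v)) = Z (proj A v)" using AB by (intro proj_id cR) auto
      moreover have "Z (proj R v) = Z (proj A v) + Z u"
        using proj_plus_gap[OF cA cR AB(1), of v] by (simp add: u_def blinfun.add_right[symmetric])
      ultimately have "low R Z v = gap R B (Z u)"
        using proj_id[OF cB Zu] by (simp add: low_apply gap_apply blinfun.add_right)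
      \<comment> \<open>Within the i-th block \<open>D\<close> is the compression of
        \<open>C0\<close>, so the two cancel in \<open>C\<close> and only \<open>X\<close>
        remains.\<close>
      moreover have "gap R B (C u) = 0"
      proof -
        have Eu: "E j u = (if j = i then u else 0)" if "j < n" for j
        proof (cases j i rule: linorder_cases)
          case less
          thus ?thesis using Eup[of u i j] u i by (simp add: A_def)
        next
          case equal
          thus ?thesis using proj_id[OF cB uB] proj_zero_iff[OF cA, of u] u
            by (simp add: E_def gap_apply A_def B_def)
        next
          case greater
          thus ?thesis using Elow[of u "Suc i" j] uB that by (simp add: B_def)
        qed
        have "D u = (\<Sum>j<n. if j = i then E i (C0 u) else 0)"
          unfolding Dapp by (intro sum.cong refl) (auto simp: Eu)
        hence "D u = gap A B (C0 u)" using i by (simp add: E_def A_def B_def)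
        moreover have "gap R B (gap A B z) = gap R B z" for z
          using AB by (simp add: gap_apply blinfun.diff_right proj_proj_subset[OF cA cB] proj_proj_subset[OF cA cR]
              proj_proj_subset[OF cR cB] proj_id[OF cB proj_in[OF cB]])
        ultimately show ?thesis by (simp add: C_def blinfun.diff_left blinfun.diff_right)
      qed
      ultimately show "low R Z v = (gap R B o\<^sub>L X o\<^sub>L gap A R) v"
        by (simp add: Z_def blinfun.diff_left blinfun.diff_right u_def)
    qed
    thus ?thesis using L(4)[OF i(1)] R AB by (simp add: small_interval_def A_def B_def)
  qed
  thus ?thesis using Cc nC by (intro bexI[of _ C]) (auto simp: Z_def)
qed

text \<open>\<open>compact_correction\<close> is iterated with bounds \<open>c k\<close> that halve.
  Each correction has norm at most \<open>4 * c k\<close>, so the remainders \<open>Y k\<close>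
  converge in norm to an operator without lower corners, and the total correction is a norm limit of
  compact operators.\<close>

theorem almost_derives_quasitriangular:
  fixes N :: "'a::chilbert_space set set"
  assumes N: "nest N" and X: "almost_derives N X"
  shows "X \<in> quasitriangular_algebra N"
proof -
  note cl = nest_closed_csubspace[OF N]
  define c where "c k = (norm X + 1) / 2 ^ k" for k :: nat
  have c: "c k > 0" for k by (simp add: c_def add_nonneg_pos)
  define P where "P k Y \<longleftrightarrow> almost_derives N Y \<and> (\<forall>R\<in>N. norm (low R Y) \<le> c k) \<and> X - Y \<in> compact_operators" for k Y
  have "\<exists>Y. \<forall>k. P k (Y k) \<and> norm (Y k - Y (Suc k)) \<le> 4 * c k"
  proof (rule dependent_nat_choice)
    have "norm (low R X) \<le> c 0" if "R \<in> N" for R using norm_low[OF cl[OF that], of X] by (simp add: c_def)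
    thus "\<exists>Y. P 0 Y" unfolding P_def using X compact_operators_zero by (intro exI[of _ X]) auto
    fix Y k assume Y: "P k Y"
    then obtain C where C: "C \<in> compact_operators" "norm C \<le> 4 * c k" "\<And>R. R \<in> N \<Longrightarrow> norm (low R (Y - C)) \<le> c (Suc k)"
      using compact_correction[OF N, of Y "c k" "c (Suc k)"] c unfolding P_def by blast
    have "almost_derives N (Y - C)"
      using almost_derives_add_compact[OF N _ compact_operators_minus[OF C(1)], of Y] Y by (simp add: P_def)
    moreover have "X - (Y - C) \<in> compact_operators"
      using compact_operators_add[OF _ C(1), of "X - Y"] Y by (simp add: P_def algebra_simps)
    ultimately show "\<exists>Y'. P (Suc k) Y' \<and> norm (Y - Y') \<le> 4 * c k"
      using C by (intro exI[of _ "Y - C"]) (simp add: P_def)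
  qed
  then obtain Y where Y: "\<And>k. P k (Y k)" "\<And>k. norm (Y k - Y (Suc k)) \<le> 4 * c k" by blast
  have "(\<lambda>k. (norm X + 1) * (1/2) ^ k) \<longlonglongrightarrow> (norm X + 1) * 0"
    by (intro tendsto_intros LIMSEQ_realpow_zero) auto
  hence c_lim: "c \<longlonglongrightarrow> 0" by (simp add: c_def[abs_def] power_one_over field_simps)
  have "summable (\<lambda>k. Y (Suc k) - Y k)"
  proof (rule summable_comparison_test')
    show "summable (\<lambda>k. 4 * (norm X + 1) * (1/2) ^ k)" by (intro summable_mult summable_geometric) simp
    show "norm (Y (Suc k) - Y k) \<le> 4 * (norm X + 1) * (1/2) ^ k" for k
      using Y(2)[of k] by (simp add: norm_minus_commute c_def power_one_over field_simps)
  qed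
  hence "convergent (\<lambda>n. \<Sum>k<n. Y (Suc k) - Y k)" by (simp add: summable_iff_convergent)
  moreover have "(\<Sum>k<n. Y (Suc k) - Y k) = Y n - Y 0" for n by (rule sum_lessThan_telescope)
  ultimately obtain l where "(\<lambda>n. Y n - Y 0) \<longlonglongrightarrow> l" by (auto simp: convergent_def)
  from tendsto_add[OF this tendsto_const[of "Y 0"]] obtain Z where Z: "Y \<longlonglongrightarrow> Z" by auto
  have Zb: "Z \<in> bounded_operators"
    by (rule closed_sequentially[OF closed_bounded_operators _ Z]) (use Y(1) in \<open>auto simp: P_def almost_derives_def\<close>)
  have "low R Z = 0" if R: "R \<in> N" for R
  proof -
    have "norm (low R Z) \<le> norm (Z - Y k) + c k" for k
    proof -
      have "low R Z = low R (Z - Y k) + low R (Y k)" by (simp add: low_diff)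
      hence "norm (low R Z) \<le> norm (low R (Z - Y k)) + norm (low R (Y k))" by (metis norm_triangle_ineq)
      thus ?thesis using norm_low[OF cl[OF R], of "Z - Y k"] Y(1)[of k] R by (fastforce simp: P_def)
    qed
    moreover have "(\<lambda>k. norm (Z - Y k) + c k) \<longlonglongrightarrow> norm (Z - Z) + 0"
      by (intro tendsto_intros Z c_lim)
    ultimately have "norm (low R Z) \<le> norm (Z - Z) + 0" by (intro LIMSEQ_le_const) auto
    thus ?thesis by simp
  qed
  hence "Z \<in> nest_algebra N"
    using Zb low_zero_iff[OF cl, of _ Z] by (intro nest_algebraI) blast+
  moreover have "X - Z \<in> compact_operators"
  proof (rule compact_operators_limit)
    show "X - Z \<in> bounded_operators" using Zb X by (simp add: almost_derives_def)
    fix e :: real assume "e > 0"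
    then obtain k where "dist (Y k) Z < e"
      using Z unfolding lim_sequentially by blast
    hence "norm ((X - Z) - (X - Y k)) < e" by (simp add: dist_norm)
    moreover have "X - Y k \<in> compact_operators" using Y(1)[of k] by (simp add: P_def)
    ultimately show "\<exists>S\<in>compact_operators. norm (X - Z - S) < e" by blast
  qed
  moreover have "X = Z + (X - Z)" by simp
  ultimately show ?thesis unfolding quasitriangular_algebra_def by blast
qed

text \<open>For a limit \<open>X\<close> of members of the algebra, the commutators with the nest
  algebra are limits of members too, so \<open>X\<close> satisfies
  \<open>almost_derives\<close>.\<close>

corollary closed_quasitriangular_algebra:
  assumes N: "nest N" shows "closed (quasitriangular_algebra N)"
proof -
  have "X \<in> quasitriangular_algebra N" if X: "X \<in> closure (quasitriangular_algebra N)" for X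
  proof (rule almost_derives_quasitriangular[OF N], unfold almost_derives_def, intro conjI ballI)
    let ?Q = "quasitriangular_algebra N"
    have "closure ?Q \<subseteq> bounded_operators"
      by (intro closure_minimal closed_bounded_operators subsetI quasitriangular_closed_under(1)[OF N])
    thus "X \<in> bounded_operators" using X by blast
    fix T assume T: "T \<in> nest_algebra N"
    hence TQ: "T \<in> ?Q" using nest_algebra_subset_quasitriangular by blast
    obtain f where f: "\<And>n::nat. f n \<in> ?Q" "f \<longlonglongrightarrow> X" using X by (auto simp: closure_sequential)
    have "(\<lambda>n. (f n o\<^sub>L T) - (T o\<^sub>L f n)) \<longlonglongrightarrow> (X o\<^sub>L T) - (T o\<^sub>L X)"
      by (intro tendsto_diff bounded_bilinear.tendsto[OF bounded_bilinear_blinfun_compose] f tendsto_const)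
    moreover have "(f n o\<^sub>L T) - (T o\<^sub>L f n) \<in> ?Q" for n
    proof -
      have "(f n o\<^sub>L T) - (T o\<^sub>L f n) = (f n o\<^sub>L T) + blinfun_scaleC (-1) (T o\<^sub>L f n)"
        by (rule blinfun_eqI) (simp add: blinfun.diff_left blinfun.add_left)
      thus ?thesis using quasitriangular_closed_under(2-4)[OF N] f(1) TQ by metis
    qed
    ultimately show "(X o\<^sub>L T) - (T o\<^sub>L X) \<in> closure ?Q"
      unfolding closure_sequential
      by (intro exI[of _ "\<lambda>n. (f n o\<^sub>L T) - (T o\<^sub>L f n)"]) simp
  qed
  hence "closure (quasitriangular_algebra N) = quasitriangular_algebra N" using closure_subset by blast
  thus ?thesis by (simp add: closure_eq)
qed

section \<open>Generators of uniformly continuous flows\<close>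

text \<open>Automorphisms are linear and bounded on \<open>B\<close> only. So the exchange with the
  integral is carried out on Riemann sums, which stay in \<open>B\<close>.\<close>

lemma has_integral_linear_on:
  fixes f :: "real \<Rightarrow> 'b::real_normed_vector" and \<phi> :: "'b \<Rightarrow> 'b"
  assumes B: "closed B" "0 \<in> B" "\<And>x y. x \<in> B \<Longrightarrow> y \<in> B \<Longrightarrow> x + y \<in> B" "\<And>r x. x \<in> B \<Longrightarrow> r *\<^sub>R x \<in> B"
    and \<phi>: "\<And>x y. x \<in> B \<Longrightarrow> y \<in> B \<Longrightarrow> \<phi> (x + y) = \<phi> x + \<phi> y" "\<And>r x. x \<in> B \<Longrightarrow> \<phi> (r *\<^sub>R x) = r *\<^sub>R \<phi> x"
      "\<And>x. x \<in> B \<Longrightarrow> norm (\<phi> x) \<le> K * norm x"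
    and f: "(f has_integral I) {a..b}" "\<And>x. x \<in> {a..b} \<Longrightarrow> f x \<in> B"
  shows "I \<in> B" "((\<lambda>x. \<phi> (f x)) has_integral \<phi> I) {a..b}"
proof -
  have sum: "sum g A \<in> B \<and> \<phi> (sum g A) = (\<Sum>p\<in>A. \<phi> (g p))" if "finite A" "\<And>p. p \<in> A \<Longrightarrow> g p \<in> B" for g A
    using that
  proof (induction A)
    case empty
    have "\<phi> 0 = 0" using \<phi>(1)[OF B(2,2)] by simp
    thus ?case using B by simp
  qed (use B \<phi> in auto)
  have riemann: "(\<Sum>(x, k)\<in>D. measure lborel k *\<^sub>R f x) \<in> B \<and>
      \<phi> (\<Sum>(x, k)\<in>D. measure lborel k *\<^sub>R f x) = (\<Sum>(x, k)\<in>D. measure lborel k *\<^sub>R \<phi> (f x))"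
    if D: "D tagged_division_of {a..b}" for D
  proof -
    have m: "f x \<in> B" if "(x, k) \<in> D" for x k
      using f(2) tagged_division_ofD(2,3)[OF D that] by blast
    have "(\<Sum>p\<in>D. \<phi> (case p of (x, k) \<Rightarrow> measure lborel k *\<^sub>R f x)) = (\<Sum>(x, k)\<in>D. measure lborel k *\<^sub>R \<phi> (f x))"
      by (intro sum.cong refl) (auto simp: \<phi>(2) m)
    thus ?thesis
      using sum[OF tagged_division_ofD(1)[OF D], of "\<lambda>(x,k). measure lborel k *\<^sub>R f x"] m B(4) by auto
  qed
  have int: "\<exists>\<gamma>. gauge \<gamma> \<and> (\<forall>D. D tagged_division_of {a..b} \<and> \<gamma> fine D \<longrightarrow>
      norm ((\<Sum>(x, k)\<in>D. measure lborel k *\<^sub>R f x) - I) < e)" if "e > 0" for e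
    using f(1) that unfolding has_integral_real by simp
  have "I \<in> closure B"
    unfolding closure_approachable
  proof (intro allI impI)
    fix e :: real assume "e > 0"
    from int[OF this] obtain \<gamma> where \<gamma>: "gauge \<gamma>" "\<And>D. D tagged_division_of {a..b} \<Longrightarrow> \<gamma> fine D \<Longrightarrow>
      norm ((\<Sum>(x, k)\<in>D. measure lborel k *\<^sub>R f x) - I) < e" by auto
    obtain D where D: "D tagged_division_of {a..b}" "\<gamma> fine D" using fine_division_exists_real[OF \<gamma>(1)] .
    thus "\<exists>y\<in>B. dist y I < e" using riemann[OF D(1)] \<gamma>(2)[OF D] by (auto simp: dist_norm)
  qed
  thus I: "I \<in> B" using B(1) by simp
  show "((\<lambda>x. \<phi> (f x)) has_integral \<phi> I) {a..b}"
    unfolding has_integral_real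
  proof (intro allI impI)
    fix e :: real assume e: "e > 0"
    have K: "\<bar>K\<bar> + 1 > 0" by linarith
    hence "e / (\<bar>K\<bar> + 1) > 0" using e by simp
    from int[OF this] obtain \<gamma> where \<gamma>: "gauge \<gamma>" "\<And>D. D tagged_division_of {a..b} \<Longrightarrow> \<gamma> fine D \<Longrightarrow>
      norm ((\<Sum>(x, k)\<in>D. measure lborel k *\<^sub>R f x) - I) < e / (\<bar>K\<bar> + 1)" by auto
    have "norm ((\<Sum>(x, k)\<in>D. measure lborel k *\<^sub>R \<phi> (f x)) - \<phi> I) < e"
      if D: "D tagged_division_of {a..b}" "\<gamma> fine D" for D
    proof -
      define s where "s = (\<Sum>(x, k)\<in>D. measure lborel k *\<^sub>R f x)"
      have s: "s \<in> B" "\<phi> s = (\<Sum>(x, k)\<in>D. measure lborel k *\<^sub>R \<phi> (f x))"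
        using riemann[OF D(1)] by (auto simp: s_def)
      have mI: "(-1) *\<^sub>R I \<in> B" by (rule B(4)[OF I])
      have "\<phi> (s + (-1) *\<^sub>R I) = \<phi> s - \<phi> I" unfolding \<phi>(1)[OF s(1) mI] \<phi>(2)[OF I] by simp
      moreover have "s + (-1) *\<^sub>R I \<in> B" by (rule B(3)[OF s(1) mI])
      ultimately have "norm (\<phi> s - \<phi> I) \<le> K * norm (s - I)" using \<phi>(3)[of "s + (-1) *\<^sub>R I"] by simp
      also have "\<dots> \<le> (\<bar>K\<bar> + 1) * norm (s - I)" by (intro mult_right_mono) auto
      also have "\<dots> < e" using \<gamma>(2)[OF D] K by (simp add: s_def less_divide_eq mult.commute)
      finally show ?thesis by (simp add: s(2))
    qed
    thus "\<exists>\<gamma>. gauge \<gamma> \<and> (\<forall>D. D tagged_division_of {a..b} \<and> \<gamma> fine D \<longrightarrow>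
      norm ((\<Sum>(x, k)\<in>D. measure lborel k *\<^sub>R \<phi> (f x)) - \<phi> I) < e)" using \<gamma>(1) by blast
  qed
qed

section \<open>Differentiability of flows that are uniformly continuous at time 0\<close>

locale uniform_flow =
  fixes B :: "('a::chilbert_space \<Rightarrow>\<^sub>L 'a) set" and \<alpha> :: "real \<Rightarrow> ('a \<Rightarrow>\<^sub>L 'a) \<Rightarrow> ('a \<Rightarrow>\<^sub>L 'a)"
  assumes B_bounded: "T \<in> B \<Longrightarrow> T \<in> bounded_operators"
    and B_add: "S \<in> B \<Longrightarrow> T \<in> B \<Longrightarrow> S + T \<in> B"
    and B_scaleC: "T \<in> B \<Longrightarrow> blinfun_scaleC c T \<in> B"
    and B_compose: "S \<in> B \<Longrightarrow> T \<in> B \<Longrightarrow> S o\<^sub>L T \<in> B"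
    and B_id: "id_blinfun \<in> B"
    and B_closed: "closed B"
    and flow: "flow B \<alpha>"
    and uniform: "\<eta> > 0 \<Longrightarrow> \<exists>\<delta>>0. \<forall>t. \<bar>t\<bar> < \<delta> \<longrightarrow> (\<forall>T\<in>B. norm (\<alpha> t T - T) \<le> \<eta> * norm T)"
begin

lemma B_scaleR: "T \<in> B \<Longrightarrow> r *\<^sub>R T \<in> B"
  using B_scaleC[of T "of_real r"]
  by (metis (no_types, lifting) blinfun_eqI blinfun_scaleC_apply scaleR_blinfun.rep_eq scaleC_complex_of_real)

lemma B_zero: "0 \<in> B"
  using B_scaleR[OF B_id, of 0] by simp

lemma B_diff: "S \<in> B \<Longrightarrow> T \<in> B \<Longrightarrow> S - T \<in> B"
  using B_add[OF _ B_scaleR[of T "-1"], of S] by simp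

lemma automorphism: "bounded_automorphism B (\<alpha> t)"
  using flow by (simp add: flow_def)

lemma \<alpha>_in: "T \<in> B \<Longrightarrow> \<alpha> t T \<in> B"
  using automorphism[of t] by (auto simp: bounded_automorphism_def bij_betw_def)

lemma \<alpha>_add: "S \<in> B \<Longrightarrow> T \<in> B \<Longrightarrow> \<alpha> t (S + T) = \<alpha> t S + \<alpha> t T"
  and \<alpha>_scaleC: "T \<in> B \<Longrightarrow> \<alpha> t (blinfun_scaleC c T) = blinfun_scaleC c (\<alpha> t T)"
  and \<alpha>_compose: "S \<in> B \<Longrightarrow> T \<in> B \<Longrightarrow> \<alpha> t (S o\<^sub>L T) = \<alpha> t S o\<^sub>L \<alpha> t T"
  and \<alpha>_bound: "\<exists>K. \<forall>T\<in>B. norm (\<alpha> t T) \<le> K * norm T"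
  using automorphism[of t] by (simp_all add: bounded_automorphism_def)

lemma \<alpha>_scaleR: "T \<in> B \<Longrightarrow> \<alpha> t (r *\<^sub>R T) = r *\<^sub>R \<alpha> t T"
proof -
  have eq: "r *\<^sub>R T = blinfun_scaleC (of_real r) T" for T :: "'a \<Rightarrow>\<^sub>L 'a"
    by (rule blinfun_eqI) (simp add: blinfun.scaleR_left scaleC_complex_of_real)
  show "T \<in> B \<Longrightarrow> \<alpha> t (r *\<^sub>R T) = r *\<^sub>R \<alpha> t T" by (simp only: eq \<alpha>_scaleC)
qed

lemma \<alpha>_plus: "T \<in> B \<Longrightarrow> \<alpha> (s + t) T = \<alpha> s (\<alpha> t T)"
  using flow by (simp add: flow_def)

text \<open>By the group law \<open>\<alpha> 0\<close> is idempotent, and it is injective on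
  \<open>B\<close>.\<close>

lemma \<alpha>_zero: assumes "T \<in> B" shows "\<alpha> 0 T = T"
proof -
  have "\<alpha> 0 (\<alpha> 0 T) = \<alpha> 0 T" using \<alpha>_plus[OF assms, of 0 0] by simp
  moreover have "inj_on (\<alpha> 0) B" using automorphism[of 0] by (simp add: bounded_automorphism_def bij_betw_def)
  ultimately show ?thesis using assms \<alpha>_in by (meson inj_onD)
qed

lemma \<alpha>_continuous: assumes "T \<in> B" shows "continuous_on S (\<lambda>t. \<alpha> t T)"
proof -
  have "((\<lambda>t. \<alpha> t T) \<longlongrightarrow> \<alpha> t0 T) (at t0)" for t0
    by (rule LIM_zero_cancel[OF tendsto_norm_zero_cancel]) (use flow assms in \<open>simp add: flow_def\<close>)
  hence "continuous_on UNIV (\<lambda>t. \<alpha> t T)" by (simp add: continuous_on_def)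
  thus ?thesis by (rule continuous_on_subset) simp
qed

lemma has_integral_\<alpha>: "T \<in> B \<Longrightarrow> ((\<lambda>s. \<alpha> s T) has_integral integral {a..b} (\<lambda>s. \<alpha> s T)) {a..b}"
  by (intro integrable_integral integrable_continuous_real \<alpha>_continuous)

lemma integral_\<alpha>:
  assumes T: "T \<in> B"
  shows "integral {a..b} (\<lambda>s. \<alpha> s T) \<in> B"
    and "\<alpha> t (integral {a..b} (\<lambda>s. \<alpha> s T)) = integral {a+t..b+t} (\<lambda>s. \<alpha> s T)"
proof -
  obtain K where K: "\<And>S. S \<in> B \<Longrightarrow> norm (\<alpha> t S) \<le> K * norm S" using \<alpha>_bound[of t] by auto
  note lin = has_integral_linear_on[OF B_closed B_zero B_add B_scaleR \<alpha>_add \<alpha>_scaleR K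
      has_integral_\<alpha>[OF T] \<alpha>_in[OF T], simplified]
  show "integral {a..b} (\<lambda>s. \<alpha> s T) \<in> B" by (rule lin(1))
  have "(((\<lambda>s. \<alpha> s T) \<circ> ((+) t)) has_integral \<alpha> t (integral {a..b} (\<lambda>s. \<alpha> s T))) {a..b}"
    using lin(2) by (simp add: comp_def \<alpha>_plus[OF T])
  hence "((\<lambda>s. \<alpha> s T) has_integral \<alpha> t (integral {a..b} (\<lambda>s. \<alpha> s T))) {a+t..b+t}"
    by (simp only: has_integral_shift_Icc_real)
  thus "\<alpha> t (integral {a..b} (\<lambda>s. \<alpha> s T)) = integral {a+t..b+t} (\<lambda>s. \<alpha> s T)"
    by (rule integral_unique[symmetric])
qed

text \<open>For small \<open>h\<close> the mean \<open>J T = h\<inverse> \<integral>\<^sub>0\<^sup>h \<alpha>\<^sub>s T ds\<close> is close to \<open>T\<close>, so \<open>J\<close> maps \<open>B\<close> onto \<open>B\<close>; and the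
  orbit of \<open>J T\<close> is differentiable by the fundamental theorem of calculus.\<close>

lemma \<alpha>_differentiable:
  "\<exists>C. \<forall>S\<in>B. \<exists>D\<in>B. norm D \<le> C * norm S \<and> ((\<lambda>t. \<alpha> t S) has_vector_derivative D) (at 0)"
proof -
  obtain \<delta> where \<delta>: "\<delta> > 0" "\<And>t T. \<bar>t\<bar> < \<delta> \<Longrightarrow> T \<in> B \<Longrightarrow> norm (\<alpha> t T - T) \<le> 1/2 * norm T"
    using uniform[of "1/2"] by auto
  define h where "h = min (1/2) (\<delta>/2)"
  have h: "h > 0" "h < \<delta>" "h \<le> 1/2" using \<delta>(1) by (auto simp: h_def)
  define J where "J T = (1/h) *\<^sub>R integral {0..h} (\<lambda>s. \<alpha> s T)" for T
  have JB: "J T \<in> B" if "T \<in> B" for T unfolding J_def by (intro B_scaleR integral_\<alpha> that)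
  have near: "norm (T - J T) \<le> 1/2 * norm T" if T: "T \<in> B" for T
  proof -
    have "((\<lambda>s. T - \<alpha> s T) has_integral (measure lborel {0..h} *\<^sub>R T - integral {0..h} (\<lambda>s. \<alpha> s T))) (cbox 0 h)"
      using has_integral_diff[OF has_integral_const_real has_integral_\<alpha>[OF T], of T 0 h] by simp
    hence "norm (measure lborel {0..h} *\<^sub>R T - integral {0..h} (\<lambda>s. \<alpha> s T)) \<le> (1/2 * norm T) * measure lborel (cbox 0 h)"
    proof (rule has_integral_bound[rotated])
      fix s assume "s \<in> cbox 0 h"
      hence "\<bar>s\<bar> < \<delta>" using h by auto
      thus "norm (T - \<alpha> s T) \<le> 1/2 * norm T" using \<delta>(2)[OF _ T, of s] by (simp add: norm_minus_commute)
    qed simp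
    moreover have "T - J T = (1/h) *\<^sub>R (measure lborel {0..h} *\<^sub>R T - integral {0..h} (\<lambda>s. \<alpha> s T))"
      using h by (simp add: J_def scaleR_diff_right)
    ultimately show ?thesis using h by (simp add: divide_le_eq)
  qed
  have Jdiff: "J (S - T) = J S - J T" if "S \<in> B" "T \<in> B" for S T
  proof -
    have "\<alpha> s (S - T) = \<alpha> s S - \<alpha> s T" for s
      using \<alpha>_add[OF that(1) B_scaleR[OF that(2), of "-1"], of s] \<alpha>_scaleR[OF that(2), of s "-1"] by simp
    thus ?thesis
      unfolding J_def scaleR_diff_right[symmetric]
      using integral_diff[OF has_integral_integrable[OF has_integral_\<alpha>[OF that(1)]]
          has_integral_integrable[OF has_integral_\<alpha>[OF that(2)]], of 0 h] by simp
  qed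
  have onto: "\<exists>T\<in>B. J T = S" if S: "S \<in> B" for S
  proof -
    \<comment> \<open>A fixed point of this map solves \<open>J T = S\<close>, and
      \<open>near\<close> makes it a contraction with factor 1/2.\<close>
    have "\<exists>!T\<in>B. S + (T - J T) = T"
    proof (rule Banach_fix)
      show "complete B" by (simp add: complete_eq_closed B_closed)
      show "B \<noteq> {}" using S by blast
      show "(\<lambda>T. S + (T - J T)) ` B \<subseteq> B" using S JB by (auto intro: B_add B_diff)
      show "dist (S + (T - J T)) (S + (T' - J T')) \<le> 1/2 * dist T T'" if "T \<in> B" "T' \<in> B" for T T'
        using near[OF B_diff[OF that]] by (simp add: dist_norm Jdiff that algebra_simps)
    qed auto
    then obtain T where T: "T \<in> B" "S + (T - J T) = T" by blast
    hence "S - J T = 0" by (simp add: algebra_simps)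
    thus ?thesis using T(1) by auto
  qed
  have "\<exists>D\<in>B. norm D \<le> (1/h) * norm S \<and> ((\<lambda>t. \<alpha> t S) has_vector_derivative D) (at 0)" if S: "S \<in> B" for S
  proof -
    obtain T where T: "T \<in> B" "J T = S" using onto[OF S] by blast
    \<comment> \<open>The lower limit -1 and the bound 1/2 on \<open>h\<close> leave room on both
      sides: for \<open>t\<close> between -1 and 1, the points \<open>t\<close> and
      \<open>h + t\<close> stay in the interval from -1 to 2 on which \<open>F\<close> is
      differentiated.\<close>
    define F where "F u = integral {-1..u} (\<lambda>s. \<alpha> s T)" for u
    have dF: "(F has_vector_derivative \<alpha> t T) (at t)" if "-1 < t" "t < 2" for t
    proof -
      have "((\<lambda>u. integral {-1..u} (\<lambda>s. \<alpha> s T)) has_vector_derivative \<alpha> t T) (at t within {-1..2})"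
        using that by (intro integral_has_vector_derivative \<alpha>_continuous T) auto
      moreover have "at t within {-1..2} = at t" using that by (intro at_within_interior) auto
      ultimately show ?thesis by (simp add: F_def[abs_def])
    qed
    have eq: "\<alpha> t S = (1/h) *\<^sub>R (F (h + t) - F t)" if "-1 < t" "t < 1" for t
    proof -
      have "integral {-1..t} (\<lambda>s. \<alpha> s T) + integral {t..h+t} (\<lambda>s. \<alpha> s T) = integral {-1..h+t} (\<lambda>s. \<alpha> s T)"
        using that h by (intro Henstock_Kurzweil_Integration.integral_combine integrable_continuous_real \<alpha>_continuous T) auto
      hence "integral {t..h+t} (\<lambda>s. \<alpha> s T) = F (h + t) - F t" by (simp add: F_def algebra_simps)
      moreover have "\<alpha> t S = (1/h) *\<^sub>R \<alpha> t (integral {0..h} (\<lambda>s. \<alpha> s T))"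
        unfolding T(2)[symmetric] J_def by (rule \<alpha>_scaleR[OF integral_\<alpha>(1)[OF T(1)]])
      ultimately show ?thesis by (simp add: integral_\<alpha>(2)[OF T(1)])
    qed
    have "((\<lambda>t. h + t) has_vector_derivative 1) (at 0)"
      by (auto intro!: derivative_eq_intros simp: has_vector_derivative_def)
    moreover have "(F has_vector_derivative \<alpha> h T) (at (h + 0))" using dF[of h] h by simp
    ultimately have "((F \<circ> (\<lambda>t. h + t)) has_vector_derivative (1 *\<^sub>R \<alpha> h T)) (at 0)"
      by (rule vector_diff_chain_at)
    hence "((\<lambda>t. F (h + t)) has_vector_derivative \<alpha> h T) (at 0)" by (simp add: comp_def)
    from has_vector_derivative_diff[OF this dF[of 0]]
    have "((\<lambda>t. F (h + t) - F t) has_vector_derivative (\<alpha> h T - T)) (at 0)"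
      by (simp add: \<alpha>_zero T)
    from has_vector_derivative_scaleR[OF _ this, of "\<lambda>_. 1/h" 0]
    have "((\<lambda>t. (1/h) *\<^sub>R (F (h + t) - F t)) has_vector_derivative (1/h) *\<^sub>R (\<alpha> h T - T)) (at 0)" by simp
    hence "((\<lambda>t. \<alpha> t S) has_vector_derivative (1/h) *\<^sub>R (\<alpha> h T - T)) (at 0)"
      by (rule has_vector_derivative_transform_within_open[where S = "{-1<..<1}"]) (auto simp: eq)
    moreover have "norm T \<le> 2 * norm S"
      using near[OF T(1)] norm_triangle_ineq[of "J T" "T - J T"] by (simp add: T(2))
    hence "norm ((1/h) *\<^sub>R (\<alpha> h T - T)) \<le> (1/h) * norm S"
      using \<delta>(2)[of h, OF _ T(1)] h by (simp add: divide_right_mono)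
    moreover have "(1/h) *\<^sub>R (\<alpha> h T - T) \<in> B" by (intro B_scaleR B_diff \<alpha>_in T)
    ultimately show ?thesis by blast
  qed
  thus ?thesis by blast
qed

definition \<delta> :: "('a \<Rightarrow>\<^sub>L 'a) \<Rightarrow> ('a \<Rightarrow>\<^sub>L 'a)"
  where "\<delta> S = vector_derivative (\<lambda>t. \<alpha> t S) (at 0)"

lemma \<delta>_props:
  assumes "S \<in> B"
  shows \<delta>_in: "\<delta> S \<in> B" and has_derivative_zero: "((\<lambda>t. \<alpha> t S) has_vector_derivative \<delta> S) (at 0)"
proof -
  obtain D where "D \<in> B" "((\<lambda>t. \<alpha> t S) has_vector_derivative D) (at 0)"
    using \<alpha>_differentiable assms by blast
  thus "\<delta> S \<in> B" "((\<lambda>t. \<alpha> t S) has_vector_derivative \<delta> S) (at 0)"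
    by (simp_all add: \<delta>_def vector_derivative_at)
qed

lemma \<delta>_eqI: "S \<in> B \<Longrightarrow> ((\<lambda>t. \<alpha> t S) has_vector_derivative D) (at 0) \<Longrightarrow> \<delta> S = D"
  by (simp add: \<delta>_def vector_derivative_at)

lemma \<delta>_bound: "\<exists>C. \<forall>S\<in>B. norm (\<delta> S) \<le> C * norm S"
proof -
  obtain C where "\<forall>S\<in>B. \<exists>D\<in>B. norm D \<le> C * norm S \<and> ((\<lambda>t. \<alpha> t S) has_vector_derivative D) (at 0)"
    using \<alpha>_differentiable by blast
  thus ?thesis using \<delta>_eqI by (intro exI[of _ C]) metis
qed

lemma \<delta>_add: "S \<in> B \<Longrightarrow> T \<in> B \<Longrightarrow> \<delta> (S + T) = \<delta> S + \<delta> T"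
  by (intro \<delta>_eqI B_add) (simp_all add: \<alpha>_add has_vector_derivative_add has_derivative_zero)

lemma bounded_linear_blinfun_scaleC: "bounded_linear (blinfun_scaleC c :: ('a \<Rightarrow>\<^sub>L 'a) \<Rightarrow> _)"
proof (rule bounded_linear_intro[where K = "cmod c"])
  show "blinfun_scaleC c (S + T) = blinfun_scaleC c S + blinfun_scaleC c T" for S T :: "'a \<Rightarrow>\<^sub>L 'a"
    by (rule blinfun_eqI) (simp add: blinfun.add_left scaleC_add_right)
  show "blinfun_scaleC c (r *\<^sub>R T) = r *\<^sub>R blinfun_scaleC c T" for r and T :: "'a \<Rightarrow>\<^sub>L 'a"
    by (rule blinfun_eqI) (simp add: blinfun.scaleR_left scaleC_scaleR_commute)
qed (simp add: norm_blinfun_scaleC)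

lemma \<delta>_scaleC: "S \<in> B \<Longrightarrow> \<delta> (blinfun_scaleC c S) = blinfun_scaleC c (\<delta> S)"
  by (intro \<delta>_eqI B_scaleC)
     (simp_all add: \<alpha>_scaleC bounded_linear.has_vector_derivative[OF bounded_linear_blinfun_scaleC] has_derivative_zero)

lemma \<delta>_compose:
  assumes "S \<in> B" "T \<in> B"
  shows "\<delta> (S o\<^sub>L T) = (S o\<^sub>L \<delta> T) + (\<delta> S o\<^sub>L T)"
proof (rule \<delta>_eqI[OF B_compose[OF assms]])
  have "((\<lambda>t. \<alpha> t S o\<^sub>L \<alpha> t T) has_vector_derivative ((\<alpha> 0 S o\<^sub>L \<delta> T) + (\<delta> S o\<^sub>L \<alpha> 0 T))) (at 0)"
    by (rule bounded_bilinear.has_vector_derivative[OF bounded_bilinear_blinfun_compose])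
       (rule has_derivative_zero assms)+
  thus "((\<lambda>t. \<alpha> t (S o\<^sub>L T)) has_vector_derivative ((S o\<^sub>L \<delta> T) + (\<delta> S o\<^sub>L T))) (at 0)"
    using assms by (simp add: \<alpha>_compose \<alpha>_zero)
qed

lemma \<alpha>_has_derivative:
  assumes "S \<in> B"
  shows "((\<lambda>t. \<alpha> t S) has_vector_derivative \<delta> (\<alpha> t S)) (at t)"
proof -
  have "((\<lambda>u. u - t) has_vector_derivative 1) (at t)"
    by (auto intro!: derivative_eq_intros simp: has_vector_derivative_def)
  moreover have "((\<lambda>r. \<alpha> r (\<alpha> t S)) has_vector_derivative \<delta> (\<alpha> t S)) (at (t - t))"
    using has_derivative_zero[OF \<alpha>_in[OF assms]] by simp
  ultimately have "(((\<lambda>r. \<alpha> r (\<alpha> t S)) \<circ> (\<lambda>u. u - t)) has_vector_derivative (1 *\<^sub>R \<delta> (\<alpha> t S))) (at t)"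
    by (rule vector_diff_chain_at)
  thus ?thesis by (simp add: comp_def \<alpha>_plus[OF assms, symmetric])
qed

end

section \<open>Derivations are inner\<close>

text \<open>For a derivation, \<open>X x = \<delta> (rank1 x f) f\<close> satisfies \<open>\<delta> T = X T - T X\<close> wherever \<open>rank1 x f\<close> lies in
  the algebra.\<close>

locale derivation =
  fixes B :: "('a::chilbert_space \<Rightarrow>\<^sub>L 'a) set" and \<delta> :: "('a \<Rightarrow>\<^sub>L 'a) \<Rightarrow> ('a \<Rightarrow>\<^sub>L 'a)" and C :: real
  assumes B_bounded: "T \<in> B \<Longrightarrow> T \<in> bounded_operators"
    and \<delta>_add: "S \<in> B \<Longrightarrow> T \<in> B \<Longrightarrow> \<delta> (S + T) = \<delta> S + \<delta> T"
    and \<delta>_scaleC: "T \<in> B \<Longrightarrow> \<delta> (blinfun_scaleC c T) = blinfun_scaleC c (\<delta> T)"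
    and \<delta>_compose: "S \<in> B \<Longrightarrow> T \<in> B \<Longrightarrow> \<delta> (S o\<^sub>L T) = (S o\<^sub>L \<delta> T) + (\<delta> S o\<^sub>L T)"
    and \<delta>_bound: "T \<in> B \<Longrightarrow> norm (\<delta> T) \<le> C * norm T"
begin

text \<open>The product rule for \<open>T o\<^sub>L rank1 x f = rank1 (T x) f\<close>, evaluated at
  the unit vector \<open>f\<close>.\<close>

lemma implement:
  assumes f: "norm f = 1" and r: "rank1 x f \<in> B" and T: "T \<in> B"
  shows "\<delta> (rank1 (T x) f) f = \<delta> T x + T (\<delta> (rank1 x f) f)"
proof -
  have "\<delta> (rank1 (T x) f) = (T o\<^sub>L \<delta> (rank1 x f)) + (\<delta> T o\<^sub>L rank1 x f)"
    using \<delta>_compose[OF T r] by (simp add: compose_rank1 B_bounded T)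
  thus ?thesis by (simp add: blinfun.add_left cinner_self f)
qed

lemma norm_implement_le:
  assumes f: "norm f = 1" and r: "rank1 x f \<in> B"
  shows "norm (\<delta> (rank1 x f) f) \<le> C * norm x"
  using norm_blinfun[of "\<delta> (rank1 x f)" f] \<delta>_bound[OF r] by (simp add: f norm_rank1)

lemma inner_global:
  assumes f: "norm f = 1" and r: "\<And>x. rank1 x f \<in> B"
  shows "\<exists>X\<in>bounded_operators. \<forall>T\<in>B. \<delta> T = (X o\<^sub>L T) - (T o\<^sub>L X)"
proof -
  define g where "g x = \<delta> (rank1 x f) f" for x
  have gs: "g (c *\<^sub>C x) = c *\<^sub>C g x" for c x by (simp add: g_def rank1_scaleC_left \<delta>_scaleC r)
  have "bounded_linear g"
  proof (rule bounded_linear_intro[where K = C])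
    show "g (x + y) = g x + g y" for x y by (simp add: g_def rank1_add_left \<delta>_add r blinfun.add_left)
    show "g (s *\<^sub>R x) = s *\<^sub>R g x" for s x using gs[of "of_real s" x] by (simp add: scaleC_complex_of_real)
    show "norm (g x) \<le> norm x * C" for x
      using norm_implement_le[OF f r, of x] by (simp add: g_def mult.commute)
  qed
  hence app: "Blinfun g x = g x" for x by (simp add: bounded_linear_Blinfun_apply)
  have "\<delta> T = (Blinfun g o\<^sub>L T) - (T o\<^sub>L Blinfun g)" if "T \<in> B" for T
    using implement[OF f r that]
    by (intro blinfun_eqI) (simp add: app blinfun.diff_left g_def)
  moreover have "Blinfun g \<in> bounded_operators" by (rule bounded_operatorsI) (simp add: app gs)
  ultimately show ?thesis by blast
qed

lemma extend_to_closure: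
  fixes D :: "'a set" and g :: "'a \<Rightarrow> 'a"
  assumes D: "csubspace D" "closure D = UNIV"
    and g: "\<And>x y. x \<in> D \<Longrightarrow> y \<in> D \<Longrightarrow> g (x + y) = g x + g y" "\<And>c x. x \<in> D \<Longrightarrow> g (c *\<^sub>C x) = c *\<^sub>C g x"
      "\<And>x. x \<in> D \<Longrightarrow> norm (g x) \<le> K * norm x"
  shows "\<exists>X\<in>bounded_operators. \<forall>x\<in>D. blinfun_apply X x = g x"
proof -
  have gd: "g x - g y = g (x - y)" if "x \<in> D" "y \<in> D" for x y
    using g(1)[OF that(1) csubspace_scaleC[OF D(1) that(2), of "-1"]] g(2)[OF that(2), of "-1"]
    by simp
  have "uniformly_continuous_on D g"
    unfolding uniformly_continuous_on_def
  proof (intro allI impI)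
    fix e :: real assume e: "e > 0"
    have K: "\<bar>K\<bar> + 1 > 0" by linarith
    have "dist (g y) (g x) < e" if "x \<in> D" "y \<in> D" "dist y x < e / (\<bar>K\<bar> + 1)" for x y
    proof -
      have "dist (g y) (g x) \<le> K * dist y x"
        unfolding dist_norm gd[OF that(2,1)] by (rule g(3)[OF csubspace_diff[OF D(1) that(2,1)]])
      also have "\<dots> \<le> (\<bar>K\<bar> + 1) * dist y x" by (intro mult_right_mono) auto
      also have "\<dots> < e" using that(3) K by (simp add: less_divide_eq mult.commute)
      finally show ?thesis .
    qed
    thus "\<exists>d>0. \<forall>x\<in>D. \<forall>y\<in>D. dist y x < d \<longrightarrow> dist (g y) (g x) < e"
      using e K by (intro exI[of _ "e / (\<bar>K\<bar> + 1)"]) simp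
  qed
  then obtain G where G: "uniformly_continuous_on (closure D) G" "\<And>x. x \<in> D \<Longrightarrow> g x = G x"
    using uniformly_continuous_on_extension_on_closure by metis
  have cG: "continuous_on UNIV G" using uniformly_continuous_imp_continuous[OF G(1)] D(2) by simp
  have lim: "(\<lambda>n. G (s n)) \<longlonglongrightarrow> G x" if "s \<longlonglongrightarrow> x" for s :: "nat \<Rightarrow> 'a" and x
    using continuous_on_tendsto_compose[OF cG that] by simp
  have seq: "\<exists>s::nat \<Rightarrow> 'a. (\<forall>n. s n \<in> D) \<and> s \<longlonglongrightarrow> x" for x
    using D(2) closure_sequential[of x D] by simp
  have Gs: "G (c *\<^sub>C x) = c *\<^sub>C G x" for c x
  proof -
    obtain s where s: "\<And>n. s n \<in> D" "s \<longlonglongrightarrow> x" using seq by blast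
    have "(\<lambda>n. G (c *\<^sub>C s n)) \<longlonglongrightarrow> G (c *\<^sub>C x)" by (intro lim tendsto_intros s)
    moreover have "(\<lambda>n. c *\<^sub>C G (s n)) \<longlonglongrightarrow> c *\<^sub>C G x" by (intro lim tendsto_intros s)
    moreover have "G (c *\<^sub>C s n) = c *\<^sub>C G (s n)" for n
      using g(2)[OF s(1)] G(2)[OF s(1)] G(2)[OF csubspace_scaleC[OF D(1) s(1)]] by simp
    ultimately show ?thesis using LIMSEQ_unique by auto
  qed
  have Ga: "G (x + y) = G x + G y" for x y
  proof -
    obtain s where s: "\<And>n. s n \<in> D" "s \<longlonglongrightarrow> x" using seq by blast
    obtain r where r: "\<And>n. r n \<in> D" "r \<longlonglongrightarrow> y" using seq by blast
    have "(\<lambda>n. G (s n + r n)) \<longlonglongrightarrow> G (x + y)" by (intro lim tendsto_intros s r)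
    moreover have "(\<lambda>n. G (s n) + G (r n)) \<longlonglongrightarrow> G x + G y" by (intro lim tendsto_intros s r)
    moreover have "G (s n + r n) = G (s n) + G (r n)" for n
      using g(1)[OF s(1) r(1)] G(2)[OF s(1)] G(2)[OF r(1)] G(2)[OF csubspace_add[OF D(1) s(1) r(1)]] by simp
    ultimately show ?thesis using LIMSEQ_unique by auto
  qed
  have Gn: "norm (G x) \<le> norm x * K" for x
  proof -
    obtain s where s: "\<And>n. s n \<in> D" "s \<longlonglongrightarrow> x" using seq by blast
    have "(\<lambda>n. norm (G (s n))) \<longlonglongrightarrow> norm (G x)" by (intro lim tendsto_intros s)
    moreover have "(\<lambda>n. norm (s n) * K) \<longlonglongrightarrow> norm x * K" by (intro tendsto_intros s)
    moreover have "norm (G (s n)) \<le> norm (s n) * K" for n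
      using g(3)[OF s(1), of n] G(2)[OF s(1)] by (simp add: mult.commute)
    ultimately show ?thesis by (intro LIMSEQ_le) auto
  qed
  have "bounded_linear G"
  proof (rule bounded_linear_intro[OF Ga _ Gn])
    show "G (s *\<^sub>R x) = s *\<^sub>R G x" for s x using Gs[of "of_real s" x] by (simp add: scaleC_complex_of_real)
  qed
  hence app: "Blinfun G x = G x" for x by (simp add: bounded_linear_Blinfun_apply)
  show ?thesis
    by (intro bexI[of _ "Blinfun G"] bounded_operatorsI) (simp_all add: app Gs G(2))
qed

text \<open>Different choices of \<open>f\<close> change \<open>\<delta> (rank1 x f) f\<close> by a scalar multiple of \<open>x\<close>, which is
  eliminated by normalising at a fixed vector \<open>e0\<close>.\<close>

lemma inner_nest_algebra_limit:
  assumes N: "nest N" and BN: "B = nest_algebra N"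
    and dense: "\<Inter>{L \<in> ocomp ` N. L \<noteq> {0}} = {0}" and nz: "(UNIV :: 'a set) \<noteq> {0}"
  shows "\<exists>X\<in>bounded_operators. \<forall>T\<in>B. \<delta> T = (X o\<^sub>L T) - (T o\<^sub>L X)"
proof -
  note cl = nest_closed_csubspace[OF N]
  define P where "P = {M\<in>N. ocomp M \<noteq> {0}}"
  have PN: "P \<subseteq> N" by (auto simp: P_def)
  have inP: "M \<in> P \<Longrightarrow> M \<in> N" for M using PN by blast
  \<comment> \<open>The nonzero complements meet in zero, so each of them contains a strictly
    smaller one.\<close>
  have bigger: "\<exists>M'\<in>P. M \<subset> M'" if M: "M \<in> P" for M
  proof -
    have "ocomp M \<in> ocomp ` N" "ocomp M \<noteq> {0}" using M by (auto simp: P_def)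
    from nest_descending[OF nest_ocomp[OF N] dense this] obtain L where
      L: "L 0 = ocomp M" "\<forall>n. L n \<in> ocomp ` N \<and> L n \<noteq> {0} \<and> L (Suc n) \<subset> L n" by (elim exE conjE)
    hence L1: "L 1 \<in> ocomp ` N" "L 1 \<noteq> {0}" "L 1 \<subset> ocomp M"
      using spec[OF L(2), of 0] spec[OF L(2), of 1] by auto
    then obtain M' where M': "M' \<in> N" "L 1 = ocomp M'" by blast
    have "\<not> M' \<subseteq> M" using ocomp_antimono[of M' M] L1(3) M'(2) by blast
    hence "M \<subset> M'" using nest_chain[OF N M'(1) inP[OF M]] by blast
    thus ?thesis using M' L1 by (auto simp: P_def)
  qed
  define D where "D = \<Union>P"
  have UD: "{0} \<in> P" using nest_zero[OF N] nz by (simp add: P_def)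
  have common: "\<exists>L\<in>P. x \<in> L \<and> y \<in> L" if "x \<in> D" "y \<in> D" for x y
  proof -
    obtain L M where LM: "L \<in> P" "x \<in> L" "M \<in> P" "y \<in> M" using \<open>x \<in> D\<close> \<open>y \<in> D\<close> by (auto simp: D_def)
    thus ?thesis using nest_chain[OF N inP[OF LM(1)] inP[OF LM(3)]] by blast
  qed
  have Dsub: "csubspace D"
  proof (rule csubspaceI)
    show "0 \<in> D" using UD by (auto simp: D_def)
    fix c x y assume x: "x \<in> D"
    then obtain L where L: "L \<in> P" "x \<in> L" by (auto simp: D_def)
    thus "c *\<^sub>C x \<in> D" using cl[OF inP[OF L(1)]] csubspace_scaleC[of L x c] by (auto simp: D_def closed_csubspace_def)
    assume "y \<in> D"
    from common[OF x this] obtain M where M: "M \<in> P" "x \<in> M" "y \<in> M" by blast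
    thus "x + y \<in> D" using cl[OF inP[OF M(1)]] csubspace_add[of M x y] by (auto simp: D_def closed_csubspace_def)
  qed
  have "ocomp D \<subseteq> {0}"
  proof
    fix x assume x: "x \<in> ocomp D"
    have "x \<in> L" if L: "L \<in> ocomp ` N" "L \<noteq> {0}" for L
    proof -
      obtain M where M: "M \<in> N" "L = ocomp M" using L by blast
      hence "M \<subseteq> D" using L by (auto simp: D_def P_def)
      thus ?thesis using subsetD[OF ocomp_antimono x] M(2) by blast
    qed
    thus "x \<in> {0}" using dense by blast
  qed
  hence Ddense: "closure D = UNIV" by (rule ocomp_trivial_dense[OF Dsub])
  have "D \<noteq> {0}"
  proof
    assume "D = {0}"
    thus False using Ddense nz by simp
  qed
  then obtain e0 where e0: "e0 \<in> D" "norm e0 = 1" using exists_unit[OF Dsub] by blast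
  define W where "W f x = \<delta> (rank1 x f) f" for f x
  \<comment> \<open>Admissible \<open>f\<close> for \<open>y\<close>. The strict inclusion of
    \<open>L\<close> in \<open>M\<close> leaves room for an auxiliary vector when two choices of
    \<open>f\<close> are compared.\<close>
  define adm where "adm f y \<longleftrightarrow> norm f = 1 \<and> (\<exists>L\<in>P. \<exists>M\<in>P. L \<subset> M \<and> y \<in> L \<and> e0 \<in> L \<and> f \<in> ocomp M)" for f y
  have adm2: "\<exists>f. adm f x \<and> adm f y" if x: "x \<in> D" and y: "y \<in> D" for x y
  proof -
    obtain L1 where L1: "L1 \<in> P" "x \<in> L1" "y \<in> L1" using common[OF x y] by blast
    obtain L2 where L2: "L2 \<in> P" "e0 \<in> L2" using e0(1) by (auto simp: D_def)
    have "\<exists>L\<in>P. L1 \<subseteq> L \<and> L2 \<subseteq> L" using nest_chain[OF N inP[OF L1(1)] inP[OF L2(1)]] L1 L2 by blast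
    then obtain L where L: "L \<in> P" "L1 \<subseteq> L" "L2 \<subseteq> L" by blast
    obtain M where M: "M \<in> P" "L \<subset> M" using bigger[OF L(1)] by blast
    have "csubspace (ocomp M)" using closed_csubspace_ocomp[of M] by (simp add: closed_csubspace_def)
    moreover have "ocomp M \<noteq> {0}" using M(1) by (simp add: P_def)
    ultimately obtain f where f: "f \<in> ocomp M" "norm f = 1" using exists_unit by blast
    have "adm f x" "adm f y" unfolding adm_def using f L M L1 L2 by blast+
    thus ?thesis by blast
  qed
  have admB: "rank1 y f \<in> B" if f: "adm f y" for f y
  proof -
    obtain L M where LM: "L \<in> P" "M \<in> P" "L \<subset> M" "y \<in> L" "f \<in> ocomp M" using f by (auto simp: adm_def)
    hence "y \<in> M" by blast
    thus ?thesis unfolding BN by (rule rank1_in_nest_algebra_at[OF N inP[OF LM(2)] _ LM(5)])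
  qed
  have adm_e0: "adm f e0" if "adm f y" for f y using that by (auto simp: adm_def)
  have adm_n: "norm f = 1" if "adm f y" for f y using that by (simp add: adm_def)
  have indep: "W f y - cinner (W f e0) e0 *\<^sub>C y = W g y - cinner (W g e0) e0 *\<^sub>C y"
    if f: "adm f y" and g: "adm g y" for f g y
  proof -
    obtain L1 M1 where 1: "L1 \<in> P" "M1 \<in> P" "L1 \<subset> M1" "y \<in> L1" "e0 \<in> L1" "f \<in> ocomp M1"
      using f by (auto simp: adm_def)
    obtain L2 M2 where 2: "L2 \<in> P" "M2 \<in> P" "L2 \<subset> M2" "y \<in> L2" "e0 \<in> L2" "g \<in> ocomp M2"
      using g by (auto simp: adm_def)
    define L M where "L = (if L1 \<subseteq> L2 then L1 else L2)" and "M = (if M1 \<subseteq> M2 then M1 else M2)"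
    have "M1 \<subseteq> M2 \<or> M2 \<subseteq> M1" "L1 \<subseteq> L2 \<or> L2 \<subseteq> L1"
      using nest_chain[OF N] inP 1 2 by blast+
    hence LM: "L \<in> P" "M \<in> P" "L \<subset> M" "y \<in> L" "e0 \<in> L" "M \<subseteq> M1" "M \<subseteq> M2"
      using 1 2 by (auto simp: L_def M_def split: if_splits)
    have sM: "csubspace M" using cl[OF inP[OF LM(2)]] by (simp add: closed_csubspace_def)
    \<comment> \<open>Lying in \<open>M\<close>, this \<open>e\<close> gives
      \<open>rank1 e f\<close> and \<open>rank1 e g\<close> in the algebra; being orthogonal to
      \<open>L\<close>, it gives \<open>rank1 z e\<close> for every \<open>z\<close> in
      \<open>L\<close>.\<close>
    obtain e where e: "e \<in> M" "e \<in> ocomp L" "norm e = 1"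
      using exists_unit_orthogonal[OF cl[OF inP[OF LM(1)]] sM LM(3)] by blast
    have fg: "f \<in> ocomp M" "g \<in> ocomp M"
      using subsetD[OF ocomp_antimono[OF LM(6)] 1(6)] subsetD[OF ocomp_antimono[OF LM(7)] 2(6)] .
    have rf: "rank1 e f \<in> B" "rank1 e g \<in> B"
      unfolding BN by (rule rank1_in_nest_algebra_at[OF N inP[OF LM(2)] e(1)] fg)+
    define s where "s = cinner (W f e - W g e) e"
    \<comment> \<open>In \<open>implement\<close> with \<open>rank1 z e\<close> for
      \<open>T\<close>, the term with \<delta> is the same for \<open>f\<close> and
      \<open>g\<close>. What remains is a multiple of \<open>z\<close> by a scalar independent of
      \<open>z\<close>.\<close>
    have scal: "W f z - W g z = s *\<^sub>C z" if z: "z \<in> L" for z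
    proof -
      have T: "rank1 z e \<in> B" unfolding BN by (rule rank1_in_nest_algebra_at[OF N inP[OF LM(1)] z e(2)])
      have ze: "rank1 z e e = z" by (simp add: cinner_self e)
      have "W f z = \<delta> (rank1 z e) e + rank1 z e (W f e)"
        using implement[OF adm_n[OF f] rf(1) T] unfolding ze W_def .
      moreover have "W g z = \<delta> (rank1 z e) e + rank1 z e (W g e)"
        using implement[OF adm_n[OF g] rf(2) T] unfolding ze W_def .
      ultimately show ?thesis by (simp add: s_def cinner_diff_left scaleC_diff_left)
    qed
    have "cinner (W f e0) e0 - cinner (W g e0) e0 = s"
      using scal[OF LM(5)] by (simp add: cinner_diff_left[symmetric] cinner_scaleC_left cinner_self e0)
    moreover have "W f y - W g y = s *\<^sub>C y" by (rule scal[OF LM(4)])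
    ultimately have "W f y - W g y = (cinner (W f e0) e0 - cinner (W g e0) e0) *\<^sub>C y" by simp
    thus ?thesis by (simp add: scaleC_diff_left algebra_simps)
  qed
  define g where "g y = (let f = SOME f. adm f y in W f y - cinner (W f e0) e0 *\<^sub>C y)" for y
  have g: "g y = W f y - cinner (W f e0) e0 *\<^sub>C y" if "adm f y" for f y
    unfolding g_def Let_def by (rule indep[OF someI[of "\<lambda>f. adm f y", OF that] that])
  have adm_add: "adm f (x + y)" if fx: "adm f x" and fy: "adm f y" for f x y
  proof -
    obtain L1 M1 where 1: "L1 \<in> P" "M1 \<in> P" "L1 \<subset> M1" "x \<in> L1" "e0 \<in> L1" "f \<in> ocomp M1"
      using fx by (auto simp: adm_def)
    obtain L2 M2 where 2: "L2 \<in> P" "M2 \<in> P" "L2 \<subset> M2" "y \<in> L2" "e0 \<in> L2" "f \<in> ocomp M2"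
      using fy by (auto simp: adm_def)
    have s: "csubspace L1" "csubspace L2"
      using cl[OF inP[OF 1(1)]] cl[OF inP[OF 2(1)]] by (simp_all add: closed_csubspace_def)
    from nest_chain[OF N inP[OF 1(1)] inP[OF 2(1)]] show ?thesis
    proof
      assume "L1 \<subseteq> L2"
      hence "x + y \<in> L2" using csubspace_add[OF s(2) _ 2(4)] 1(4) by blast
      thus ?thesis unfolding adm_def using 2 adm_n[OF fx] by blast
    next
      assume "L2 \<subseteq> L1"
      hence "x + y \<in> L1" using csubspace_add[OF s(1) 1(4)] 2(4) by blast
      thus ?thesis unfolding adm_def using 1 adm_n[OF fx] by blast
    qed
  qed
  have adm_T: "adm f (T y)" if f: "adm f y" and T: "T \<in> B" for f y T
  proof -
    obtain L M where LM: "L \<in> P" "M \<in> P" "L \<subset> M" "y \<in> L" "e0 \<in> L" "f \<in> ocomp M"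
      using f by (auto simp: adm_def)
    have "T y \<in> L" using nest_algebra_invariant[of T N L y] T LM inP by (simp add: BN)
    thus ?thesis unfolding adm_def using LM adm_n[OF f] by blast
  qed
  have idB: "blinfun_scaleC c id_blinfun \<in> B" for c unfolding BN by (intro nest_algebra_closed_under[OF N])
  have ga: "g (x + y) = g x + g y" if xD: "x \<in> D" and yD: "y \<in> D" for x y
  proof -
    obtain f where f: "adm f x" "adm f y" using adm2[OF xD yD] by blast
    have "W f (x + y) = W f x + W f y"
      by (simp add: W_def rank1_add_left \<delta>_add admB f blinfun.add_left)
    thus ?thesis using g[OF f(1)] g[OF f(2)] g[OF adm_add[OF f]] by (simp add: scaleC_add_right)
  qed
  have gs: "g (c *\<^sub>C x) = c *\<^sub>C g x" if xD: "x \<in> D" for c x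
  proof -
    obtain f where f: "adm f x" using adm2[OF xD xD] by blast
    have "adm f (c *\<^sub>C x)" using adm_T[OF f idB[of c]] by simp
    moreover have "W f (c *\<^sub>C x) = c *\<^sub>C W f x" by (simp add: W_def rank1_scaleC_left \<delta>_scaleC admB f)
    ultimately show ?thesis using g[OF f] g[of f "c *\<^sub>C x"]
      by (simp add: scaleC_diff_right scaleC_scaleC mult.commute)
  qed
  have gn: "norm (g x) \<le> (2 * C) * norm x" if xD: "x \<in> D" for x
  proof -
    obtain f where f: "adm f x" using adm2[OF xD xD] by blast
    have "norm (W f x) \<le> C * norm x" unfolding W_def by (rule norm_implement_le[OF adm_n[OF f] admB[OF f]])
    moreover have "norm (W f e0) \<le> C"
      using norm_implement_le[OF adm_n[OF f] admB[OF adm_e0[OF f]]] by (simp add: W_def e0)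
    hence "cmod (cinner (W f e0) e0) \<le> C" using Cauchy_Schwarz[of "W f e0" e0] by (simp add: e0)
    hence "norm (cinner (W f e0) e0 *\<^sub>C x) \<le> C * norm x" by (simp add: norm_scaleC mult_right_mono)
    ultimately show ?thesis
      using g[OF f] norm_triangle_ineq4[of "W f x" "cinner (W f e0) e0 *\<^sub>C x"] by simp
  qed
  obtain X where X: "X \<in> bounded_operators" "\<And>x. x \<in> D \<Longrightarrow> blinfun_apply X x = g x"
    using extend_to_closure[OF Dsub Ddense ga gs gn] by auto
  have "\<delta> T = (X o\<^sub>L T) - (T o\<^sub>L X)" if T: "T \<in> B" for T
  proof (rule blinfun_eqI)
    fix x
    have "closed {x. \<delta> T x = ((X o\<^sub>L T) - (T o\<^sub>L X)) x}"
      by (intro closed_Collect_eq continuous_intros)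
    moreover have "D \<subseteq> {x. \<delta> T x = ((X o\<^sub>L T) - (T o\<^sub>L X)) x}"
    proof
      fix y assume y: "y \<in> D"
      obtain f where f: "adm f y" using adm2[OF y y] by blast
      note fT = adm_T[OF f T]
      have TyD: "T y \<in> D" using fT by (auto simp: adm_def D_def)
      have "W f (T y) = \<delta> T y + T (W f y)" unfolding W_def by (rule implement[OF adm_n[OF f] admB[OF f] T])
      thus "y \<in> {x. \<delta> T x = ((X o\<^sub>L T) - (T o\<^sub>L X)) x}"
        using g[OF f] g[OF fT] X(2)[OF y] X(2)[OF TyD]
        by (simp add: blinfun.diff_left blinfun.diff_right bounded_operators_scaleC[OF B_bounded[OF T]])
    qed
    ultimately have "closure D \<subseteq> {x. \<delta> T x = ((X o\<^sub>L T) - (T o\<^sub>L X)) x}" by (rule closure_minimal[rotated])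
    thus "\<delta> T x = ((X o\<^sub>L T) - (T o\<^sub>L X)) x" using Ddense by blast
  qed
  thus ?thesis using X(1) by blast
qed

text \<open>If a unit vector \<open>f\<close> lies in every nonzero complement, all
  \<open>rank1 x f\<close> are in the algebra and \<open>inner_global\<close> applies at once.
  Otherwise the complements meet in zero and \<open>X\<close> is first defined on a dense
  subspace.\<close>

lemma inner_nest_algebra:
  assumes N: "nest N" and BN: "B = nest_algebra N" and \<delta>B: "\<And>T. T \<in> B \<Longrightarrow> \<delta> T \<in> B"
    and nz: "(UNIV :: 'a set) \<noteq> {0}"
  shows "\<exists>X\<in>B. \<forall>T\<in>B. \<delta> T = (X o\<^sub>L T) - (T o\<^sub>L X)"
proof -
  have "\<exists>X\<in>bounded_operators. \<forall>T\<in>B. \<delta> T = (X o\<^sub>L T) - (T o\<^sub>L X)"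
  proof (cases "\<Inter>{L \<in> ocomp ` N. L \<noteq> {0}} = {0}")
    case True
    show ?thesis by (rule inner_nest_algebra_limit[OF N BN True nz])
  next
    case False
    from nest_bottom_vector[OF nest_ocomp[OF N] False] obtain f where
      f: "norm f = 1" "\<forall>L\<in>ocomp ` N. L = {0} \<or> f \<in> L" by (elim exE conjE)
    have "rank1 x f \<in> B" for x
      unfolding BN
    proof (rule rank1_in_nest_algebra[OF N])
      fix M assume M: "M \<in> N"
      show "x \<in> M \<or> f \<in> ocomp M"
      proof (cases "ocomp M = {0}")
        case True
        hence "M = UNIV" using ocomp_ocomp[OF nest_closed_csubspace[OF N M]] by simp
        thus ?thesis by simp
      qed (use f(2) M in blast)
    qed
    thus ?thesis by (rule inner_global[OF f(1)])
  qed
  then obtain X where X: "X \<in> bounded_operators" "\<And>T. T \<in> B \<Longrightarrow> \<delta> T = (X o\<^sub>L T) - (T o\<^sub>L X)" by blast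
  have "X \<in> B"
    unfolding BN
  proof (rule nest_algebraI[OF X(1)])
    fix M x assume M: "M \<in> N" "x \<in> M"
    note cl = nest_closed_csubspace[OF N M(1)]
    have "proj M \<in> B" unfolding BN by (rule proj_in_nest_algebra[OF N M(1)])
    hence "(X o\<^sub>L proj M) - (proj M o\<^sub>L X) \<in> nest_algebra N" using \<delta>B[of "proj M"] X(2)[of "proj M"] BN by simp
    from nest_algebra_invariant[OF this M] have "X x - proj M (X x) \<in> M"
      by (simp add: blinfun.diff_left proj_id cl M)
    hence "(X x - proj M (X x)) + proj M (X x) \<in> M"
      using proj_in[OF cl] cl by (intro csubspace_add) (simp_all add: closed_csubspace_def)
    thus "X x \<in> M" by simp
  qed
  thus ?thesis using X(2) by blast
qed

end

section \<open>One-parameter groups of operators\<close>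

text \<open>The library's \<open>exp\<close> requires a unital normed algebra, but \<open>norm id_blinfun = 1\<close> fails on the trivial
  space.\<close>

primrec opow :: "('a::real_normed_vector \<Rightarrow>\<^sub>L 'a) \<Rightarrow> nat \<Rightarrow> ('a \<Rightarrow>\<^sub>L 'a)"
  where "opow X 0 = id_blinfun" | "opow X (Suc n) = X o\<^sub>L opow X n"

definition oexp :: "('a::banach \<Rightarrow>\<^sub>L 'a) \<Rightarrow> real \<Rightarrow> ('a \<Rightarrow>\<^sub>L 'a)"
  where "oexp X t = (\<Sum>n. (t ^ n / fact n) *\<^sub>R opow X n)"

lemma norm_opow: "norm (opow X n) \<le> norm X ^ n"
proof (induction n)
  case 0
  show ?case by (simp add: norm_blinfun_id_le)
next
  case (Suc n)
  have "norm (opow X (Suc n)) \<le> norm X * norm (opow X n)" by (simp add: norm_blinfun_compose)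
  also have "\<dots> \<le> norm X * norm X ^ n" by (intro mult_left_mono Suc) simp
  finally show ?case by simp
qed

lemma blinfun_compose_assoc: "(R o\<^sub>L S) o\<^sub>L T = R o\<^sub>L (S o\<^sub>L T)"
  by (rule blinfun_eqI) simp

lemma opow_commute: "opow X n o\<^sub>L X = X o\<^sub>L opow X n"
proof (induction n)
  case (Suc n)
  thus ?case by (simp add: blinfun_compose_assoc)
qed (simp add: blinfun_eqI)

lemma norm_oexp_term:
  assumes "\<bar>t\<bar> \<le> r"
  shows "norm ((t ^ n / fact n) *\<^sub>R opow X n) \<le> (r * norm X) ^ n /\<^sub>R fact n"
proof -
  have "norm ((t ^ n / fact n) *\<^sub>R opow X n) = (\<bar>t\<bar> ^ n / fact n) * norm (opow X n)"
    by (simp add: power_abs)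
  also have "\<dots> \<le> (r ^ n / fact n) * norm X ^ n"
    using assms by (intro mult_mono divide_right_mono power_mono norm_opow) auto
  finally show ?thesis by (simp add: power_mult_distrib divide_inverse mult_ac)
qed

lemma oexp_uniform_limit:
  "uniform_limit {-r..r} (\<lambda>n t. \<Sum>i<n. (t ^ i / fact i) *\<^sub>R opow X i) (oexp X) sequentially"
proof -
  have "uniform_limit {-r..r} (\<lambda>n t. \<Sum>i<n. (t ^ i / fact i) *\<^sub>R opow X i)
      (\<lambda>t. \<Sum>i. (t ^ i / fact i) *\<^sub>R opow X i) sequentially"
  proof (rule Weierstrass_m_test)
    show "norm ((t ^ n / fact n) *\<^sub>R opow X n) \<le> (r * norm X) ^ n /\<^sub>R fact n" if "t \<in> {-r..r}" for n t
      using that by (intro norm_oexp_term) auto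
    show "summable (\<lambda>n. (r * norm X) ^ n /\<^sub>R fact n)" by (rule summable_exp_generic)
  qed
  thus ?thesis by (simp add: oexp_def[abs_def])
qed

lemma oexp_sums: "(\<lambda>n. (t ^ n / fact n) *\<^sub>R opow X n) sums oexp X t"
  unfolding sums_def
  by (rule tendsto_uniform_limitI[OF oexp_uniform_limit[where r = "\<bar>t\<bar>"]]) auto

lemma oexp_zero: "oexp X 0 = id_blinfun"
proof -
  have "(\<lambda>n. (0 ^ n / fact n) *\<^sub>R opow X n) = (\<lambda>n. if n = 0 then id_blinfun else 0)" by auto
  hence "(\<lambda>n. if n = 0 then id_blinfun else 0) sums oexp X 0" using oexp_sums[of 0 X] by simp
  thus ?thesis using sums_unique2[OF _ sums_single[of 0 "\<lambda>_. id_blinfun"]] by metis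
qed

lemma oexp_commute: "oexp X t o\<^sub>L X = X o\<^sub>L oexp X t"
proof (rule sums_unique2)
  have bl: "bounded_linear (\<lambda>F. F o\<^sub>L X)" "bounded_linear (\<lambda>F. X o\<^sub>L F)"
    using bounded_bilinear.bounded_linear_left[OF bounded_bilinear_blinfun_compose]
      bounded_bilinear.bounded_linear_right[OF bounded_bilinear_blinfun_compose] by blast+
  show "(\<lambda>n. ((t ^ n / fact n) *\<^sub>R opow X n) o\<^sub>L X) sums (oexp X t o\<^sub>L X)"
    by (rule bounded_linear.sums[OF bl(1) oexp_sums])
  have "((t ^ n / fact n) *\<^sub>R opow X n) o\<^sub>L X = X o\<^sub>L ((t ^ n / fact n) *\<^sub>R opow X n)" for n
  proof (rule blinfun_eqI)
    fix v
    have "opow X n (X v) = X (opow X n v)" using arg_cong[OF opow_commute[of X n], of "\<lambda>F. F v"] by simp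
    thus "(((t ^ n / fact n) *\<^sub>R opow X n) o\<^sub>L X) v = (X o\<^sub>L ((t ^ n / fact n) *\<^sub>R opow X n)) v"
      by (simp add: blinfun.scaleR_left blinfun.scaleR_right)
  qed
  thus "(\<lambda>n. ((t ^ n / fact n) *\<^sub>R opow X n) o\<^sub>L X) sums (X o\<^sub>L oexp X t)"
    using bounded_linear.sums[OF bl(2) oexp_sums[of t X]] by simp
qed

lemma oexp_commute_apply: "oexp X t (X v) = X (oexp X t v)"
  using arg_cong[OF oexp_commute[of X t], of "\<lambda>F. F v"] by simp

lemma oexp_has_derivative:
  "(oexp X has_vector_derivative (X o\<^sub>L oexp X t)) (at t)"
proof -
  \<comment> \<open>A bounded open set around \<open>t\<close>, on which the exponential series
    converges uniformly.\<close>
  define S where "S = {-(\<bar>t\<bar> + 1)<..<\<bar>t\<bar> + 1}"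
  have tS: "t \<in> S" by (auto simp: S_def)
  define f where "f n s = (s ^ n / fact n) *\<^sub>R opow X n" for n and s :: real
  define f' where "f' n s h = h *\<^sub>R ((real n * s ^ (n - 1) / fact n) *\<^sub>R opow X n)" for n and s h :: real
  have f0: "f' 0 s h = 0" for s h by (simp add: f'_def)
  \<comment> \<open>The differentiated series is the original one composed with \<open>X\<close> and
    shifted by one index, which explains \<open>Suc n0\<close> below.\<close>
  have fS: "f' (Suc n) s h = h *\<^sub>R (X o\<^sub>L f n s)" for n s h
    by (rule blinfun_eqI)
       (simp add: f'_def f_def blinfun.scaleR_left blinfun.scaleR_right fact_Suc del: of_nat_Suc)
  have "\<exists>g. \<forall>s\<in>S. (\<lambda>n. f n s) sums g s \<and> (g has_derivative (\<lambda>h. h *\<^sub>R (X o\<^sub>L oexp X s))) (at s within S)"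
  proof (rule has_derivative_series[where f' = f'])
    show "convex S" by (simp add: S_def)
    show "(f n has_derivative f' n s) (at s within S)" if "s \<in> S" for n s
    proof -
      have "((\<lambda>s. s ^ n / fact n) has_real_derivative (real n * s ^ (n - 1) / fact n)) (at s within S)"
        by (auto intro!: derivative_eq_intros)
      from has_vector_derivative_scaleR[OF this has_vector_derivative_const, of "opow X n"]
      show ?thesis by (simp add: has_vector_derivative_def f_def[abs_def] f'_def[abs_def])
    qed
    show "t \<in> S" by (rule tS)
    show "(\<lambda>n. f n t) sums oexp X t" unfolding f_def by (rule oexp_sums)
    fix e :: real assume e: "e > 0"
    hence "e / (norm X + 1) > 0" by (simp add: add_nonneg_pos)
    from uniform_limitD[OF oexp_uniform_limit[where r = "\<bar>t\<bar> + 1" and X = X] this]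
    obtain n0 where n0: "\<And>n s. n \<ge> n0 \<Longrightarrow> s \<in> {-(\<bar>t\<bar>+1)..\<bar>t\<bar>+1} \<Longrightarrow>
      dist (\<Sum>i<n. (s ^ i / fact i) *\<^sub>R opow X i) (oexp X s) < e / (norm X + 1)"
      unfolding eventually_sequentially by blast
    show "\<forall>\<^sub>F n in sequentially. \<forall>s\<in>S. \<forall>h. norm ((\<Sum>i<n. f' i s h) - h *\<^sub>R (X o\<^sub>L oexp X s)) \<le> e * norm h"
      unfolding eventually_sequentially
    proof (intro exI[of _ "Suc n0"] allI impI ballI)
      fix n s h assume n: "Suc n0 \<le> n" and s: "s \<in> S"
      then obtain m where m: "n = Suc m" "m \<ge> n0" by (cases n) auto
      have "(\<Sum>i<n. f' i s h) = h *\<^sub>R (X o\<^sub>L (\<Sum>i<m. f i s))"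
        unfolding m(1) sum.lessThan_Suc_shift f0 fS
        by (simp add: scaleR_sum_right[symmetric] bounded_bilinear.sum_right[OF bounded_bilinear_blinfun_compose])
      hence "(\<Sum>i<n. f' i s h) - h *\<^sub>R (X o\<^sub>L oexp X s) = h *\<^sub>R (X o\<^sub>L ((\<Sum>i<m. f i s) - oexp X s))"
        by (simp add: scaleR_diff_right[symmetric] bounded_bilinear.diff_right[OF bounded_bilinear_blinfun_compose])
      hence "norm ((\<Sum>i<n. f' i s h) - h *\<^sub>R (X o\<^sub>L oexp X s)) \<le> \<bar>h\<bar> * (norm X * norm ((\<Sum>i<m. f i s) - oexp X s))"
        by (simp add: mult_left_mono norm_blinfun_compose)
      also have "\<dots> \<le> \<bar>h\<bar> * ((norm X + 1) * (e / (norm X + 1)))"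
        using n0[OF m(2), of s] s e
        by (intro mult_left_mono mult_mono) (auto simp: S_def f_def dist_norm less_imp_le)
      also have "\<dots> = e * norm h"
      proof -
        have "norm X + 1 \<noteq> 0" using norm_ge_zero[of X] by linarith
        thus ?thesis by simp
      qed
      finally show "norm ((\<Sum>i<n. f' i s h) - h *\<^sub>R (X o\<^sub>L oexp X s)) \<le> e * norm h" .
    qed
  qed
  then obtain g where g: "\<And>s. s \<in> S \<Longrightarrow> (\<lambda>n. f n s) sums g s"
    "\<And>s. s \<in> S \<Longrightarrow> (g has_derivative (\<lambda>h. h *\<^sub>R (X o\<^sub>L oexp X s))) (at s within S)" by blast
  have eq: "g s = oexp X s" if "s \<in> S" for s
    using sums_unique2[OF g(1)[OF that]] oexp_sums[of s X] by (simp add: f_def)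
  have "(oexp X has_derivative (\<lambda>h. h *\<^sub>R (X o\<^sub>L oexp X t))) (at t within S)"
    by (rule has_derivative_transform[OF tS _ g(2)[OF tS]]) (simp add: eq)
  moreover have "at t within S = at t" using tS by (intro at_within_open) (auto simp: S_def)
  ultimately show ?thesis by (simp add: has_vector_derivative_def)
qed

lemma oexp_continuous: "continuous_on S (oexp X)"
  by (meson continuous_on_subset[OF _ subset_UNIV] continuous_at_imp_continuous_on
      has_vector_derivative_continuous[OF oexp_has_derivative])

lemma oexp_minus_has_derivative:
  "((\<lambda>t. oexp X (- t)) has_vector_derivative - (oexp X (- t) o\<^sub>L X)) (at t)"
proof -
  have "((\<lambda>t. - t) has_vector_derivative (-1)) (at t)"
    by (auto intro!: derivative_eq_intros simp: has_vector_derivative_def)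
  from vector_diff_chain_at[OF this oexp_has_derivative[of X "- t"]]
  show ?thesis by (simp add: comp_def oexp_commute)
qed

lemma has_vector_derivative_zero_constant:
  fixes f :: "real \<Rightarrow> 'b::real_normed_vector"
  assumes "\<And>t. (f has_vector_derivative 0) (at t)"
  shows "f s = f t"
proof -
  have "\<exists>c. \<forall>x\<in>UNIV. f x = c"
  proof (rule has_derivative_zero_constant)
    show "(f has_derivative (\<lambda>h. 0)) (at x within UNIV)" for x
      using assms[of x] by (simp add: has_vector_derivative_def)
  qed simp
  thus ?thesis by auto
qed

lemma has_vector_derivative_compose3:
  assumes "(f has_vector_derivative f') (at t)" "(g has_vector_derivative g') (at t)"
    "(h has_vector_derivative h') (at t)"
  shows "((\<lambda>t. f t o\<^sub>L (g t o\<^sub>L h t)) has_vector_derivative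
    (f t o\<^sub>L ((g t o\<^sub>L h') + (g' o\<^sub>L h t))) + (f' o\<^sub>L (g t o\<^sub>L h t))) (at t)"
  by (intro bounded_bilinear.has_vector_derivative[OF bounded_bilinear_blinfun_compose] assms)

text \<open>The product of \<open>oexp X (s + u)\<close> and \<open>oexp X (- u)\<close> has
  derivative zero in \<open>u\<close>. Its constancy, used with \<open>s + t\<close> for
  \<open>s\<close> and \<open>- t\<close> for \<open>u\<close>, is the addition law.\<close>

lemma oexp_add: "oexp X s o\<^sub>L oexp X t = oexp X (s + t)"
proof -
  have shift: "((\<lambda>u. oexp X (s + u)) has_vector_derivative (oexp X (s + u) o\<^sub>L X)) (at u)" for s u
  proof -
    have "((\<lambda>u. s + u) has_vector_derivative 1) (at u)"
      by (auto intro!: derivative_eq_intros simp: has_vector_derivative_def)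
    from vector_diff_chain_at[OF this oexp_has_derivative[of X "s + u"]]
    show ?thesis by (simp add: comp_def oexp_commute)
  qed
  have const: "oexp X (s + u) o\<^sub>L oexp X (- u) = oexp X s" for s u
  proof -
    have "((\<lambda>u. oexp X (s + u) o\<^sub>L oexp X (- u)) has_vector_derivative 0) (at u)" for u
    proof -
      have "((\<lambda>u. oexp X (s + u) o\<^sub>L oexp X (- u)) has_vector_derivative
          ((oexp X (s + u) o\<^sub>L - (oexp X (- u) o\<^sub>L X)) + ((oexp X (s + u) o\<^sub>L X) o\<^sub>L oexp X (- u)))) (at u)"
        by (intro bounded_bilinear.has_vector_derivative[OF bounded_bilinear_blinfun_compose]
            shift oexp_minus_has_derivative)
      moreover have "(oexp X (s + u) o\<^sub>L - (oexp X (- u) o\<^sub>L X)) + ((oexp X (s + u) o\<^sub>L X) o\<^sub>L oexp X (- u)) = 0"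
        by (rule blinfun_eqI) (simp add: oexp_commute_apply blinfun.add_left blinfun.minus_left blinfun.minus_right)
      ultimately show ?thesis by simp
    qed
    from has_vector_derivative_zero_constant[OF this, of u 0] show ?thesis
      by (simp add: oexp_zero blinfun_eqI)
  qed
  from const[of "s + t" "- t"] have "oexp X s o\<^sub>L oexp X t = oexp X (s + t)" by simp
  thus ?thesis .
qed

lemma oexp_minus: "oexp X t o\<^sub>L oexp X (- t) = id_blinfun" "oexp X (- t) o\<^sub>L oexp X t = id_blinfun"
  by (simp_all add: oexp_add oexp_zero)

section \<open>Flows as conjugation by exponentials, and their cocycles\<close>

context uniform_flow
begin

lemma oexp_in: assumes "X \<in> B" shows "oexp X t \<in> B"
proof -
  have "opow X n \<in> B" for n by (induction n) (simp_all add: B_id B_compose assms)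
  hence "(\<Sum>i<n. (t ^ i / fact i) *\<^sub>R opow X i) \<in> B" for n
    by (induction n) (simp_all add: B_zero B_add B_scaleR)
  from closed_sequentially[OF B_closed this oexp_sums[of t X, unfolded sums_def]] show ?thesis .
qed

text \<open>Undoing the conjugation, \<open>g\<close> has derivative zero: the commutator produced
  by \<delta> cancels the derivatives of the two exponentials.\<close>

lemma \<alpha>_eq_oexp:
  assumes X: "X \<in> B" "\<And>T. T \<in> B \<Longrightarrow> \<delta> T = (X o\<^sub>L T) - (T o\<^sub>L X)" and T: "T \<in> B"
  shows "\<alpha> t T = oexp X t o\<^sub>L (T o\<^sub>L oexp X (- t))"
proof -
  define g where "g t = oexp X (- t) o\<^sub>L (\<alpha> t T o\<^sub>L oexp X t)" for t
  have "(g has_vector_derivative 0) (at t)" for t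
  proof -
    have "(g has_vector_derivative
       (oexp X (- t) o\<^sub>L ((\<alpha> t T o\<^sub>L (X o\<^sub>L oexp X t)) + (\<delta> (\<alpha> t T) o\<^sub>L oexp X t)))
        + (- (oexp X (- t) o\<^sub>L X) o\<^sub>L (\<alpha> t T o\<^sub>L oexp X t))) (at t)"
      unfolding g_def
      by (intro has_vector_derivative_compose3 oexp_minus_has_derivative \<alpha>_has_derivative oexp_has_derivative T)
    moreover have "(oexp X (- t) o\<^sub>L ((\<alpha> t T o\<^sub>L (X o\<^sub>L oexp X t)) + (\<delta> (\<alpha> t T) o\<^sub>L oexp X t)))
        + (- (oexp X (- t) o\<^sub>L X) o\<^sub>L (\<alpha> t T o\<^sub>L oexp X t)) = 0"
      by (rule blinfun_eqI)
         (simp add: X(2) \<alpha>_in T blinfun.add_left blinfun.diff_left blinfun.minus_left blinfun.add_right blinfun.diff_right)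
    ultimately show ?thesis by simp
  qed
  from has_vector_derivative_zero_constant[OF this, of t 0]
  have "g t = T" by (simp add: g_def oexp_zero \<alpha>_zero T blinfun_eqI)
  hence "oexp X t o\<^sub>L (T o\<^sub>L oexp X (- t)) = oexp X t o\<^sub>L ((oexp X (- t) o\<^sub>L (\<alpha> t T o\<^sub>L oexp X t)) o\<^sub>L oexp X (- t))"
    by (simp add: g_def)
  also have "\<dots> = (oexp X t o\<^sub>L oexp X (- t)) o\<^sub>L (\<alpha> t T o\<^sub>L (oexp X t o\<^sub>L oexp X (- t)))"
    by (simp add: blinfun_compose_assoc)
  also have "\<dots> = \<alpha> t T" by (simp add: oexp_minus blinfun_eqI)
  finally show ?thesis by simp
qed

lemma uniformly_continuous: "uniformly_continuous_flow B \<alpha>"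
  unfolding uniformly_continuous_flow_def
proof (intro conjI allI flow)
  fix t0
  obtain K where K: "\<And>S. S \<in> B \<Longrightarrow> norm (\<alpha> t0 S) \<le> K * norm S" using \<alpha>_bound[of t0] by auto
  define K' where "K' = \<bar>K\<bar> + 1"
  have K': "K' > 0" "\<And>S. S \<in> B \<Longrightarrow> norm (\<alpha> t0 S) \<le> K' * norm S"
  proof -
    show "K' > 0" by (simp add: K'_def)
    show "norm (\<alpha> t0 S) \<le> K' * norm S" if "S \<in> B" for S
      by (rule order_trans[OF K[OF that]], rule mult_right_mono) (auto simp: K'_def)
  qed
  show "((\<lambda>t. onorm_on B (\<lambda>T. \<alpha> t T - \<alpha> t0 T)) \<longlongrightarrow> 0) (at t0)"
  proof (rule LIM_I)
    fix r :: real assume r: "r > 0"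
    \<comment> \<open>Aiming at \<open>r / 2\<close> leaves the supremum strictly below
      \<open>r\<close>. The group law moves the estimate from time 0 to \<open>t0\<close> at the
      cost of the factor \<open>K'\<close>; at \<open>T = 0\<close> the quotient is 0 by
      convention.\<close>
    hence "r / (2 * K') > 0" using K' by simp
    from uniform[OF this] obtain d where d: "d > 0"
      "\<And>t T. \<bar>t\<bar> < d \<Longrightarrow> T \<in> B \<Longrightarrow> norm (\<alpha> t T - T) \<le> r / (2 * K') * norm T" by auto
    have "norm (onorm_on B (\<lambda>T. \<alpha> t T - \<alpha> t0 T) - 0) < r" if t: "t \<noteq> t0 \<and> norm (t - t0) < d" for t
    proof -
      have le: "norm (\<alpha> t T - \<alpha> t0 T) / norm T \<le> r / 2" if T: "T \<in> B" for T
      proof (cases "T = 0")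
        case False
        have "norm (\<alpha> t T - \<alpha> t0 T) = norm (\<alpha> (t - t0) (\<alpha> t0 T) - \<alpha> t0 T)"
          using \<alpha>_plus[OF T, of "t - t0" t0] by simp
        also have "\<dots> \<le> r / (2 * K') * norm (\<alpha> t0 T)" using t by (intro d \<alpha>_in T) auto
        also have "\<dots> \<le> r / (2 * K') * (K' * norm T)" using r K' T by (intro mult_left_mono) auto
        also have "\<dots> = r / 2 * norm T" using K'(1) by simp
        finally show ?thesis using False by (simp add: divide_le_eq)
      qed (use r in simp)
      have "onorm_on B (\<lambda>T. \<alpha> t T - \<alpha> t0 T) \<le> r / 2"
        unfolding onorm_on_def by (rule cSUP_least) (use B_zero le in auto)
      moreover have "0 \<le> onorm_on B (\<lambda>T. \<alpha> t T - \<alpha> t0 T)"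
        unfolding onorm_on_def
        by (rule cSUP_upper2[OF _ B_zero]) (use le in \<open>auto intro!: bdd_aboveI2[of _ _ "r/2"]\<close>)
      ultimately show ?thesis using r by simp
    qed
    thus "\<exists>s>0. \<forall>t. t \<noteq> t0 \<and> norm (t - t0) < s \<longrightarrow> norm (onorm_on B (\<lambda>T. \<alpha> t T - \<alpha> t0 T) - 0) < r"
      using d(1) by blast
  qed
qed

end

lemma cocycle_perturbation_of_oexp:
  assumes "uniform_flow B \<alpha>" "uniform_flow B \<beta>" and X: "X \<in> B" and Y: "Y \<in> B"
    and \<alpha>: "\<And>t T. T \<in> B \<Longrightarrow> \<alpha> t T = oexp X t o\<^sub>L (T o\<^sub>L oexp X (- t))"
    and \<beta>: "\<And>t T. T \<in> B \<Longrightarrow> \<beta> t T = oexp Y t o\<^sub>L (T o\<^sub>L oexp Y (- t))"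
  shows "cocycle_perturbation B \<alpha> \<beta>"
proof -
  interpret uniform_flow B \<alpha> by (rule assms)
  define u where "u t = oexp Y t o\<^sub>L oexp X (- t)" for t
  define v where "v t = oexp X t o\<^sub>L oexp Y (- t)" for t
  have uB: "u t \<in> B" "v t \<in> B" for t unfolding u_def v_def by (intro B_compose oexp_in X Y)+
  have XX: "oexp X s (oexp X (- s) z) = z" "oexp X (- s) (oexp X s z) = z" for s z
    using arg_cong[OF oexp_minus(1)[of X s], of "\<lambda>F. F z"] arg_cong[OF oexp_minus(2)[of X s], of "\<lambda>F. F z"] by simp_all
  have YY: "oexp Y s (oexp Y (- s) z) = z" "oexp Y (- s) (oexp Y s z) = z" for s z
    using arg_cong[OF oexp_minus(1)[of Y s], of "\<lambda>F. F z"] arg_cong[OF oexp_minus(2)[of Y s], of "\<lambda>F. F z"] by simp_all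
  have add: "oexp Z s (oexp Z t z) = oexp Z (s + t) z" for Z :: "'a \<Rightarrow>\<^sub>L 'a" and s t z
    using arg_cong[OF oexp_add[of Z s t], of "\<lambda>F. F z"] by simp
  have inv: "is_inverse_in B (u t) (v t)" for t
    unfolding is_inverse_in_def using uB
    by (auto intro!: blinfun_eqI simp: u_def v_def XX YY)
  have "cocycle B \<alpha> u"
    unfolding cocycle_def
  proof (intro conjI allI)
    show "u t \<in> invertibles B" for t using uB inv by (auto simp: invertibles_def)
    have "continuous_on UNIV (\<lambda>t. oexp X (- t))"
      by (rule continuous_on_compose2[OF oexp_continuous[of UNIV]]) (auto intro: continuous_intros)
    thus "continuous_on UNIV u"
      unfolding u_def[abs_def]
      by (intro bounded_bilinear.continuous_on[OF bounded_bilinear_blinfun_compose] oexp_continuous)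
    show "u s o\<^sub>L \<alpha> s (u t) = u (s + t)" for s t
    proof (rule blinfun_eqI)
      fix z
      \<comment> \<open>\<open>\<alpha> s\<close> conjugates \<open>u t\<close> by exponentials of
        \<open>X\<close>, and the left one cancels the right factor of \<open>u s\<close>.\<close>
      have "(u s o\<^sub>L \<alpha> s (u t)) z = oexp Y s (oexp Y t (oexp X (- t) (oexp X (- s) z)))"
        unfolding \<alpha>[OF uB(1)] by (simp add: u_def XX)
      also have "\<dots> = oexp Y (s + t) (oexp X (- t + - s) z)" unfolding add ..
      also have "- t + - s = - (s + t)" by simp
      finally show "(u s o\<^sub>L \<alpha> s (u t)) z = u (s + t) z" by (simp add: u_def)
    qed
  qed
  moreover have "\<beta> t T = u t o\<^sub>L \<alpha> t T o\<^sub>L inverse_in B (u t)" if T: "T \<in> B" for t T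
    unfolding inverse_in_eq[OF inv] \<alpha>[OF T] \<beta>[OF T]
    by (rule blinfun_eqI) (simp add: u_def v_def XX)
  ultimately show ?thesis unfolding cocycle_perturbation_def by blast
qed

section \<open>Flows on nest algebras and quasi-triangular algebras\<close>

text \<open>If uniformity at time 0 failed, there would be times \<open>t n\<close> tending to 0,
  each with a badly moved member of \<open>B\<close>. The maps \<open>\<alpha> (t k)\<close> form an
  \<open>approx_hom\<close>, whose theorem \<open>uniform\<close> excludes this.\<close>

lemma flow_uniform:
  fixes N :: "'a::chilbert_space set set"
  assumes N: "nest N" and sub: "nest_algebra N \<subseteq> B"
    and B: "\<And>T. T \<in> B \<Longrightarrow> T \<in> bounded_operators" "\<And>S T. S \<in> B \<Longrightarrow> T \<in> B \<Longrightarrow> S + T \<in> B"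
      "\<And>c T. T \<in> B \<Longrightarrow> blinfun_scaleC c T \<in> B" "\<And>S T. S \<in> B \<Longrightarrow> T \<in> B \<Longrightarrow> S o\<^sub>L T \<in> B" "closed B"
    and flow: "flow B \<alpha>"
  shows "uniform_flow B \<alpha>"
proof
  have aut: "bounded_automorphism B (\<alpha> t)" for t using flow by (simp add: flow_def)
  have in_B: "\<alpha> t T \<in> B" if "T \<in> B" for t T
    using aut[of t] that by (auto simp: bounded_automorphism_def bij_betw_def)
  show "id_blinfun \<in> B" using sub nest_algebra_closed_under(4)[OF N] by blast
  have \<alpha>0: "\<alpha> 0 T = T" if T: "T \<in> B" for T
  proof -
    have "\<alpha> 0 (\<alpha> 0 T) = \<alpha> (0 + 0) T" using flow T by (simp only: flow_def)
    moreover have "inj_on (\<alpha> 0) B" using aut[of 0] by (simp add: bounded_automorphism_def bij_betw_def)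
    ultimately show ?thesis using T in_B by (metis add_0 inj_onD)
  qed
  show "\<exists>\<delta>>0. \<forall>t. \<bar>t\<bar> < \<delta> \<longrightarrow> (\<forall>T\<in>B. norm (\<alpha> t T - T) \<le> \<eta> * norm T)" if \<eta>: "\<eta> > 0" for \<eta>
  proof (rule ccontr)
    assume "\<not> ?thesis"
    hence "\<exists>t. \<bar>t\<bar> < 1 / real (Suc n) \<and> (\<exists>T\<in>B. norm (\<alpha> t T - T) > \<eta> * norm T)" for n
      by (metis not_le of_nat_0_less_iff zero_less_Suc zero_less_divide_1_iff)
    then obtain t where t: "\<And>n. \<bar>t n\<bar> < 1 / real (Suc n)"
      "\<And>n. \<exists>T\<in>B. norm (\<alpha> (t n) T - T) > \<eta> * norm T" by metis
    have t0: "t \<longlonglongrightarrow> 0"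
    proof (rule tendsto_rabs_zero_cancel, rule tendsto_sandwich)
      show "(\<lambda>_. 0) \<longlonglongrightarrow> (0::real)" by simp
      show "(\<lambda>n. 1 / real (Suc n)) \<longlonglongrightarrow> 0"
        using LIMSEQ_inverse_real_of_nat by (simp add: inverse_eq_divide)
    qed (use t(1) less_imp_le in \<open>auto intro!: always_eventually\<close>)
    interpret approx_hom B "\<lambda>k. \<alpha> (t k)"
    proof
      fix S T k c
      assume T: "T \<in> B"
      show "T \<in> bounded_operators" "blinfun_scaleC c T \<in> B" by (rule B T)+
      show "\<alpha> (t k) T \<in> bounded_operators" by (rule B(1)[OF in_B[OF T]])
      show "\<alpha> (t k) (blinfun_scaleC c T) = blinfun_scaleC c (\<alpha> (t k) T)"
        using aut[of "t k"] T by (simp add: bounded_automorphism_def)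
      have "((\<lambda>s. \<alpha> s T) \<longlongrightarrow> \<alpha> 0 T) (at 0)"
        by (rule LIM_zero_cancel[OF tendsto_norm_zero_cancel]) (use flow T in \<open>simp add: flow_def\<close>)
      hence "isCont (\<lambda>s. \<alpha> s T) 0" by (simp add: isCont_def)
      from isCont_tendsto_compose[OF this t0] show "(\<lambda>k. \<alpha> (t k) T) \<longlonglongrightarrow> T" by (simp add: \<alpha>0 T)
      assume S: "S \<in> B"
      show "S + T \<in> B" "S o\<^sub>L T \<in> B" by (rule B S T)+
      show "\<alpha> (t k) (S + T) = \<alpha> (t k) S + \<alpha> (t k) T" "\<alpha> (t k) (S o\<^sub>L T) = \<alpha> (t k) S o\<^sub>L \<alpha> (t k) T"
        using aut[of "t k"] S T by (simp_all add: bounded_automorphism_def)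
    qed
    from uniform[OF N sub \<eta>] obtain k where "\<forall>T\<in>B. norm (err k T) \<le> \<eta> * norm T"
      by (auto simp: eventually_sequentially)
    thus False using t(2)[of k] by (auto simp: err_def not_le)
  qed
qed (use B flow in auto)

lemma flow_inner:
  fixes N :: "'a::chilbert_space set set"
  assumes N: "nest N" and B: "B = nest_algebra N \<or> B = quasitriangular_algebra N"
    and flow: "flow B \<alpha>"
  shows "uniform_flow B \<alpha>" "\<exists>X\<in>B. \<forall>t. \<forall>T\<in>B. \<alpha> t T = oexp X t o\<^sub>L (T o\<^sub>L oexp X (- t))"
proof -
  show uf: "uniform_flow B \<alpha>"
    using B
  proof
    assume "B = nest_algebra N"
    thus ?thesis using flow
      by (intro flow_uniform[OF N]) (auto simp: nest_algebra_bounded nest_algebra_closed_under[OF N] closed_nest_algebra[OF N])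
  next
    assume "B = quasitriangular_algebra N"
    thus ?thesis using flow
      by (intro flow_uniform[OF N])
         (auto simp: quasitriangular_closed_under[OF N] closed_quasitriangular_algebra[OF N]
           subsetD[OF nest_algebra_subset_quasitriangular])
  qed
  interpret uniform_flow B \<alpha> by (rule uf)
  obtain C where C: "\<And>S. S \<in> B \<Longrightarrow> norm (\<delta> S) \<le> C * norm S" using \<delta>_bound by blast
  interpret derivation B \<delta> C
    by unfold_locales
       (auto simp: B_bounded \<delta>_in \<delta>_compose \<delta>_scaleC \<delta>_add C)
  have "\<exists>X\<in>B. \<forall>T\<in>B. \<delta> T = (X o\<^sub>L T) - (T o\<^sub>L X)"
  proof (cases "(UNIV :: 'a set) = {0}")
    case True
    have z: "z = 0" for z :: 'a using UNIV_I[of z] unfolding True by simp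
    have "S = T" for S T :: "'a \<Rightarrow>\<^sub>L 'a" by (rule blinfun_eqI, rule trans[OF z z[symmetric]])
    thus ?thesis using B_zero by blast
  next
    case False
    from B show ?thesis
    proof
      assume "B = nest_algebra N"
      thus ?thesis using \<delta>_in False by (intro inner_nest_algebra[OF N]) auto
    next
      assume BQ: "B = quasitriangular_algebra N"
      \<comment> \<open>Rank-one operators are compact, so all of them lie in this algebra and any
        unit vector can play the part of \<open>f\<close>.\<close>
      obtain f :: 'a where f: "norm f = 1" using exists_unit[OF complex_vector.subspace_UNIV False] by blast
      have "rank1 x f \<in> B" for x
        using rank1_compact compact_subset_quasitriangular[OF N] by (auto simp: BQ)
      from inner_global[OF f this] obtain X where
        X: "X \<in> bounded_operators" "\<forall>T\<in>B. \<delta> T = (X o\<^sub>L T) - (T o\<^sub>L X)" by blast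
      have "almost_derives N X"
        unfolding almost_derives_def
      proof (intro conjI ballI X(1))
        fix T assume "T \<in> nest_algebra N"
        hence T: "T \<in> B" using nest_algebra_subset_quasitriangular BQ by blast
        have "(X o\<^sub>L T) - (T o\<^sub>L X) \<in> B" using \<delta>_in[OF T] X(2) T by simp
        thus "(X o\<^sub>L T) - (T o\<^sub>L X) \<in> closure (quasitriangular_algebra N)"
          using closure_subset BQ by blast
      qed
      hence "X \<in> B" unfolding BQ by (rule almost_derives_quasitriangular[OF N])
      thus ?thesis using X(2) by blast
    qed
  qed
  then obtain X where "X \<in> B" "\<And>T. T \<in> B \<Longrightarrow> \<delta> T = (X o\<^sub>L T) - (T o\<^sub>L X)" by blast
  thus "\<exists>X\<in>B. \<forall>t. \<forall>T\<in>B. \<alpha> t T = oexp X t o\<^sub>L (T o\<^sub>L oexp X (- t))"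
    using \<alpha>_eq_oexp by blast
qed

theorem theorem3p4:
  fixes N :: "'a::chilbert_space set set" and B :: "('a \<Rightarrow>\<^sub>L 'a) set"
  assumes "nest N"
    and "B = nest_algebra N \<or> B = quasitriangular_algebra N"
  shows "(\<forall>\<alpha>. flow B \<alpha> \<longrightarrow> uniformly_continuous_flow B \<alpha>) \<and>
    (\<forall>\<alpha> \<beta>. flow B \<alpha> \<longrightarrow> flow B \<beta> \<longrightarrow>
      cocycle_perturbation B \<alpha> \<beta> \<and> cocycle_perturbation B \<beta> \<alpha>)"
proof (intro conjI allI impI)
  note uf = flow_inner(1)[OF assms]
  show "uniformly_continuous_flow B \<alpha>" if "flow B \<alpha>" for \<alpha>
    by (rule uniform_flow.uniformly_continuous[OF uf[OF that]])
  have main: "cocycle_perturbation B \<alpha> \<beta>" if \<alpha>: "flow B \<alpha>" and \<beta>: "flow B \<beta>" for \<alpha> \<beta>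
  proof -
    obtain X where X: "X \<in> B" "\<And>t T. T \<in> B \<Longrightarrow> \<alpha> t T = oexp X t o\<^sub>L (T o\<^sub>L oexp X (- t))"
      using flow_inner(2)[OF assms \<alpha>] by blast
    obtain Y where Y: "Y \<in> B" "\<And>t T. T \<in> B \<Longrightarrow> \<beta> t T = oexp Y t o\<^sub>L (T o\<^sub>L oexp Y (- t))"
      using flow_inner(2)[OF assms \<beta>] by blast
    show ?thesis by (rule cocycle_perturbation_of_oexp[OF uf[OF \<alpha>] uf[OF \<beta>] X(1) Y(1) X(2) Y(2)])
  qed
  fix \<alpha> \<beta> assume "flow B \<alpha>" "flow B \<beta>"
  thus "cocycle_perturbation B \<alpha> \<beta>" "cocycle_perturbation B \<beta> \<alpha>" by (auto intro: main)
qed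

end
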